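(* Let $X$, $Y$, $(\mathcal{L},\tau)$, $M(X,\mathcal{L})$ and $M_0(X,\mathcal{L})$ be as in the context, and suppose that Assumption (A) stated there holds. Suppose that $M_0(X,\mathcal{L})\neq M(X,\mathcal{L})$. Then: (1) $M_0(X,\mathcal{L})^*$ is the strongly unique predual of $M(X,\mathcal{L})\simeq (M_0(X,\mathcal{L})^* )^*$ (under the canonical isometric identification described in the context). (2) $M_0(X,\mathcal{L})$ is not a strongly unique predual, that is, $M_0(X,\mathcal{L})$ is not the strongly unique predual of $M_0(X,\mathcal{L})^*$.
   Context: Setting. $X$ and $Y$ are Banach spaces, with $X$ separable and reflexive. $\mathcal{L}\subset B(X,Y)$ is a collection of bounded linear operators $L:X\to Y$, equipped with a topology $\tau$ such that $(\mathcal{L},\tau)$ is Hausdorff, $\sigma$-compact and locally compact, and such that for every $x\in X$ the map $L\mapsto Lx$ is continuous from $(\mathcal{L},\tau)$ to $Y$. The limit $L\to\infty$ means that $L$ escapes all compact subsets of $(\mathcal{L},\tau)$ (equivalently, $L$ tends to $\infty$ in the one-point compactification $\mathcal{L}\cup\{\infty\}$); thus $\varlimsup_{\mathcal{L}\ni L\to\infty}\|Lx\|_Y=\inf_{K}\sup_{L\in\mathcal{L}\setminus K}\|Lx\|_Y$, the infimum being over compact $K\subset\mathcal{L}$, with $\sup\emptyset=0$. Define $$M(X,\mathcal{L})=\{x\in X:\sup_{L\in\mathcal{L}}\|Lx\|_Y<\infty\},\qquad M_0(X,\mathcal{L})=\{x\in M(X,\mathcal{L}):\varlimsup_{\mathcal{L}\ni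 L\to\infty}\|Lx\|_Y=0\},$$ with norm $\|x\|_M=\sup_{L\in\mathcal{L}}\|Lx\|_Y$ on both. It is assumed that $M(X,\mathcal{L})$ is dense in $X$ in the $X$-norm, and that $M(X,\mathcal{L})$ is a Banach space under $\|\cdot\|_M$, continuously contained in $X$. Assumption (A). For every $x\in M(X,\mathcal{L})$ there is a bounded sequence $(x_n)_{n=1}^\infty$ in $M_0(X,\mathcal{L})$ such that $x_n$ converges weakly to $x$ in $X$ and $\sup_n\|x_n\|_M\le\|x\|_M$. Canonical identification $M_0^{**}\simeq M$ (a known fact under Assumption (A)): $X^*$ is continuously contained and dense in $M_0(X,\mathcal{L})^*$ (via restriction of functionals to $M_0(X,\mathcal{L})$); denoting by $I:M_0(X,\mathcal{L})^{**}\to X^{**}=X$ the adjoint of the inclusion $J:X^*\to M_0(X,\mathcal{L})^*$, the operator $I$ is an isometric isomorphism of $M_0(X,\mathcal{L})^{**}$ onto $M(X,\mathcal{L})$ which acts as the identity on $M_0(X,\mathcal{L})$. Strongly unique predual. A Banach space $Z$ is said to be the strongly unique predual of $Z^*$ if, for every Banach space $W$, every isometric isomorphism from $Z^*$ onto $W^*$ is the adjoint of an isometric isomorphism of $W$ onto $Z$. *)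

theory Defs
  imports "HOL-Analysis.Analysis" "HOL-Library.Function_Algebras"
begin

text \<open>Scalars: the field is \<open>\<real>\<close> or \<open>\<complex>\<close>, so that real and complex Banach spaces are treated at once.
  The assumption fixes the field, and multiplicativity of the norm then forces the norm to be
  the usual absolute value.\<close>

class real_or_complex = real_normed_field +
  assumes real_or_complex:
    "(\<forall>z. \<exists>a. z = a *\<^sub>R 1) \<or> (\<exists>i. i * i = - 1 \<and> (\<forall>z. \<exists>a b. z = a *\<^sub>R 1 + b *\<^sub>R i))"

instance real :: real_or_complex
  by standard simp

instance complex :: real_or_complex
proof
  have "\<forall>z. \<exists>a b. z = a *\<^sub>R 1 + b *\<^sub>R \<i>"
    by (metis complex_eq mult.commute mult.right_neutral scaleR_conv_of_real)
  moreover have "\<i> * \<i> = - 1" by simp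
  ultimately show "(\<forall>z::complex. \<exists>a. z = a *\<^sub>R 1) \<or>
      (\<exists>i::complex. i * i = - 1 \<and> (\<forall>z. \<exists>a b. z = a *\<^sub>R 1 + b *\<^sub>R i))"
    by blast
qed

text \<open>A scalar multiplication making the type \<open>'v\<close>, with its own norm, a normed space over \<open>'k\<close>.\<close>

definition normed_scaling :: "('k::real_or_complex \<Rightarrow> 'v::real_normed_vector \<Rightarrow> 'v) \<Rightarrow> bool" where
  "normed_scaling s \<longleftrightarrow> vector_space s \<and> (\<forall>r x. s (of_real r) x = r *\<^sub>R x) \<and>
     (\<forall>c x. norm (s c x) = norm c * norm x)"

text \<open>Normed spaces whose norm is not that of their type (\<open>M\<close>, \<open>M\<^sub>0\<close>), dual spaces, and the spaces
  quantified over in the definition of a strongly unique predual are given by a carrier and a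
  norm inside a vector space. The norm is unconstrained outside of the carrier.\<close>

record ('k, 'v) nspace =
  vecs :: "'v set"
  smul :: "'k \<Rightarrow> 'v \<Rightarrow> 'v"
  nrm :: "'v \<Rightarrow> real"

definition normed_space :: "('k::real_or_complex, 'v::ab_group_add) nspace \<Rightarrow> bool" where
  "normed_space Z \<longleftrightarrow> vector_space (smul Z) \<and> module.subspace (smul Z) (vecs Z) \<and>
     (\<forall>x\<in>vecs Z. 0 \<le> nrm Z x \<and> (nrm Z x = 0 \<longleftrightarrow> x = 0)) \<and>
     (\<forall>x\<in>vecs Z. \<forall>y\<in>vecs Z. nrm Z (x + y) \<le> nrm Z x + nrm Z y) \<and>
     (\<forall>c. \<forall>x\<in>vecs Z. nrm Z (smul Z c x) = norm c * nrm Z x)"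

definition banach_space :: "('k::real_or_complex, 'v::ab_group_add) nspace \<Rightarrow> bool" where
  "banach_space Z \<longleftrightarrow> normed_space Z \<and>
     (\<forall>\<sigma>. (\<forall>n. \<sigma> n \<in> vecs Z) \<and> (\<forall>e>0. \<exists>N. \<forall>m\<ge>N. \<forall>n\<ge>N. nrm Z (\<sigma> m - \<sigma> n) < e) \<longrightarrow>
          (\<exists>x\<in>vecs Z. (\<lambda>n. nrm Z (\<sigma> n - x)) \<longlonglongrightarrow> (0::real)))"

definition type_space :: "('k \<Rightarrow> 'v \<Rightarrow> 'v) \<Rightarrow> ('k, 'v::real_normed_vector) nspace" where
  "type_space s = \<lparr>vecs = UNIV, smul = s, nrm = norm\<rparr>"

definition linear_map ::
  "('k, 'v::ab_group_add) nspace \<Rightarrow> ('k, 'w::ab_group_add) nspace \<Rightarrow> ('v \<Rightarrow> 'w) \<Rightarrow> bool" where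
  "linear_map Z W T \<longleftrightarrow> T ` vecs Z \<subseteq> vecs W \<and>
     (\<forall>x\<in>vecs Z. \<forall>y\<in>vecs Z. T (x + y) = T x + T y) \<and>
     (\<forall>c. \<forall>x\<in>vecs Z. T (smul Z c x) = smul W c (T x))"

definition isometric_iso ::
  "('k, 'v::ab_group_add) nspace \<Rightarrow> ('k, 'w::ab_group_add) nspace \<Rightarrow> ('v \<Rightarrow> 'w) \<Rightarrow> bool" where
  "isometric_iso Z W T \<longleftrightarrow> linear_map Z W T \<and> bij_betw T (vecs Z) (vecs W) \<and>
     (\<forall>x\<in>vecs Z. nrm W (T x) = nrm Z x)"

text \<open>Functionals are made to vanish off the carrier, so that a functional is determined by
  its values on the carrier.\<close>

definition dual :: "('k::real_or_complex, 'v::ab_group_add) nspace \<Rightarrow> ('k, 'v \<Rightarrow> 'k) nspace" where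
  "dual Z =
     \<lparr>vecs = {f. (\<forall>x\<in>vecs Z. \<forall>y\<in>vecs Z. f (x + y) = f x + f y) \<and>
                 (\<forall>c. \<forall>x\<in>vecs Z. f (smul Z c x) = c * f x) \<and>
                 (\<exists>C. \<forall>x\<in>vecs Z. norm (f x) \<le> C * nrm Z x) \<and>
                 (\<forall>x. x \<notin> vecs Z \<longrightarrow> f x = 0)},
      smul = (\<lambda>c f x. c * f x),
      nrm = (\<lambda>f. Sup {norm (f x) | x. x \<in> vecs Z \<and> nrm Z x \<le> 1})\<rparr>"

text \<open>The adjoint \<open>Z* \<rightarrow> W*\<close> of \<open>S : W \<rightarrow> Z\<close>; it needs only the domain \<open>W\<close> of \<open>S\<close>.\<close>

definition adjoint_map ::
  "('k::zero, 'w) nspace \<Rightarrow> ('w \<Rightarrow> 'v) \<Rightarrow> ('v \<Rightarrow> 'k) \<Rightarrow> ('w \<Rightarrow> 'k)" where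
  "adjoint_map W S f = (\<lambda>w. if w \<in> vecs W then f (S w) else 0)"

definition bidual_embed ::
  "('k::real_or_complex, 'v::ab_group_add) nspace \<Rightarrow> 'v \<Rightarrow> (('v \<Rightarrow> 'k) \<Rightarrow> 'k)" where
  "bidual_embed Z x = (\<lambda>f. if f \<in> vecs (dual Z) then f x else 0)"

definition reflexive_space :: "('k::real_or_complex, 'v::ab_group_add) nspace \<Rightarrow> bool" where
  "reflexive_space Z \<longleftrightarrow> bidual_embed Z ` vecs Z = vecs (dual (dual Z))"

text \<open>As HOL cannot quantify over types inside a formula, the type of the competing preduals \<open>W\<close>
  is a parameter. A positive statement is to be made for arbitrary \<open>'w\<close>. In a negative one,
  any choice of \<open>'w\<close> gives at least the failure of strong uniqueness among all Banach spaces; for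
  \<open>Z = M\<^sub>0\<close> the type of \<open>X\<close> suffices, because a predual \<open>W\<close> of \<open>M\<^sub>0*\<close> embeds into \<open>W** \<simeq> M\<^sub>0** \<simeq> M \<subseteq> X\<close>.\<close>

definition strongly_unique_predual ::
  "'w::ab_group_add itself \<Rightarrow> ('k::real_or_complex, 'v::ab_group_add) nspace \<Rightarrow> bool" where
  "strongly_unique_predual _ Z \<longleftrightarrow>
     (\<forall>W :: ('k, 'w) nspace. banach_space W \<longrightarrow>
        (\<forall>T. isometric_iso (dual Z) (dual W) T \<longrightarrow>
           (\<exists>S. isometric_iso W Z S \<and> (\<forall>f\<in>vecs (dual Z). T f = adjoint_map W S f))))"

definition sigma_compact_space :: "'a topology \<Rightarrow> bool" where
  "sigma_compact_space \<tau> \<longleftrightarrow>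
     (\<exists>\<K>. countable \<K> \<and> (\<forall>K\<in>\<K>. compactin \<tau> K) \<and> \<Union>\<K> = topspace \<tau>)"

text \<open>The suprema are taken in \<open>[0,\<infinity>]\<close>, where \<open>sup \<emptyset> = 0\<close>.\<close>

definition sup_norm ::
  "('x::real_normed_vector \<Rightarrow>\<^sub>L 'y::real_normed_vector) set \<Rightarrow> 'x \<Rightarrow> ennreal" where
  "sup_norm \<L> x = (SUP L\<in>\<L>. ennreal (norm (blinfun_apply L x)))"

definition limsup_at_infinity ::
  "('x::real_normed_vector \<Rightarrow>\<^sub>L 'y::real_normed_vector) topology \<Rightarrow> 'x \<Rightarrow> ennreal" where
  "limsup_at_infinity \<tau> x = (INF K\<in>{K. compactin \<tau> K}. sup_norm (topspace \<tau> - K) x)"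

definition M_space ::
  "('k \<Rightarrow> 'x \<Rightarrow> 'x) \<Rightarrow> ('x::real_normed_vector \<Rightarrow>\<^sub>L 'y::real_normed_vector) set \<Rightarrow> ('k, 'x) nspace" where
  "M_space s \<L> =
     \<lparr>vecs = {x. sup_norm \<L> x < \<infinity>}, smul = s, nrm = (\<lambda>x. enn2real (sup_norm \<L> x))\<rparr>"

definition M0_space ::
  "('k \<Rightarrow> 'x \<Rightarrow> 'x) \<Rightarrow> ('x::real_normed_vector \<Rightarrow>\<^sub>L 'y::real_normed_vector) topology \<Rightarrow> ('k, 'x) nspace" where
  "M0_space s \<tau> =
     \<lparr>vecs = {x \<in> vecs (M_space s (topspace \<tau>)). limsup_at_infinity \<tau> x = 0},
      smul = s, nrm = nrm (M_space s (topspace \<tau>))\<rparr>"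

text \<open>The boundedness of the sequence in \<open>M\<^sub>0\<close> is contained in the bound by the norm of \<open>x\<close>.\<close>

definition assumption_A ::
  "('k::real_or_complex \<Rightarrow> 'x \<Rightarrow> 'x) \<Rightarrow>
   ('x::real_normed_vector \<Rightarrow>\<^sub>L 'y::real_normed_vector) topology \<Rightarrow> bool" where
  "assumption_A s \<tau> \<longleftrightarrow>
     (\<forall>x\<in>vecs (M_space s (topspace \<tau>)). \<exists>\<sigma>::nat \<Rightarrow> 'x.
        (\<forall>n. \<sigma> n \<in> vecs (M0_space s \<tau>)) \<and>
        (\<forall>f\<in>vecs (dual (type_space s)). (\<lambda>n. f (\<sigma> n)) \<longlonglongrightarrow> f x) \<and>
        (\<forall>n. nrm (M_space s (topspace \<tau>)) (\<sigma> n) \<le> nrm (M_space s (topspace \<tau>)) x))"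

text \<open>The canonical map \<open>I : M\<^sub>0** \<rightarrow> X** = X\<close>, where \<open>J : X* \<rightarrow> M\<^sub>0*\<close> is the restriction of functionals,
  i.e. the adjoint of the inclusion of \<open>M\<^sub>0\<close> in \<open>X\<close>.\<close>

definition canonical_I ::
  "('k::real_or_complex \<Rightarrow> 'x \<Rightarrow> 'x) \<Rightarrow>
   ('x::real_normed_vector \<Rightarrow>\<^sub>L 'y::real_normed_vector) topology \<Rightarrow>
   (('x \<Rightarrow> 'k) \<Rightarrow> 'k) \<Rightarrow> 'x" where
  "canonical_I s \<tau> \<Phi> =
     (let J = adjoint_map (M0_space s \<tau>) (\<lambda>x. x)
      in inv_into UNIV (bidual_embed (type_space s)) (adjoint_map (dual (type_space s)) J \<Phi>))"

end

theory Submission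
  imports Defs
begin

text \<open>A gliding hump argument shows that a functional on \<open>M\<^sub>0\<close> is small on \<open>X\<close>-null sequences that are
  bounded in \<open>M\<close>; by Hahn--Banach \<open>X*\<close> is then dense in \<open>M\<^sub>0*\<close>, and with Assumption (A) and reflexivity
  \<open>M\<^sub>0** = M\<close>. A second gliding hump yields, for \<open>x\<close> in the unit ball of \<open>M\<close>, a sequence \<open>\<sigma>\<^sub>n\<close> in \<open>M\<^sub>0\<close> with
  \<open>\<sigma>\<^sub>n \<rightarrow> x\<close> weak* and \<open>limsup \<parallel>y + a (x - \<sigma>\<^sub>n)\<parallel> \<le> 1\<close> for \<open>y\<close> in the unit ball of \<open>M\<^sub>0\<close> and \<open>\<bar>a\<bar> \<le> 1\<close>, so that
  \<open>M\<^sub>0\<close> is an M-ideal in \<open>M\<close>.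

  (1) If \<open>W* = M\<close> isometrically, then \<open>\<sigma>\<^sub>n\<close> also converges to some \<open>x'\<close> in the weak* topology of \<open>W*\<close>,
  and \<open>\<parallel>y + (x - x')\<parallel> \<le> 1\<close> for all \<open>y\<close> in the unit ball of \<open>M\<^sub>0\<close>, hence of \<open>M\<close>; this forces \<open>x = x'\<close>. So the
  elements of \<open>W\<close> are determined on \<open>M\<close> by their restrictions to \<open>M\<^sub>0\<close>, i.e. lie in \<open>M\<^sub>0*\<close>.

  (2) For \<open>x\<^sub>0\<close> of norm one in \<open>M\<close> but not in \<open>M\<^sub>0\<close> and \<open>\<phi>\<close> in \<open>M\<^sub>0*\<close> with \<open>0 < \<parallel>\<phi>\<parallel> \<le> 1/2\<close>, the space
  \<open>W = {y + \<phi> y x\<^sub>0 | y \<in> M\<^sub>0}\<close> is a second predual of \<open>M\<^sub>0*\<close> inside \<open>M\<close>.\<close>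

section \<open>Hahn--Banach theorems\<close>

text \<open>The obstacle in (1) is that a competing predual \<open>W\<close> puts its own weak*
  topology on \<open>M\<close>, a priori unrelated to the one coming from M_0*. Only the norm is
  shared, and it is lower semicontinuous for both topologies, so a norm inequality that holds along
  a sequence survives a limit in either of them. The inequality ||y + u|| \<le> 1 with u = x - x' is
  contradictory for y = u / ||u||, where the left side is 1 + ||u||. In (2) the point is that
  \<open>W\<close> still norms M_0*. Each y in M_0 is a weak* limit of elements y + c_n (x_0 -
  \<sigma>_n) of \<open>W\<close>, and the M-ideal inequality keeps their norms asymptotically below
  1 when ||y|| \<le> 1. The bound 1/2 on ||\<phi>|| puts the limit of c_n into the unit disc and
  makes \<open>W\<close> isomorphic to M_0, hence complete. If the resulting isometry of M_0* onto
  W* were an adjoint, \<open>W\<close> would be contained in M_0, which x_0 prevents. Spaces are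
  carriers with their own norms, since \<open>M\<close> and \<open>W\<close> carry norms other than
  that of the ambient type; the tools of functional analysis are therefore stated for carriers and
  for both scalar fields.\<close>

lemma real_hahn_banach:
  fixes s :: "real \<Rightarrow> 'v::ab_group_add \<Rightarrow> 'v" and p :: "'v \<Rightarrow> real"
  assumes "vector_space s" and E: "module.subspace s E"
    and p_add: "\<And>x y. x \<in> E \<Longrightarrow> y \<in> E \<Longrightarrow> p (x + y) \<le> p x + p y"
    and p_scale: "\<And>r x. x \<in> E \<Longrightarrow> 0 < r \<Longrightarrow> p (s r x) = r * p x"
    and F: "module.subspace s F" "F \<subseteq> E"
    and f_add: "\<And>x y. x \<in> F \<Longrightarrow> y \<in> F \<Longrightarrow> f (x + y) = f x + f y"
    and f_scale: "\<And>r x. x \<in> F \<Longrightarrow> f (s r x) = r * f x"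
    and f_le: "\<And>x. x \<in> F \<Longrightarrow> f x \<le> p x"
  obtains g where "\<And>x y. x \<in> E \<Longrightarrow> y \<in> E \<Longrightarrow> g (x + y) = g x + g y"
    "\<And>r x. x \<in> E \<Longrightarrow> g (s r x) = r * g x"
    "\<And>x. x \<in> F \<Longrightarrow> g x = f x" "\<And>x. x \<in> E \<Longrightarrow> g x \<le> p x"
proof -
  interpret vector_space s by fact
  \<comment> \<open>Extensions are ordered as graphs, so that the union of a chain is again a
    candidate. Single-valuedness is not imposed on a graph: it follows from linearity and domination
    by \<open>p\<close>, see \<open>uniq\<close> below.\<close>
  define \<G> where "\<G> = {G. (\<lambda>x. (x, f x)) ` F \<subseteq> G \<and> (\<forall>x r. (x, r) \<in> G \<longrightarrow> x \<in> E \<and> r \<le> p x) \<and>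
     (\<forall>x r y t. (x, r) \<in> G \<longrightarrow> (y, t) \<in> G \<longrightarrow> (x + y, r + t) \<in> G) \<and>
     (\<forall>c x r. (x, r) \<in> G \<longrightarrow> (s c x, c * r) \<in> G)}"
  have "(\<lambda>x. (x, f x)) ` F \<in> \<G>"
    using F f_le unfolding \<G>_def
    by (auto simp: image_iff f_add f_scale intro: subspace_add subspace_scale)
  then have "\<G> \<noteq> {}" by blast
  moreover have "\<Union>C \<in> \<G>" if C: "C \<noteq> {}" "subset.chain \<G> C" for C
  proof -
    have CG: "G \<in> \<G>" if "G \<in> C" for G
      using C that by (auto simp: subset.chain_def)
    have lin: "G \<subseteq> H \<or> H \<subseteq> G" if "G \<in> C" "H \<in> C" for G H
      using C that by (auto simp: subset.chain_def)
    have "(x + y, r + t) \<in> \<Union>C" if xr: "(x, r) \<in> \<Union>C" and yt: "(y, t) \<in> \<Union>C" for x r y t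
    proof -
      obtain G H where GH: "G \<in> C" "(x, r) \<in> G" "H \<in> C" "(y, t) \<in> H"
        using xr yt by blast
      then have "G \<union> H \<in> C" using lin[OF GH(1,3)] by (auto simp: Un_absorb1 Un_absorb2)
      moreover have "(x, r) \<in> G \<union> H" "(y, t) \<in> G \<union> H" using GH by auto
      ultimately show ?thesis using CG unfolding \<G>_def by blast
    qed
    moreover have "(s c x, c * r) \<in> \<Union>C" if xr: "(x, r) \<in> \<Union>C" for c x r
      using xr CG unfolding \<G>_def by blast
    moreover have "x \<in> E \<and> r \<le> p x" if xr: "(x, r) \<in> \<Union>C" for x r
      using xr CG unfolding \<G>_def by blast
    moreover have "(\<lambda>x. (x, f x)) ` F \<subseteq> \<Union>C"
      using C(1) CG unfolding \<G>_def by blast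
    ultimately show ?thesis unfolding \<G>_def by blast
  qed
  ultimately obtain G where G: "G \<in> \<G>" and max: "\<And>H. H \<in> \<G> \<Longrightarrow> G \<subseteq> H \<Longrightarrow> H = G"
    using subset_Zorn_nonempty[of \<G>] by blast
  have GF: "\<And>x. x \<in> F \<Longrightarrow> (x, f x) \<in> G" and GE: "\<And>x r. (x, r) \<in> G \<Longrightarrow> x \<in> E"
    and Gp: "\<And>x r. (x, r) \<in> G \<Longrightarrow> r \<le> p x"
    and Gadd: "\<And>x r y t. (x, r) \<in> G \<Longrightarrow> (y, t) \<in> G \<Longrightarrow> (x + y, r + t) \<in> G"
    and Gscale: "\<And>c x r. (x, r) \<in> G \<Longrightarrow> (s c x, c * r) \<in> G"
    using G unfolding \<G>_def by blast+
  have "f 0 = 0" using f_scale[of 0 0] subspace_0[OF F(1)] by simp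
  then have G0: "(0, 0) \<in> G" using GF[OF subspace_0[OF F(1)]] by simp
  have dom: "\<exists>r. (v, r) \<in> G" if v: "v \<in> E" for v
  proof -
    \<comment> \<open>A value \<alpha> of the extension at \<open>v\<close> must lie above every r -
      p (x - v) and below every p (y + v) - t. Subadditivity of \<open>p\<close> separates the two
      families, and \<alpha> is the supremum of the lower one.\<close>
    define B where "B = {r - p (x - v) | x r. (x, r) \<in> G}"
    have le: "r - p (x - v) \<le> p (y + v) - t" if "(x, r) \<in> G" "(y, t) \<in> G" for x r y t
    proof -
      have "r + t \<le> p (x + y)" using Gp Gadd that by blast
      also have "\<dots> = p ((x - v) + (y + v))" by simp
      also have "\<dots> \<le> p (x - v) + p (y + v)"
        using that GE v E by (intro p_add subspace_diff subspace_add) auto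
      finally show ?thesis by simp
    qed
    define \<alpha> where "\<alpha> = Sup B"
    have "B \<noteq> {}" using G0 unfolding B_def by blast
    moreover have "bdd_above B" unfolding B_def using le[OF _ G0] by (intro bdd_aboveI) blast
    ultimately have a1: "r - p (x - v) \<le> \<alpha>" and a2: "\<alpha> \<le> p (x + v) - r" if "(x, r) \<in> G" for x r
      using that le unfolding \<alpha>_def
      by (auto intro!: cSup_upper cSup_least simp: B_def)
    define H where "H = {(x + s c v, r + c * \<alpha>) | x r c. (x, r) \<in> G}"
    have GH: "G \<subseteq> H"
    proof
      fix z assume z: "z \<in> G"
      obtain x r where xr: "z = (x, r)" by (cases z)
      then have "z = (x + s 0 v, r + 0 * \<alpha>)" by simp
      with z xr show "z \<in> H" unfolding H_def by blast
    qed
    have Hp: "r + c * \<alpha> \<le> p (x + s c v)" if xr: "(x, r) \<in> G" for x r c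
    proof (cases c "0::real" rule: linorder_cases)
      case equal
      then show ?thesis using Gp xr by simp
    next
      case greater
      have "r + c * \<alpha> = c * (inverse c * r + \<alpha>)" using greater by (simp add: field_simps)
      also have "\<dots> \<le> c * p (s (inverse c) x + v)"
        using a2[OF Gscale[OF xr, of "inverse c"]] greater by (intro mult_left_mono) auto
      also have "\<dots> = p (s c (s (inverse c) x + v))"
        using greater GE[OF xr] v E by (subst p_scale) (auto intro: subspace_add subspace_scale)
      also have "\<dots> = p (x + s c v)" using greater by (simp add: scale_right_distrib)
      finally show ?thesis .
    next
      case less
      define d where "d = - c"
      have d: "d > 0" using less d_def by simp
      have "r + c * \<alpha> = d * (inverse d * r - \<alpha>)" using d by (simp add: field_simps d_def)
      also have "\<dots> \<le> d * p (s (inverse d) x - v)"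
        using a1[OF Gscale[OF xr, of "inverse d"]] d by (intro mult_left_mono) auto
      also have "\<dots> = p (s d (s (inverse d) x - v))"
        using d GE[OF xr] v E by (subst p_scale) (auto intro: subspace_diff subspace_scale)
      also have "\<dots> = p (x + s c v)" using d by (simp add: scale_right_diff_distrib d_def)
      finally show ?thesis .
    qed
    have "H \<in> \<G>"
      unfolding \<G>_def mem_Collect_eq
    proof (intro conjI allI impI)
      show "(\<lambda>x. (x, f x)) ` F \<subseteq> H" using GF GH by blast
      show "x \<in> E" if "(x, r) \<in> H" for x r
        using that GE v E unfolding H_def by (auto intro: subspace_add subspace_scale)
      show "r \<le> p x" if "(x, r) \<in> H" for x r
        using that Hp unfolding H_def by blast
      show "(x + y, r + t) \<in> H" if xr: "(x, r) \<in> H" and yt: "(y, t) \<in> H" for x r y t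
      proof -
        obtain x' r' c y' t' d where *: "x = x' + s c v" "r = r' + c * \<alpha>" "(x', r') \<in> G"
          "y = y' + s d v" "t = t' + d * \<alpha>" "(y', t') \<in> G"
          using xr yt unfolding H_def by blast
        then have "x + y = (x' + y') + s (c + d) v" "r + t = (r' + t') + (c + d) * \<alpha>"
          by (simp_all add: scale_left_distrib algebra_simps)
        with Gadd[OF *(3,6)] show ?thesis unfolding H_def by blast
      qed
      show "(s c x, c * r) \<in> H" if xr: "(x, r) \<in> H" for c x r
      proof -
        obtain x' r' d where *: "x = x' + s d v" "r = r' + d * \<alpha>" "(x', r') \<in> G"
          using xr unfolding H_def by blast
        then have "s c x = s c x' + s (c * d) v" "c * r = c * r' + (c * d) * \<alpha>"
          by (simp_all add: scale_right_distrib algebra_simps)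
        with Gscale[OF *(3), of c] show ?thesis unfolding H_def by blast
      qed
    qed
    with max GH have "H = G" by blast
    moreover have "(0 + s 1 v, 0 + 1 * \<alpha>) \<in> H" using G0 unfolding H_def by blast
    ultimately show ?thesis by auto
  qed
  \<comment> \<open>Two values over one point put (0, r' - t') into the graph. Positive homogeneity
    gives \<open>p 0 = 0\<close>, hence r' \<le> t', and the situation is symmetric.\<close>
  have uniq: "r = t" if "(x, r) \<in> G" "(x, t) \<in> G" for x r t
  proof -
    have le: "r' \<le> t'" if "(x, r') \<in> G" "(x, t') \<in> G" for r' t'
    proof -
      have "(s 1 x + s (-1) x, 1 * r' + (-1) * t') \<in> G"
        using that by (intro Gadd Gscale)
      then have *: "(0, r' - t') \<in> G" by simp
      have "(s 2 0, 2 * 0) \<in> G" using G0 Gscale by blast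
      have "p 0 = p (s 2 0)" by simp
      also have "\<dots> = 2 * p 0" using subspace_0[OF E] by (intro p_scale) auto
      finally show ?thesis using Gp[OF *] by simp
    qed
    show ?thesis using le[OF that] le[OF that(2,1)] by simp
  qed
  define g where "g x = (THE r. (x, r) \<in> G)" for x
  have g: "g x = r" if "(x, r) \<in> G" for x r
    using that uniq unfolding g_def by blast
  have gG: "(x, g x) \<in> G" if "x \<in> E" for x
    using dom[OF that] g by auto
  show thesis
  proof
    show "g (x + y) = g x + g y" if "x \<in> E" "y \<in> E" for x y
      using that gG Gadd g by blast
    show "g (s r x) = r * g x" if "x \<in> E" for r x
      using that gG Gscale g by blast
    show "g x = f x" if "x \<in> F" for x using that GF g by blast
    show "g x \<le> p x" if "x \<in> E" for x using that gG Gp by blast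
  qed
qed

text \<open>Multiplicativity forces the copy of the complex numbers to be isometric: the crude bound
  |\<phi> z| \<le> 2 |z|, applied to z^n, gives |\<phi> z|^n \<le> 2 |z|^n, so the factor 2
  disappears for large n; the bound for 1 / z then yields the reverse inequality.\<close>

lemma real_or_complex_scalars:
  obtains (real) "\<forall>z::'k::real_or_complex. \<exists>a. z = of_real a"
  | (complex) \<phi> :: "complex \<Rightarrow> 'k::real_or_complex" where "\<And>z w. \<phi> (z + w) = \<phi> z + \<phi> w"
    "\<And>z w. \<phi> (z * w) = \<phi> z * \<phi> w" "\<And>r. \<phi> (of_real r) = of_real r"
    "bij \<phi>" "\<And>z. norm (\<phi> z) = norm z"
proof -
  consider "\<forall>z::'k. \<exists>a. z = a *\<^sub>R 1" | i where "(i::'k) * i = - 1" "\<forall>z. \<exists>a b. z = a *\<^sub>R 1 + b *\<^sub>R i"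
    using real_or_complex by blast
  then show thesis
  proof cases
    case 1
    then show thesis using real by (auto simp: of_real_def)
  next
    case 2
    define \<phi> where "\<phi> z = of_real (Re z) + of_real (Im z) * i" for z
    have add: "\<phi> (z + w) = \<phi> z + \<phi> w" for z w
      by (simp add: \<phi>_def algebra_simps)
    have mult: "\<phi> (z * w) = \<phi> z * \<phi> w" for z w
    proof -
      have "\<phi> z * \<phi> w = of_real (Re z * Re w) + of_real (Im z * Im w) * (i * i)
          + of_real (Re z * Im w + Im z * Re w) * i"
        by (simp add: \<phi>_def algebra_simps)
      then show ?thesis unfolding 2 by (simp add: \<phi>_def algebra_simps)
    qed
    have \<phi>r: "\<phi> (of_real r) = of_real r" for r by (simp add: \<phi>_def)
    have i1: "norm i = 1"
    proof -
      have "norm i * norm i = 1" by (metis 2(1) norm_mult norm_minus_cancel norm_one)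
      then show ?thesis by (metis abs_norm_cancel abs_1 real_sqrt_abs2 real_sqrt_one)
    qed
    have le2: "norm (\<phi> z) \<le> 2 * norm z" for z
    proof -
      have "norm (\<phi> z) \<le> \<bar>Re z\<bar> + \<bar>Im z\<bar>"
        unfolding \<phi>_def by (rule order_trans[OF norm_triangle_ineq]) (simp add: norm_mult i1)
      then show ?thesis using abs_Re_le_cmod[of z] abs_Im_le_cmod[of z] by linarith
    qed
    have pow: "\<phi> (z ^ n) = \<phi> z ^ n" for z n
      by (induction n) (use mult \<phi>r[of 1] in auto)
    have le: "norm (\<phi> z) \<le> norm z" for z
    proof (rule ccontr)
      assume c: "\<not> norm (\<phi> z) \<le> norm z"
      then have z0: "norm z > 0" using le2[of z] by (cases "norm z = 0") auto
      then have "norm (\<phi> z) / norm z > 1" using c by simp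
      then obtain n where "2 < (norm (\<phi> z) / norm z) ^ n" using real_arch_pow by blast
      then have "2 * norm z ^ n < norm (\<phi> z) ^ n" using z0 by (simp add: power_divide field_simps)
      then show False using le2[of "z ^ n"] by (simp add: pow norm_power)
    qed
    have norm: "norm (\<phi> z) = norm z" for z
    proof (cases "z = 0")
      case False
      have "1 = norm (\<phi> z) * norm (\<phi> (inverse z))"
        using False \<phi>r[of 1] by (simp flip: norm_mult mult)
      also have "\<dots> \<le> norm (\<phi> z) * norm (inverse z)" by (intro mult_left_mono le) simp
      finally have "norm z \<le> norm (\<phi> z)" using False by (simp add: norm_inverse norm_divide field_simps)
      with le[of z] show ?thesis by simp
    qed (simp add: \<phi>_def)
    have "\<phi> z = \<phi> w \<longleftrightarrow> z = w" for z w
    proof -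
      have "\<phi> z = \<phi> (z - w) + \<phi> w" using add[of "z - w" w] by simp
      then show ?thesis using norm[of "z - w"] by auto
    qed
    moreover have "surj \<phi>"
      unfolding surj_def
    proof
      fix y :: 'k
      obtain a b where "y = a *\<^sub>R 1 + b *\<^sub>R i" using 2 by blast
      then have "y = \<phi> (Complex a b)" by (simp add: \<phi>_def scaleR_conv_of_real)
      then show "\<exists>x. y = \<phi> x" by blast
    qed
    ultimately have "bij \<phi>" by (simp add: bij_def inj_def)
    then show thesis using add mult \<phi>r norm complex by blast
  qed
qed

section \<open>Hahn-Banach over the real or complex field\<close>

lemma unit_rotation:
  fixes z :: "'k::real_normed_field"
  obtains c where "norm c = 1" "c * z = of_real (norm z)"
proof (cases "z = 0")
  case True
  then show ?thesis using that[of 1] by simp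
next
  case False
  then show ?thesis using that[of "of_real (norm z) / z"] by (simp add: norm_divide)
qed

definition linear_functional_on ::
  "('k::real_or_complex \<Rightarrow> 'v::ab_group_add \<Rightarrow> 'v) \<Rightarrow> 'v set \<Rightarrow> ('v \<Rightarrow> 'k) \<Rightarrow> bool" where
  "linear_functional_on s E f \<longleftrightarrow>
     (\<forall>x\<in>E. \<forall>y\<in>E. f (x + y) = f x + f y) \<and> (\<forall>c. \<forall>x\<in>E. f (s c x) = c * f x)"

definition seminorm_on ::
  "('k::real_or_complex \<Rightarrow> 'v::ab_group_add \<Rightarrow> 'v) \<Rightarrow> 'v set \<Rightarrow> ('v \<Rightarrow> real) \<Rightarrow> bool" where
  "seminorm_on s E p \<longleftrightarrow>
     (\<forall>x\<in>E. \<forall>y\<in>E. p (x + y) \<le> p x + p y) \<and> (\<forall>c. \<forall>x\<in>E. p (s c x) = norm c * p x)"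

lemma vector_space_of_real:
  assumes "vector_space (s :: 'k::real_normed_field \<Rightarrow> 'v::ab_group_add \<Rightarrow> 'v)"
  shows "vector_space (\<lambda>r. s (of_real r))"
proof -
  interpret vector_space s by fact
  show ?thesis by unfold_locales (simp_all add: scale_right_distrib scale_left_distrib)
qed

lemma subspace_of_real:
  assumes "vector_space (s :: 'k::real_normed_field \<Rightarrow> 'v::ab_group_add \<Rightarrow> 'v)" "module.subspace s E"
  shows "module.subspace (\<lambda>r. s (of_real r)) E"
proof -
  interpret vector_space s by fact
  interpret r: vector_space "\<lambda>r. s (of_real r)" using assms(1) by (rule vector_space_of_real)
  show ?thesis using assms(2) by (simp add: subspace_def r.subspace_def)
qed

lemma seminorm_on_nonneg:
  assumes "vector_space s" "module.subspace s E" "seminorm_on s E p" "x \<in> E"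
  shows "0 \<le> p x"
proof -
  interpret vector_space s by fact
  have "s (-1) x \<in> E" using assms subspace_scale by blast
  then have "p (x + s (-1) x) \<le> p x + p (s (-1) x)"
    using assms unfolding seminorm_on_def by blast
  moreover have "p (s 0 x) = norm (0::'a) * p x" "p (s (-1) x) = norm (-1::'a) * p x"
    using assms unfolding seminorm_on_def by blast+
  ultimately show ?thesis by simp
qed

text \<open>A real linear \<open>u\<close> is the real part of the linear \<open>g x = u x - \<i> u (\<i> x)\<close>.\<close>

lemma real_part:
  fixes s :: "'k::real_or_complex \<Rightarrow> 'v::ab_group_add \<Rightarrow> 'v"
  assumes "vector_space s"
  obtains re :: "'k \<Rightarrow> real" where "\<And>a b. re (a + b) = re a + re b"
    "\<And>r a. re (of_real r * a) = r * re a" "\<And>a. re a \<le> norm a" "\<And>r. re (of_real r) = r"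
    "\<forall>E u. module.subspace s E \<longrightarrow> (\<forall>x\<in>E. \<forall>y\<in>E. u (x + y) = u x + u y) \<longrightarrow>
       (\<forall>r. \<forall>x\<in>E. u (s (of_real r) x) = r * u x) \<longrightarrow>
       (\<exists>g. linear_functional_on s E g \<and> (\<forall>x\<in>E. re (g x) = u x))"
proof -
  interpret vector_space s by fact
  show thesis
  proof (cases rule: real_or_complex_scalars[where 'k = 'k])
    case real
    then obtain re :: "'k \<Rightarrow> real" where re: "\<And>z. z = of_real (re z)" by metis
    have re_of: "re (of_real r) = r" for r
      using re[of "of_real r"] by (metis of_real_eq_iff)
    show thesis
    proof (rule that[of re])
      show "re (a + b) = re a + re b" for a b
        by (metis re re_of of_real_add)
      show "re (of_real r * a) = r * re a" for r a
        by (metis re re_of of_real_mult)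
      show "re a \<le> norm a" for a
        by (metis re norm_of_real abs_ge_self)
      show "\<forall>E u. subspace E \<longrightarrow> (\<forall>x\<in>E. \<forall>y\<in>E. u (x + y) = u x + u y) \<longrightarrow>
         (\<forall>r. \<forall>x\<in>E. u (s (of_real r) x) = r * u x) \<longrightarrow>
         (\<exists>g. linear_functional_on s E g \<and> (\<forall>x\<in>E. re (g x) = u x))"
      proof (intro allI impI exI conjI ballI)
        fix E u assume add: "\<forall>x\<in>E. \<forall>y\<in>E. u (x + y) = u x + u y"
          and scale: "\<forall>r. \<forall>x\<in>E. u (s (of_real r) x) = r * u x"
        have "of_real (u (s c x)) = c * of_real (u x)" if "x \<in> E" for c x
          using scale that re[of c] by (metis of_real_mult)
        then show "linear_functional_on s E (\<lambda>x. of_real (u x))"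
          by (simp add: linear_functional_on_def add)
      qed (simp add: re_of)
    qed (rule re_of)
  next
    case (complex \<phi>)
    define re where "re z = Re (inv \<phi> z)" for z
    have \<phi>_inv: "\<phi> (inv \<phi> z) = z" and inv_\<phi>: "inv \<phi> (\<phi> w) = w" for z w
      using complex(4) by (auto simp: bij_def surj_f_inv_f)
    have re_\<phi>: "re (\<phi> z) = Re z" for z by (simp add: re_def inv_\<phi>)
    show thesis
    proof (rule that[of re])
      show "re (a + b) = re a + re b" for a b
        using re_\<phi>[of "inv \<phi> a + inv \<phi> b"] by (simp add: complex(1) \<phi>_inv) (simp add: re_def)
      show "re (of_real r * a) = r * re a" for r a
        using re_\<phi>[of "of_real r * inv \<phi> a"] by (simp add: complex(2,3) \<phi>_inv) (simp add: re_def)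
      show "re a \<le> norm a" for a
        using complex(5)[of "inv \<phi> a"] complex_Re_le_cmod[of "inv \<phi> a"] by (simp add: \<phi>_inv re_def)
      show re_of: "re (of_real r) = r" for r
        using re_\<phi>[of "of_real r"] by (simp add: complex(3))
      show "\<forall>E u. subspace E \<longrightarrow> (\<forall>x\<in>E. \<forall>y\<in>E. u (x + y) = u x + u y) \<longrightarrow>
         (\<forall>r. \<forall>x\<in>E. u (s (of_real r) x) = r * u x) \<longrightarrow>
         (\<exists>g. linear_functional_on s E g \<and> (\<forall>x\<in>E. re (g x) = u x))"
      proof (intro allI impI)
        fix E u assume E: "subspace E" and add': "\<forall>x\<in>E. \<forall>y\<in>E. u (x + y) = u x + u y"
          and scale': "\<forall>r. \<forall>x\<in>E. u (s (of_real r) x) = r * u x"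
        have add: "u (x + y) = u x + u y" if "x \<in> E" "y \<in> E" for x y using add' that by blast
        have scale: "u (s (of_real r) x) = r * u x" if "x \<in> E" for r x using scale' that by blast
        define i where "i = \<phi> \<i>"
        have ii: "i * i = - 1"
          using complex(2)[of \<i> \<i>] complex(3)[of "-1"] by (simp add: i_def)
        define g where "g x = \<phi> (Complex (u x) (- u (s i x)))" for x
        have gexp: "g x = of_real (u x) - i * of_real (u (s i x))" for x
        proof -
          have "Complex (u x) (- u (s i x)) = of_real (u x) + \<i> * of_real (- u (s i x))"
            by (simp add: complex_eq_iff)
          then show ?thesis by (simp only: g_def complex i_def) simp
        qed
        have "g (x + y) = g x + g y" if "x \<in> E" "y \<in> E" for x y
          using that E by (simp add: gexp add scale_right_distrib subspace_scale algebra_simps)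
        moreover have "g (s c x) = c * g x" if x: "x \<in> E" for c x
        proof -
          obtain a b where c: "c = of_real a + i * of_real b"
            using \<phi>_inv[of c] complex_eq[of "inv \<phi> c"] by (metis complex(1-3) i_def)
          have ix: "s i x \<in> E" using x E by (rule subspace_scale[rotated])
          have "s c x = s (of_real a) x + s (of_real b) (s i x)"
            by (simp add: c scale_left_distrib mult.commute)
          then have 1: "u (s c x) = a * u x + b * u (s i x)"
            using x ix E by (simp add: add scale subspace_scale del: scale_scale)
          have "s i (s c x) = s (of_real a) (s i x) + s (of_real (- b)) x"
          proof -
            have "i * c = of_real a * i + of_real b * (i * i)" by (simp add: c algebra_simps)
            then have "i * c = of_real a * i + of_real (- b)" unfolding ii by simp
            then show ?thesis by (simp only: scale_scale scale_left_distrib)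
          qed
          then have 2: "u (s i (s c x)) = a * u (s i x) - b * u x"
            using scale[OF x, of "- b"] scale[OF ix, of a]
              add[OF subspace_scale[OF E ix] subspace_scale[OF E x], of "of_real a" "of_real (- b)"]
            by (simp del: scale_scale scale_minus_left of_real_minus)
          have "c * g x = of_real (a * u x) - of_real b * (i * i) * of_real (u (s i x))
              + i * of_real (b * u x - a * u (s i x))"
            by (simp add: c gexp algebra_simps)
          then show ?thesis unfolding ii by (simp add: gexp 1 2 algebra_simps del: scale_scale)
        qed
        ultimately have "linear_functional_on s E g" by (simp add: linear_functional_on_def)
        moreover have "re (g x) = u x" for x by (simp add: g_def re_\<phi>)
        ultimately show "\<exists>g. linear_functional_on s E g \<and> (\<forall>x\<in>E. re (g x) = u x)" by blast
      qed
    qed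
  qed
qed

text \<open>Real parts suffice: the real part of \<open>f\<close> is extended below \<open>p\<close>
  over the reals and then complexified. Rotating g x to the nonnegative real axis turns the bound on
  real parts into one on moduli, and rotating g x - f x turns equality of real parts on
  \<open>F\<close> into equality.\<close>

theorem hahn_banach:
  fixes s :: "'k::real_or_complex \<Rightarrow> 'v::ab_group_add \<Rightarrow> 'v"
  assumes vs: "vector_space s" and E: "module.subspace s E" and p: "seminorm_on s E p"
    and F: "module.subspace s F" "F \<subseteq> E"
    and f: "linear_functional_on s F f" and le: "\<And>x. x \<in> F \<Longrightarrow> norm (f x) \<le> p x"
  obtains g where "linear_functional_on s E g" "\<And>x. x \<in> F \<Longrightarrow> g x = f x"
    "\<And>x. x \<in> E \<Longrightarrow> norm (g x) \<le> p x"
proof -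
  interpret vector_space s by fact
  obtain re where re_add: "\<And>a b. re (a + b) = re a + re b"
    and re_scale: "\<And>r a. re (of_real r * a) = r * re a" and re_le: "\<And>a::'k. re a \<le> norm a"
    and re_of: "\<And>r. re (of_real r) = r"
    and complexify: "\<forall>E u. module.subspace s E \<longrightarrow> (\<forall>x\<in>E. \<forall>y\<in>E. u (x + y) = u x + u y) \<longrightarrow>
       (\<forall>r. \<forall>x\<in>E. u (s (of_real r) x) = r * u x) \<longrightarrow>
       (\<exists>g. linear_functional_on s E g \<and> (\<forall>x\<in>E. re (g x) = u x))"
    by (rule real_part[OF vs]) (rule that)
  obtain u where u_add: "\<And>x y. x \<in> E \<Longrightarrow> y \<in> E \<Longrightarrow> u (x + y) = u x + u y"
    and u_scale: "\<And>r x. x \<in> E \<Longrightarrow> u (s (of_real r) x) = r * u x"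
    and uf: "\<And>x. x \<in> F \<Longrightarrow> u x = re (f x)" and up: "\<And>x. x \<in> E \<Longrightarrow> u x \<le> p x"
  proof (rule real_hahn_banach[of "\<lambda>r. s (of_real r)" E p F "\<lambda>x. re (f x)"])
    show "vector_space (\<lambda>r. s (of_real r))" using vs by (rule vector_space_of_real)
    show "module.subspace (\<lambda>r. s (of_real r)) E" "module.subspace (\<lambda>r. s (of_real r)) F"
      using subspace_of_real[OF vs] E F by auto
    show "re (f x) \<le> p x" if "x \<in> F" for x using le[OF that] re_le[of "f x"] by simp
  qed (use F f p in \<open>auto simp: re_add re_scale seminorm_on_def linear_functional_on_def\<close>)
  obtain g where g: "linear_functional_on s E g" and gu: "\<And>x. x \<in> E \<Longrightarrow> re (g x) = u x"
    using complexify E u_add u_scale by blast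
  have "norm (g x) \<le> p x" if x: "x \<in> E" for x
  proof -
    obtain c where c: "norm c = 1" "c * g x = of_real (norm (g x))" by (rule unit_rotation)
    have cx: "s c x \<in> E" using E x by (rule subspace_scale)
    have "norm (g x) = re (c * g x)" using c re_of by simp
    also have "\<dots> = u (s c x)" using g x gu[OF cx] by (simp add: linear_functional_on_def)
    also have "\<dots> \<le> p (s c x)" using up cx by blast
    also have "\<dots> = p x" using p x c by (simp add: seminorm_on_def)
    finally show ?thesis .
  qed
  moreover have "g x = f x" if x: "x \<in> F" for x
  proof -
    obtain c where c: "norm c = 1" "c * (g x - f x) = of_real (norm (g x - f x))"
      by (rule unit_rotation)
    have cx: "s c x \<in> F" using F(1) x by (rule subspace_scale)
    have "g (s c x) = c * g x" "f (s c x) = c * f x"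
      using g f x F(2) by (auto simp: linear_functional_on_def)
    then have "g (s c x) = c * (g x - f x) + f (s c x)" by (simp add: algebra_simps)
    then have "re (g (s c x)) = norm (g x - f x) + re (f (s c x))" using c re_add re_of by simp
    then show ?thesis using gu uf cx F(2) by auto
  qed
  ultimately show thesis using g that by blast
qed

lemma hahn_banach_point:
  fixes s :: "'k::real_or_complex \<Rightarrow> 'v::ab_group_add \<Rightarrow> 'v"
  assumes vs: "vector_space s" and E: "module.subspace s E" and p: "seminorm_on s E p"
    and x: "x \<in> E"
  obtains g where "linear_functional_on s E g" "g x = of_real (p x)"
    "\<And>y. y \<in> E \<Longrightarrow> norm (g y) \<le> p y"
proof (cases "x = 0")
  case True
  interpret vector_space s by fact
  have "p (s 0 x) = norm (0::'k) * p x" using p x unfolding seminorm_on_def by blast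
  then have "p x = 0" using True by simp
  then show ?thesis using that[of "\<lambda>_. 0"] seminorm_on_nonneg[OF vs E p]
    by (simp add: linear_functional_on_def)
next
  case False
  interpret vector_space s by fact
  define F where "F = range (\<lambda>c. s c x)"
  have F: "subspace F"
  proof (rule subspaceI)
    show "0 \<in> F" unfolding F_def by (metis rangeI scale_zero_left)
    show "a + b \<in> F" if "a \<in> F" "b \<in> F" for a b
      using that unfolding F_def by (auto simp flip: scale_left_distrib)
    show "s c a \<in> F" if "a \<in> F" for a c
      using that unfolding F_def by auto
  qed
  have FE: "F \<subseteq> E" unfolding F_def using E x by (auto intro: subspace_scale)
  \<comment> \<open>The coefficient is unique because x is nonzero; this is why x = 0 is split
    off.\<close>
  define f where "f y = (THE c. y = s c x) * of_real (p x)" for y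
  have f: "f (s c x) = c * of_real (p x)" for c
    using False by (simp add: f_def)
  have lin: "linear_functional_on s F f"
    unfolding linear_functional_on_def F_def
    by (auto simp: f distrib_right simp flip: scale_left_distrib)
  have "norm (f y) \<le> p y" if yF: "y \<in> F" for y
  proof -
    obtain c where y: "y = s c x" using yF F_def by auto
    have "p y = norm c * p x" using p x y unfolding seminorm_on_def by blast
    then show ?thesis using seminorm_on_nonneg[OF vs E p x] by (simp add: y f norm_mult)
  qed
  then obtain g where "linear_functional_on s E g" "\<And>x. x \<in> F \<Longrightarrow> g x = f x"
    "\<And>x. x \<in> E \<Longrightarrow> norm (g x) \<le> p x"
    using hahn_banach[OF vs E p F FE lin] by blast
  moreover have "x \<in> F" unfolding F_def by (metis rangeI scale_one)
  moreover have "f x = of_real (p x)" using f[of 1] by simp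
  ultimately show thesis using that by auto
qed

text \<open>Hahn--Banach applied at \<open>x\<close> to the largest seminorm below \<open>p\<^sub>2\<close> on \<open>E\<close> and below \<open>p\<^sub>1\<close> on \<open>F\<close>,
  \<open>q u = inf {p\<^sub>1 z + p\<^sub>2 (u - z) | z. z \<in> F}\<close>.\<close>

lemma hahn_banach_inf_convolution:
  fixes s :: "'k::real_or_complex \<Rightarrow> 'v::ab_group_add \<Rightarrow> 'v"
  assumes vs: "vector_space s" and E: "module.subspace s E" and F: "module.subspace s F" "F \<subseteq> E"
    and p1: "seminorm_on s F p1" and p2: "seminorm_on s E p2" and x: "x \<in> E"
    and \<kappa>: "\<And>z. z \<in> F \<Longrightarrow> \<kappa> \<le> p1 z + p2 (x - z)"
  obtains g r where "linear_functional_on s E g" "g x = of_real r" "\<kappa> \<le> r"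
    "\<And>y. y \<in> F \<Longrightarrow> norm (g y) \<le> p1 y" "\<And>y. y \<in> E \<Longrightarrow> norm (g y) \<le> p2 y"
proof -
  interpret vector_space s by fact
  define Q where "Q u = (\<lambda>z. p1 z + p2 (u - z)) ` F" for u
  define q where "q u = Inf (Q u)" for u
  have F0: "0 \<in> F" using F subspace_0 by blast
  have EF: "u - z \<in> E" if "u \<in> E" "z \<in> F" for u z using that F E subspace_diff by blast
  have nn1: "0 \<le> p1 z" if "z \<in> F" for z using that seminorm_on_nonneg[OF vs F(1) p1] by blast
  have nn2: "0 \<le> p2 z" if "z \<in> E" for z using that seminorm_on_nonneg[OF vs E p2] by blast
  have ne: "Q u \<noteq> {}" for u using F0 unfolding Q_def by blast
  have bdd: "bdd_below (Q u)" if "u \<in> E" for u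
    unfolding Q_def by (rule bdd_belowI[of _ 0]) (auto intro!: add_nonneg_nonneg nn1 nn2 EF that)
  have q_le: "q u \<le> p1 z + p2 (u - z)" if "u \<in> E" "z \<in> F" for u z
    unfolding q_def using that by (intro cInf_lower bdd) (auto simp: Q_def)
  have q_ge: "b \<le> q u" if "\<And>z. z \<in> F \<Longrightarrow> b \<le> p1 z + p2 (u - z)" for b u
    unfolding q_def using that by (intro cInf_greatest ne) (auto simp: Q_def)
  have q_nonneg: "0 \<le> q u" if "u \<in> E" for u
    by (rule q_ge) (auto intro!: add_nonneg_nonneg nn1 nn2 EF that)
  have add: "q (u + v) \<le> q u + q v" if uv: "u \<in> E" "v \<in> E" for u v
  proof -
    have "q (u + v) - (p1 z + p2 (u - z)) \<le> q v" if z: "z \<in> F" for z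
    proof (rule q_ge)
      fix w assume w: "w \<in> F"
      have "q (u + v) \<le> p1 (z + w) + p2 ((u + v) - (z + w))"
        using uv z w E F by (intro q_le subspace_add) auto
      also have "(u + v) - (z + w) = (u - z) + (v - w)" by simp
      also have "p1 (z + w) + p2 ((u - z) + (v - w)) \<le> (p1 z + p1 w) + (p2 (u - z) + p2 (v - w))"
        using z w p1 p2 EF uv unfolding seminorm_on_def by (intro add_mono) auto
      finally show "q (u + v) - (p1 z + p2 (u - z)) \<le> p1 w + p2 (v - w)" by simp
    qed
    then have "q (u + v) - q v \<le> q u" by (intro q_ge) (simp add: algebra_simps)
    then show ?thesis by simp
  qed
  have scale_le: "q (s c u) \<le> norm c * q u" if u: "u \<in> E" for c u
  proof (cases "c = 0")
    case True
    have "q 0 \<le> p1 0 + p2 (0 - 0)" using F0 F by (intro q_le) auto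
    moreover have "p1 (s 0 0) = norm (0::'k) * p1 0" "p2 (s 0 0) = norm (0::'k) * p2 0"
      using p1 p2 F0 F unfolding seminorm_on_def by blast+
    ultimately show ?thesis using True by simp
  next
    case False
    have "q (s c u) / norm c \<le> q u"
    proof (rule q_ge)
      fix z assume z: "z \<in> F"
      have "q (s c u) \<le> p1 (s c z) + p2 (s c u - s c z)"
        using u z E F by (intro q_le subspace_scale) auto
      also have "s c u - s c z = s c (u - z)" by (simp add: scale_right_diff_distrib)
      also have "p1 (s c z) + p2 (s c (u - z)) = norm c * (p1 z + p2 (u - z))"
        using z p1 p2 EF u by (simp add: seminorm_on_def distrib_left)
      finally show "q (s c u) / norm c \<le> p1 z + p2 (u - z)" using False by (simp add: field_simps)
    qed
    then show ?thesis using False by (simp add: field_simps)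
  qed
  have scale: "q (s c u) = norm c * q u" if u: "u \<in> E" for c u
  proof (cases "c = 0")
    case True
    have "q 0 \<le> 0" using scale_le[OF u, of 0] by simp
    moreover have "0 \<le> q 0" using E by (intro q_nonneg subspace_0)
    ultimately show ?thesis using True by simp
  next
    case False
    have "q (s (inverse c) (s c u)) \<le> norm (inverse c) * q (s c u)"
      using u E by (intro scale_le subspace_scale)
    then have "norm c * q u \<le> q (s c u)" using False by (simp add: norm_inverse norm_divide field_simps)
    with scale_le[OF u] show ?thesis by (simp add: antisym)
  qed
  have q: "seminorm_on s E q" using add scale by (simp add: seminorm_on_def)
  obtain g where g: "linear_functional_on s E g" "g x = of_real (q x)"
    "\<And>y. y \<in> E \<Longrightarrow> norm (g y) \<le> q y"
    using hahn_banach_point[OF vs E q x] by blast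
  have p0: "p1 0 = 0" "p2 0 = 0"
  proof -
    have "p1 (s 0 0) = norm (0::'k) * p1 0" "p2 (s 0 0) = norm (0::'k) * p2 0"
      using p1 p2 F0 F unfolding seminorm_on_def by blast+
    then show "p1 0 = 0" "p2 0 = 0" by simp_all
  qed
  show thesis
  proof (rule that[OF g(1,2)])
    show "\<kappa> \<le> q x" using \<kappa> by (rule q_ge)
    \<comment> \<open>The choices z = y here and z = 0 in the next claim bound \<open>q\<close> by
      each seminorm alone, as both vanish at 0.\<close>
    show "norm (g y) \<le> p1 y" if "y \<in> F" for y
      using g(3)[of y] q_le[of y y] that F p0 by fastforce
    show "norm (g y) \<le> p2 y" if "y \<in> E" for y
      using g(3)[of y] q_le[of y 0] that F0 p0 by fastforce
  qed
qed

text \<open>Hahn--Banach for the seminorm \<open>(a, b) \<mapsto> p\<^sub>1 a + p\<^sub>2 b\<close> on \<open>F \<times> E\<close>, starting from \<open>f\<close> on the diagonal.\<close>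

lemma hahn_banach_sandwich:
  fixes s :: "'k::real_or_complex \<Rightarrow> 'v::ab_group_add \<Rightarrow> 'v"
  assumes vs: "vector_space s" and E: "module.subspace s E" and F: "module.subspace s F" "F \<subseteq> E"
    and p1: "seminorm_on s F p1" and p2: "seminorm_on s E p2"
    and f: "linear_functional_on s F f" and le: "\<And>x. x \<in> F \<Longrightarrow> norm (f x) \<le> p1 x + p2 x"
  obtains g where "linear_functional_on s E g"
    "\<And>x. x \<in> F \<Longrightarrow> norm (f x - g x) \<le> p1 x" "\<And>x. x \<in> E \<Longrightarrow> norm (g x) \<le> p2 x"
proof -
  interpret vector_space s by fact
  define s' where "s' c v = (s c (fst v), s c (snd v))" for c and v :: "'v \<times> 'v"
  interpret s': vector_space s'
    by unfold_locales (auto simp: s'_def scale_right_distrib scale_left_distrib plus_prod_def)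
  have "s'.subspace (F \<times> E)" "s'.subspace ((\<lambda>x. (x, x)) ` F)"
    using E F by (auto simp: s'.subspace_def subspace_def s'_def zero_prod_def)
  moreover have "seminorm_on s' (F \<times> E) (\<lambda>v. p1 (fst v) + p2 (snd v))"
    unfolding seminorm_on_def
  proof (intro conjI ballI allI)
    fix x y assume "x \<in> F \<times> E" "y \<in> F \<times> E"
    then have "p1 (fst x + fst y) \<le> p1 (fst x) + p1 (fst y)"
      "p2 (snd x + snd y) \<le> p2 (snd x) + p2 (snd y)"
      using p1 p2 by (auto simp: seminorm_on_def)
    then show "p1 (fst (x + y)) + p2 (snd (x + y)) \<le> p1 (fst x) + p2 (snd x) + (p1 (fst y) + p2 (snd y))"
      by simp
  next
    fix c x assume "x \<in> F \<times> E"
    then show "p1 (fst (s' c x)) + p2 (snd (s' c x)) = norm c * (p1 (fst x) + p2 (snd x))"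
      using p1 p2 by (auto simp: seminorm_on_def s'_def distrib_left)
  qed
  moreover have "(\<lambda>x. (x, x)) ` F \<subseteq> F \<times> E" using F by auto
  moreover have "linear_functional_on s' ((\<lambda>x. (x, x)) ` F) (\<lambda>v. f (fst v))"
    using f by (auto simp: linear_functional_on_def s'_def)
  moreover have "norm (f (fst v)) \<le> p1 (fst v) + p2 (snd v)" if "v \<in> (\<lambda>x. (x, x)) ` F" for v
    using that le by auto
  ultimately obtain G where G: "linear_functional_on s' (F \<times> E) G"
    and Gf: "\<And>v. v \<in> (\<lambda>x. (x, x)) ` F \<Longrightarrow> G v = f (fst v)"
    and Gp: "\<And>v. v \<in> F \<times> E \<Longrightarrow> norm (G v) \<le> p1 (fst v) + p2 (snd v)"
    using hahn_banach[OF s'.vector_space_axioms] by blast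
  have F0: "0 \<in> F" and E0: "0 \<in> E" using F E subspace_0 by blast+
  have p0: "p1 0 = 0" "p2 0 = 0"
  proof -
    have "p1 (s 0 0) = norm (0::'k) * p1 0" "p2 (s 0 0) = norm (0::'k) * p2 0"
      using p1 p2 F0 E0 unfolding seminorm_on_def by blast+
    then show "p1 0 = 0" "p2 0 = 0" by simp_all
  qed
  \<comment> \<open>On the diagonal, f x = G (x, x) splits as G (x, 0) + G (0, x). The second term
    serves as g x and is bounded by \<open>p2\<close>; the first is then f x - g x and is bounded by
    \<open>p1\<close>.\<close>
  show thesis
  proof (rule that[of "\<lambda>x. G (0, x)"])
    show "linear_functional_on s E (\<lambda>x. G (0, x))"
      unfolding linear_functional_on_def
    proof (intro conjI ballI allI)
      show "G (0, x + y) = G (0, x) + G (0, y)" if "x \<in> E" "y \<in> E" for x y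
      proof -
        have "G ((0, x) + (0, y)) = G (0, x) + G (0, y)"
          using G F0 that unfolding linear_functional_on_def by blast
        then show ?thesis by simp
      qed
      show "G (0, s c x) = c * G (0, x)" if "x \<in> E" for c x
      proof -
        have "G (s' c (0, x)) = c * G (0, x)"
          using G F0 that unfolding linear_functional_on_def by blast
        then show ?thesis by (simp add: s'_def)
      qed
    qed
    show "norm (f x - G (0, x)) \<le> p1 x" if x: "x \<in> F" for x
    proof -
      have "G ((x, 0) + (0, x)) = G (x, 0) + G (0, x)"
        using G F0 E0 F x unfolding linear_functional_on_def by blast
      then have "f x - G (0, x) = G (x, 0)" using Gf[of "(x, x)"] x by simp
      then show ?thesis using Gp[of "(x, 0)"] x E0 p0 by simp
    qed
    show "norm (G (0, x)) \<le> p2 x" if "x \<in> E" for x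
      using Gp[of "(0, x)"] that F0 p0 by simp
  qed
qed

section \<open>Normed spaces given by a carrier, and their duals\<close>

text \<open>Baire's theorem for the closed sets on which all operators are bounded by n: a ball
  inside one of them bounds every operator on differences of its points.\<close>

lemma uniform_boundedness:
  fixes \<L> :: "('x::banach \<Rightarrow>\<^sub>L 'y::real_normed_vector) set"
  assumes ptw: "\<And>x. \<exists>C. \<forall>L\<in>\<L>. norm (blinfun_apply L x) \<le> C"
  obtains C where "0 \<le> C" "\<And>L x. L \<in> \<L> \<Longrightarrow> norm (blinfun_apply L x) \<le> C * norm x"
proof -
  define F where "F n = {x. \<forall>L\<in>\<L>. norm (blinfun_apply L x) \<le> real n}" for n
  have closed: "closed (F n)" for n
  proof -
    have "F n = (\<Inter>L\<in>\<L>. {x. norm (blinfun_apply L x) \<le> real n})" unfolding F_def by blast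
    then show ?thesis by (auto intro!: closed_INT closed_Collect_le continuous_intros)
  qed
  have "\<exists>n. x \<in> F n" for x
  proof -
    obtain C where "\<forall>L\<in>\<L>. norm (blinfun_apply L x) \<le> C" using ptw by blast
    moreover obtain n where "C \<le> real n" using real_arch_simple by blast
    ultimately have "x \<in> F n" unfolding F_def by (auto intro: order_trans)
    then show ?thesis by blast
  qed
  then have "(\<Union>n. F n) = UNIV" by blast
  then have "interior (\<Union>n. F n) \<noteq> {}" by simp
  then obtain n where "interior (F n) \<noteq> {}"
    using Met_TC.metric_Baire_category_alt[of "range F"] closed
    by (auto simp: mcomplete_iff_complete complete_UNIV)
  then obtain x0 r where r: "r > 0" "cball x0 r \<subseteq> F n"
    using open_contains_cball by (metis interior_subset equals0I open_interior subset_trans)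
  show thesis
  proof (rule that[of "2 * real n / r"])
    fix L x assume L: "L \<in> \<L>"
    show "norm (blinfun_apply L x) \<le> 2 * real n / r * norm x"
    proof (cases "x = 0")
      case False
      \<comment> \<open>\<open>u\<close> has norm r, so x0 and x0 + u both lie in the ball and L u
        is a difference of two vectors of norm at most n; hence the constant 2 n / r.\<close>
      define u where "u = (r / norm x) *\<^sub>R x"
      have "x0 \<in> cball x0 r" "x0 + u \<in> cball x0 r" using r False by (auto simp: u_def dist_norm)
      then have "x0 \<in> F n" "x0 + u \<in> F n" using r(2) by blast+
      then have "norm (blinfun_apply L x0) \<le> n" "norm (blinfun_apply L (x0 + u)) \<le> n"
        using L unfolding F_def by auto
      moreover have "blinfun_apply L u = blinfun_apply L (x0 + u) - blinfun_apply L x0"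
        by (simp add: blinfun.add_right)
      ultimately have "norm (blinfun_apply L u) \<le> 2 * real n"
        by (smt (verit) norm_triangle_ineq4)
      then show ?thesis using False r by (simp add: u_def blinfun.scaleR_right field_simps)
    qed simp
  qed (use r in simp)
qed

section \<open>Dual norms and functionals on a carrier\<close>

locale normed =
  fixes Z :: "('k::real_or_complex, 'v::ab_group_add) nspace"
  assumes normed_space: "normed_space Z"
begin

sublocale vector_space "smul Z"
  using normed_space by (simp add: normed_space_def)

lemma subspace_vecs: "subspace (vecs Z)"
  using normed_space by (simp add: normed_space_def)

lemmas zero_mem = subspace_0[OF subspace_vecs]
  and add_mem = subspace_add[OF subspace_vecs]
  and diff_mem = subspace_diff[OF subspace_vecs]
  and smul_mem = subspace_scale[OF subspace_vecs]

lemma nrm_nonneg: "x \<in> vecs Z \<Longrightarrow> 0 \<le> nrm Z x"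
  and nrm_eq_0: "x \<in> vecs Z \<Longrightarrow> nrm Z x = 0 \<longleftrightarrow> x = 0"
  and nrm_add: "x \<in> vecs Z \<Longrightarrow> y \<in> vecs Z \<Longrightarrow> nrm Z (x + y) \<le> nrm Z x + nrm Z y"
  and nrm_smul: "x \<in> vecs Z \<Longrightarrow> nrm Z (smul Z c x) = norm c * nrm Z x"
  using normed_space by (auto simp: normed_space_def)

lemma nrm_zero: "nrm Z 0 = 0"
  using nrm_eq_0 zero_mem by simp

lemma nrm_minus: "x \<in> vecs Z \<Longrightarrow> nrm Z (- x) = nrm Z x"
  using nrm_smul[of x "-1"] by simp

lemma nrm_diff: "x \<in> vecs Z \<Longrightarrow> y \<in> vecs Z \<Longrightarrow> nrm Z (x - y) \<le> nrm Z x + nrm Z y"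
  using nrm_add[of x "- y"] nrm_minus[of y] subspace_neg[OF subspace_vecs, of y] by simp

lemma seminorm_nrm: "seminorm_on (smul Z) (vecs Z) (nrm Z)"
  by (simp add: seminorm_on_def nrm_add nrm_smul)

lemma mem_dual:
  "f \<in> vecs (dual Z) \<longleftrightarrow> linear_functional_on (smul Z) (vecs Z) f \<and>
     (\<exists>C. \<forall>x\<in>vecs Z. norm (f x) \<le> C * nrm Z x) \<and> (\<forall>x. x \<notin> vecs Z \<longrightarrow> f x = 0)"
  by (auto simp: dual_def linear_functional_on_def)

lemma smul_dual: "smul (dual Z) c f = (\<lambda>x. c * f x)"
  by (simp add: dual_def)

lemma dual_add: "f \<in> vecs (dual Z) \<Longrightarrow> x \<in> vecs Z \<Longrightarrow> y \<in> vecs Z \<Longrightarrow> f (x + y) = f x + f y"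
  and dual_smul: "f \<in> vecs (dual Z) \<Longrightarrow> x \<in> vecs Z \<Longrightarrow> f (smul Z c x) = c * f x"
  and dual_off: "f \<in> vecs (dual Z) \<Longrightarrow> x \<notin> vecs Z \<Longrightarrow> f x = 0"
  by (auto simp: mem_dual linear_functional_on_def)

lemma dual_zero: "f \<in> vecs (dual Z) \<Longrightarrow> f 0 = 0"
  using dual_add[of f 0 0] zero_mem by simp

lemma dual_diff: "f \<in> vecs (dual Z) \<Longrightarrow> x \<in> vecs Z \<Longrightarrow> y \<in> vecs Z \<Longrightarrow> f (x - y) = f x - f y"
  using dual_add[of f "x - y" y] diff_mem[of x y] by simp

lemma dual_eqI:
  assumes "f \<in> vecs (dual Z)" "g \<in> vecs (dual Z)" "\<And>x. x \<in> vecs Z \<Longrightarrow> f x = g x"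
  shows "f = g"
  using assms dual_off by (intro ext) metis

lemma dual_nrm_le_ball:
  assumes "\<And>x. x \<in> vecs Z \<Longrightarrow> nrm Z x \<le> 1 \<Longrightarrow> norm (f x) \<le> C"
  shows "nrm (dual Z) f \<le> C"
  unfolding dual_def using assms zero_mem nrm_zero
  by (auto intro!: cSup_least) (metis zero_le_one)

lemma dual_nrm_le:
  assumes "0 \<le> C" "\<And>x. x \<in> vecs Z \<Longrightarrow> norm (f x) \<le> C * nrm Z x"
  shows "nrm (dual Z) f \<le> C"
proof (rule dual_nrm_le_ball)
  fix x assume x: "x \<in> vecs Z" "nrm Z x \<le> 1"
  have "norm (f x) \<le> C * nrm Z x" using assms x by blast
  also have "\<dots> \<le> C * 1" using assms(1) x by (intro mult_left_mono)
  finally show "norm (f x) \<le> C" by simp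
qed

lemma dual_bound_unit:
  assumes f: "f \<in> vecs (dual Z)" and x: "x \<in> vecs Z" "nrm Z x \<le> 1"
  shows "norm (f x) \<le> nrm (dual Z) f"
proof -
  obtain C where C: "\<And>x. x \<in> vecs Z \<Longrightarrow> norm (f x) \<le> C * nrm Z x"
    using f by (auto simp: mem_dual)
  have bdd: "bdd_above {norm (f x) |x. x \<in> vecs Z \<and> nrm Z x \<le> 1}"
  proof (rule bdd_aboveI)
    fix r assume "r \<in> {norm (f x) |x. x \<in> vecs Z \<and> nrm Z x \<le> 1}"
    then obtain y where y: "r = norm (f y)" "y \<in> vecs Z" "nrm Z y \<le> 1" by blast
    have "r \<le> C * nrm Z y" using C y by simp
    also have "\<dots> \<le> \<bar>C\<bar> * nrm Z y" using nrm_nonneg[OF y(2)] by (intro mult_right_mono) auto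
    also have "\<dots> \<le> \<bar>C\<bar> * 1" using y by (intro mult_left_mono) auto
    finally show "r \<le> \<bar>C\<bar>" by simp
  qed
  show ?thesis
    unfolding dual_def using x by (auto intro!: cSup_upper bdd)
qed

lemma dual_bound:
  assumes f: "f \<in> vecs (dual Z)" and x: "x \<in> vecs Z"
  shows "norm (f x) \<le> nrm (dual Z) f * nrm Z x"
proof (cases "x = 0")
  case True
  then show ?thesis using dual_zero f nrm_zero by simp
next
  case False
  then have pos: "nrm Z x > 0" using x nrm_nonneg nrm_eq_0 by (simp add: less_le)
  define u where "u = smul Z (of_real (inverse (nrm Z x))) x"
  have u: "u \<in> vecs Z" "nrm Z u \<le> 1"
    using x pos by (auto simp: u_def nrm_smul norm_inverse norm_of_real abs_of_pos intro: smul_mem)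
  have "norm (f u) = norm (f x) / nrm Z x"
    using pos by (simp add: u_def dual_smul f x norm_mult norm_inverse norm_divide divide_inverse)
  then have "norm (f x) = nrm Z x * norm (f u)" using pos by simp
  also have "\<dots> \<le> nrm Z x * nrm (dual Z) f"
    using pos by (intro mult_left_mono dual_bound_unit[OF f u]) simp
  finally show ?thesis by (simp add: mult.commute)
qed

lemma dual_nrm_nonneg: "f \<in> vecs (dual Z) \<Longrightarrow> 0 \<le> nrm (dual Z) f"
  using order_trans[OF norm_ge_zero dual_bound_unit[of f 0]] zero_mem nrm_zero by simp

lemma dual_memI:
  assumes "linear_functional_on (smul Z) (vecs Z) f" "\<And>x. x \<in> vecs Z \<Longrightarrow> norm (f x) \<le> C * nrm Z x"
    "\<And>x. x \<notin> vecs Z \<Longrightarrow> f x = 0"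
  shows "f \<in> vecs (dual Z)"
  using assms by (auto simp: mem_dual)

text \<open>Members of \<open>dual Z\<close> are zero off the carrier, so a functional supplied by
  Hahn-Banach enters the dual only after truncation.\<close>

lemma restrict_in_dual:
  assumes f: "linear_functional_on (smul Z) (vecs Z) f"
    and le: "\<And>x. x \<in> vecs Z \<Longrightarrow> norm (f x) \<le> C * nrm Z x"
  shows "(\<lambda>x. if x \<in> vecs Z then f x else 0) \<in> vecs (dual Z)"
  using f by (intro dual_memI[of _ C])
    (auto simp: linear_functional_on_def le add_mem smul_mem)

lemma normed_space_dual: "normed_space (dual Z)"
proof -
  have vs: "vector_space (smul (dual Z))"
    by unfold_locales (auto simp: smul_dual fun_eq_iff algebra_simps)
  have sub: "module.subspace (smul (dual Z)) (vecs (dual Z))"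
  proof -
    interpret d: vector_space "smul (dual Z)" by (rule vs)
    show ?thesis
    proof (rule d.subspaceI)
      show "0 \<in> vecs (dual Z)"
        by (rule dual_memI[of _ 0]) (auto simp: linear_functional_on_def)
      show "f + g \<in> vecs (dual Z)" if "f \<in> vecs (dual Z)" "g \<in> vecs (dual Z)" for f g
      proof (rule dual_memI)
        show "norm ((f + g) x) \<le> (nrm (dual Z) f + nrm (dual Z) g) * nrm Z x" if "x \<in> vecs Z" for x
          using dual_bound[of f x] dual_bound[of g x] \<open>f \<in> _\<close> \<open>g \<in> _\<close> \<open>x \<in> _\<close>
            norm_triangle_ineq[of "f x" "g x"] by (simp add: distrib_right)
      qed (use that in \<open>auto simp: linear_functional_on_def dual_add dual_smul dual_off algebra_simps\<close>)
      show "smul (dual Z) c f \<in> vecs (dual Z)" if "f \<in> vecs (dual Z)" for c f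
      proof (rule dual_memI)
        show "norm (smul (dual Z) c f x) \<le> (norm c * nrm (dual Z) f) * nrm Z x" if "x \<in> vecs Z" for x
          using dual_bound[of f x] \<open>f \<in> _\<close> \<open>x \<in> _\<close>
          by (simp add: smul_dual norm_mult mult.assoc mult_left_mono)
      qed (use that in \<open>auto simp: smul_dual linear_functional_on_def dual_add dual_smul dual_off algebra_simps\<close>)
    qed
  qed
  have eq0: "nrm (dual Z) f = 0 \<longleftrightarrow> f = 0" if f: "f \<in> vecs (dual Z)" for f
  proof
    assume *: "nrm (dual Z) f = 0"
    have "f x = 0" for x
      using dual_bound[OF f, of x] dual_off[OF f, of x] * by (cases "x \<in> vecs Z") auto
    then show "f = 0" by (simp add: fun_eq_iff)
  next
    assume "f = 0"
    then have "nrm (dual Z) f \<le> 0" by (intro dual_nrm_le) auto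
    then show "nrm (dual Z) f = 0" using dual_nrm_nonneg[OF f] by simp
  qed
  have tri: "nrm (dual Z) (f + g) \<le> nrm (dual Z) f + nrm (dual Z) g"
    if "f \<in> vecs (dual Z)" "g \<in> vecs (dual Z)" for f g
  proof (rule dual_nrm_le_ball)
    fix x assume "x \<in> vecs Z" "nrm Z x \<le> 1"
    then show "norm ((f + g) x) \<le> nrm (dual Z) f + nrm (dual Z) g"
      using dual_bound_unit[of f x] dual_bound_unit[of g x] that
        norm_triangle_ineq[of "f x" "g x"] by simp
  qed
  have sc_le: "nrm (dual Z) (smul (dual Z) c f) \<le> norm c * nrm (dual Z) f"
    if "f \<in> vecs (dual Z)" for c f
    by (rule dual_nrm_le_ball) (auto simp: smul_dual norm_mult intro!: mult_left_mono dual_bound_unit that)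
  have sc: "nrm (dual Z) (smul (dual Z) c f) = norm c * nrm (dual Z) f"
    if f: "f \<in> vecs (dual Z)" for c f
  proof (cases "c = 0")
    case True
    then have "smul (dual Z) c f = 0" by (simp add: smul_dual fun_eq_iff)
    moreover have "(0 :: 'v \<Rightarrow> 'k) \<in> vecs (dual Z)"
      using module.subspace_0[OF _ sub] vs by (simp add: module_iff_vector_space)
    ultimately show ?thesis using eq0 True by simp
  next
    case False
    interpret d: vector_space "smul (dual Z)" by (rule vs)
    have "smul (dual Z) (inverse c) (smul (dual Z) c f) = f" using False by simp
    moreover have "smul (dual Z) c f \<in> vecs (dual Z)" using sub f by (rule d.subspace_scale)
    ultimately have "nrm (dual Z) f \<le> norm (inverse c) * nrm (dual Z) (smul (dual Z) c f)"
      using sc_le[of "smul (dual Z) c f" "inverse c"] by simp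
    then have "norm c * nrm (dual Z) f \<le> nrm (dual Z) (smul (dual Z) c f)"
      using False by (simp add: norm_inverse norm_divide field_simps)
    with sc_le[OF f] show ?thesis by (simp add: antisym)
  qed
  show ?thesis
    unfolding normed_space_def using vs sub dual_nrm_nonneg eq0 tri sc by blast
qed

lemma norming_functional:
  assumes x: "x \<in> vecs Z"
  obtains f where "f \<in> vecs (dual Z)" "nrm (dual Z) f \<le> 1" "f x = of_real (nrm Z x)"
proof -
  obtain g where g: "linear_functional_on (smul Z) (vecs Z) g" "g x = of_real (nrm Z x)"
    "\<And>y. y \<in> vecs Z \<Longrightarrow> norm (g y) \<le> nrm Z y"
    using hahn_banach_point[OF vector_space_axioms subspace_vecs seminorm_nrm x] by blast
  let ?f = "\<lambda>x. if x \<in> vecs Z then g x else 0"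
  show thesis
  proof (rule that[of ?f])
    show "?f \<in> vecs (dual Z)" using g by (intro restrict_in_dual[of _ 1]) auto
    show "nrm (dual Z) ?f \<le> 1" using g by (intro dual_nrm_le) auto
  qed (use g x in auto)
qed

lemma nrm_le_dual:
  assumes x: "x \<in> vecs Z" and le: "\<And>f. f \<in> vecs (dual Z) \<Longrightarrow> nrm (dual Z) f \<le> 1 \<Longrightarrow> norm (f x) \<le> C"
  shows "nrm Z x \<le> C"
proof -
  obtain f where "f \<in> vecs (dual Z)" "nrm (dual Z) f \<le> 1" "f x = of_real (nrm Z x)"
    using norming_functional[OF x] .
  then show ?thesis using le[of f] nrm_nonneg[OF x] by (simp add: norm_of_real)
qed

text \<open>The infimal convolution of the zero seminorm on \<open>F\<close> with the norm is the
  distance to \<open>F\<close>. A functional dominated by it vanishes on \<open>F\<close>, and at x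
  it can be given a value of at least d.\<close>

lemma separating_functional:
  assumes F: "subspace F" "F \<subseteq> vecs Z" and x: "x \<in> vecs Z"
    and d: "0 < d" "\<And>z. z \<in> F \<Longrightarrow> d \<le> nrm Z (x - z)"
  obtains f where "f \<in> vecs (dual Z)" "\<And>z. z \<in> F \<Longrightarrow> f z = 0" "f x \<noteq> 0"
proof -
  have "seminorm_on (smul Z) F (\<lambda>_. 0)" by (simp add: seminorm_on_def)
  then obtain g r where g: "linear_functional_on (smul Z) (vecs Z) g" "g x = of_real r" "d \<le> r"
    "\<And>y. y \<in> F \<Longrightarrow> norm (g y) \<le> 0" "\<And>y. y \<in> vecs Z \<Longrightarrow> norm (g y) \<le> nrm Z y"
    using hahn_banach_inf_convolution[OF vector_space_axioms subspace_vecs F _ seminorm_nrm x, of "\<lambda>_. 0" d]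
      d by auto
  let ?f = "\<lambda>x. if x \<in> vecs Z then g x else 0"
  show thesis
  proof (rule that[of ?f])
    show "?f \<in> vecs (dual Z)" using g by (intro restrict_in_dual[of _ 1]) auto
    show "?f z = 0" if "z \<in> F" for z using g(4)[OF that] by simp
    show "?f x \<noteq> 0" using g d x by simp
  qed
qed

end

lemma isometric_iso_inverse:
  assumes "normed_space Z" and T: "isometric_iso Z W T"
  shows "isometric_iso W Z (inv_into (vecs Z) T)"
proof -
  interpret normed Z by unfold_locales fact
  have bij: "bij_betw T (vecs Z) (vecs W)" and lin: "linear_map Z W T"
    and nrm: "\<And>x. x \<in> vecs Z \<Longrightarrow> nrm W (T x) = nrm Z x"
    using T by (auto simp: isometric_iso_def)
  define S where "S = inv_into (vecs Z) T"
  have S: "S w \<in> vecs Z" "T (S w) = w" if "w \<in> vecs W" for w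
    using bij that by (auto simp: S_def bij_betw_def intro: inv_into_into f_inv_into_f)
  have ST: "S (T x) = x" if "x \<in> vecs Z" for x
    using bij that by (simp add: S_def bij_betw_inv_into_left)
  have "S (v + w) = S v + S w" if "v \<in> vecs W" "w \<in> vecs W" for v w
  proof -
    have "T (S v + S w) = v + w" using lin S that by (simp add: linear_map_def)
    then show ?thesis using ST[of "S v + S w"] S that by (simp add: add_mem)
  qed
  moreover have "S (smul W c w) = smul Z c (S w)" if "w \<in> vecs W" for c w
  proof -
    have "T (smul Z c (S w)) = smul W c w" using lin S that by (simp add: linear_map_def)
    then show ?thesis using ST[of "smul Z c (S w)"] S that by (simp add: smul_mem)
  qed
  moreover have "bij_betw S (vecs W) (vecs Z)" unfolding S_def by (rule bij_betw_inv_into[OF bij])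
  moreover have "nrm Z (S w) = nrm W w" if "w \<in> vecs W" for w
    using nrm[of "S w"] S that by simp
  ultimately show ?thesis
    unfolding S_def[symmetric] isometric_iso_def linear_map_def using S by auto
qed

section \<open>Preduals of M-ideals in their biduals\<close>

lemma isometric_iso_surj:
  assumes "isometric_iso Z W T" "w \<in> vecs W"
  shows "\<exists>x\<in>vecs Z. T x = w"
proof -
  have "w \<in> T ` vecs Z" using assms by (simp add: isometric_iso_def bij_betw_def)
  then show ?thesis by blast
qed

text \<open>\<open>V\<close> is a subspace of its bidual, which is realised as \<open>M\<close> through \<open>E\<close>; the hypothesis \<open>approx\<close> is
  a form of the statement that \<open>V\<close> is an M-ideal in \<open>M\<close>.\<close>

locale m_embedded = V: normed V + M: normed M
  for V M :: "('k::real_or_complex, 'v::ab_group_add) nspace" +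
  fixes E :: "'v \<Rightarrow> ('v \<Rightarrow> 'k) \<Rightarrow> 'k"
  assumes V_subset: "vecs V \<subseteq> vecs M" and smul_eq: "smul V = smul M" and nrm_eq: "nrm V = nrm M"
    and E: "isometric_iso M (dual (dual V)) E"
    and E_V: "\<And>y l. y \<in> vecs V \<Longrightarrow> l \<in> vecs (dual V) \<Longrightarrow> E y l = l y"
    and goldstine: "\<And>x. x \<in> vecs M \<Longrightarrow> nrm M x \<le> 1 \<Longrightarrow>
      \<exists>\<sigma>. (\<forall>n. \<sigma> n \<in> vecs V \<and> nrm M (\<sigma> n) \<le> 1) \<and>
          (\<forall>l\<in>vecs (dual V). (\<lambda>n::nat. l (\<sigma> n)) \<longlonglongrightarrow> E x l)"
    and approx: "\<And>x. x \<in> vecs M \<Longrightarrow> nrm M x \<le> 1 \<Longrightarrow>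
      \<exists>\<sigma>. (\<forall>n. \<sigma> n \<in> vecs V) \<and> (\<forall>l\<in>vecs (dual V). (\<lambda>n::nat. l (\<sigma> n)) \<longlonglongrightarrow> E x l) \<and>
          (\<forall>y\<in>vecs V. nrm M y \<le> 1 \<longrightarrow> (\<forall>e>0. \<forall>\<^sub>F n in sequentially.
             \<forall>a. norm a \<le> 1 \<longrightarrow> nrm M (y + smul M a (x - \<sigma> n)) \<le> 1 + e))"
begin

sublocale V': normed "dual V"
  by unfold_locales (rule V.normed_space_dual)

lemma E_mem: "x \<in> vecs M \<Longrightarrow> E x \<in> vecs (dual (dual V))"
  and E_add: "x \<in> vecs M \<Longrightarrow> y \<in> vecs M \<Longrightarrow> E (x + y) = E x + E y"
  and E_smul: "x \<in> vecs M \<Longrightarrow> E (smul M c x) = (\<lambda>l. c * E x l)"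
  and nrm_E: "x \<in> vecs M \<Longrightarrow> nrm (dual (dual V)) (E x) = nrm M x"
  and inj_E: "inj_on E (vecs M)"
  using E V'.smul_dual by (auto simp: isometric_iso_def linear_map_def bij_betw_def)

lemmas E_surj = isometric_iso_surj[OF E]

lemma E_diff: "x \<in> vecs M \<Longrightarrow> y \<in> vecs M \<Longrightarrow> E (x - y) = E x - E y"
  using E_add[of "x - y" y] M.diff_mem[of x y] by simp

lemma E_bound: "x \<in> vecs M \<Longrightarrow> l \<in> vecs (dual V) \<Longrightarrow> norm (E x l) \<le> nrm M x * nrm (dual V) l"
  using V'.dual_bound[OF E_mem] by (simp add: nrm_E)

text \<open>Everything rests on \<open>key\<close>, U x w = E x (S w): an element of
  \<open>W\<close>, read as a functional on \<open>M\<close>, is recovered from its restriction S w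
  to \<open>V\<close>. It makes S isometric, because U carries the unit ball of \<open>M\<close>
  onto that of \<open>dual W\<close>. It also makes the range of S dense, because an x annihilating
  the range has U x = 0; completeness of \<open>W\<close> makes the range closed.\<close>

theorem dual_strongly_unique_predual:
  "strongly_unique_predual TYPE('w::ab_group_add) (dual V)"
  unfolding strongly_unique_predual_def
proof (intro allI impI)
  fix W :: "('k, 'w) nspace" and T
  assume W: "banach_space W" and T: "isometric_iso (dual (dual V)) (dual W) T"
  interpret W: normed W using W by unfold_locales (simp add: banach_space_def)
  have T_mem: "T \<Phi> \<in> vecs (dual W)" if "\<Phi> \<in> vecs (dual (dual V))" for \<Phi>
    using T that by (auto simp: isometric_iso_def linear_map_def)
  have T_add: "T (\<Phi> + \<Psi>) = T \<Phi> + T \<Psi>"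
    if "\<Phi> \<in> vecs (dual (dual V))" "\<Psi> \<in> vecs (dual (dual V))" for \<Phi> \<Psi>
    using T that by (auto simp: isometric_iso_def linear_map_def)
  have T_smul: "T (\<lambda>l. c * \<Phi> l) = (\<lambda>w. c * T \<Phi> w)" if "\<Phi> \<in> vecs (dual (dual V))" for c \<Phi>
    using T that by (auto simp: isometric_iso_def linear_map_def W.smul_dual V'.smul_dual)
  have nrm_T: "nrm (dual W) (T \<Phi>) = nrm (dual (dual V)) \<Phi>" if "\<Phi> \<in> vecs (dual (dual V))" for \<Phi>
    using T that by (auto simp: isometric_iso_def)
  have inj_T: "inj_on T (vecs (dual (dual V)))"
    using T by (auto simp: isometric_iso_def bij_betw_def)
  note T_surj = isometric_iso_surj[OF T]
  define U where "U x = T (E x)" for x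
  have U_mem: "U x \<in> vecs (dual W)" and nrm_U: "nrm (dual W) (U x) = nrm M x"
    and U_smul: "U (smul M c x) w = c * U x w" if "x \<in> vecs M" for x c w
    using that by (auto simp: U_def T_mem E_mem nrm_T nrm_E E_smul T_smul)
  have U_add: "U (x + y) w = U x w + U y w" if "x \<in> vecs M" "y \<in> vecs M" for x y w
    using that by (simp add: U_def E_add T_add E_mem)
  have U_diff: "U (x - y) w = U x w - U y w" if "x \<in> vecs M" "y \<in> vecs M" for x y w
    using U_add[of "x - y" y w] that by (simp add: M.diff_mem)
  have U_bound: "norm (U x w) \<le> nrm M x * nrm W w" if "x \<in> vecs M" "w \<in> vecs W" for x w
    using W.dual_bound[OF U_mem] nrm_U that by metis
  have U_surj: "\<exists>x\<in>vecs M. U x = f" if "f \<in> vecs (dual W)" for f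
    using T_surj[OF that] E_surj unfolding U_def by blast
  have U_inj: "x = y" if "x \<in> vecs M" "y \<in> vecs M" "U x = U y" for x y
    using that inj_T inj_E E_mem unfolding U_def inj_on_def by blast

  \<comment> \<open>\<open>S w\<close> is evaluation at \<open>w\<close>, transported to
    \<open>M\<close> by \<open>U\<close> and restricted to \<open>V\<close>.\<close>
  define S where "S w = (\<lambda>y. if y \<in> vecs V then U y w else 0)" for w
  have S_le: "norm (U y w) \<le> nrm W w * nrm V y" if "y \<in> vecs V" "w \<in> vecs W" for y w
    using U_bound[of y w] that V_subset by (auto simp: nrm_eq mult.commute)
  have S_mem: "S w \<in> vecs (dual V)" if w: "w \<in> vecs W" for w
    unfolding S_def
  proof (rule V.restrict_in_dual[OF _ S_le])
    show "linear_functional_on (smul V) (vecs V) (\<lambda>y. U y w)"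
      using V_subset by (auto simp: linear_functional_on_def smul_eq U_add U_smul subset_iff)
  qed (use w in auto)
  have nrm_S_le: "nrm (dual V) (S w) \<le> nrm W w" if w: "w \<in> vecs W" for w
    by (rule V.dual_nrm_le) (use w S_le W.nrm_nonneg in \<open>auto simp: S_def\<close>)
  have S_add: "S (v + w) = S v + S w" if "v \<in> vecs W" "w \<in> vecs W" for v w
    using that V_subset by (auto simp: S_def fun_eq_iff W.dual_add U_mem subset_iff)
  have S_smul: "S (smul W c w) = (\<lambda>y. c * S w y)" if "w \<in> vecs W" for c w
    using that V_subset by (auto simp: S_def fun_eq_iff W.dual_smul U_mem subset_iff)

  have key1: "U x w = E x (S w)" if x: "x \<in> vecs M" "nrm M x \<le> 1" and w: "w \<in> vecs W" for x w
  proof -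
    obtain \<sigma> where \<sigma>: "\<And>n::nat. \<sigma> n \<in> vecs V"
      and \<sigma>_lim: "\<And>l. l \<in> vecs (dual V) \<Longrightarrow> (\<lambda>n. l (\<sigma> n)) \<longlonglongrightarrow> E x l"
      and \<sigma>_nrm: "\<And>y e. y \<in> vecs V \<Longrightarrow> nrm M y \<le> 1 \<Longrightarrow> e > 0 \<Longrightarrow> \<forall>\<^sub>F n in sequentially.
             \<forall>a. norm a \<le> 1 \<longrightarrow> nrm M (y + smul M a (x - \<sigma> n)) \<le> 1 + e"
      using approx[OF x] by blast
    have \<sigma>M: "\<sigma> n \<in> vecs M" for n using \<sigma> V_subset by blast
    \<comment> \<open>\<open>f\<close> is the limit of U (\<sigma> n) pointwise on \<open>W\<close>,
      since U (\<sigma> n) w = S w (\<sigma> n). Surjectivity of \<open>U\<close> represents it by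
      some z, the limit of \<sigma> in the weak* topology given by \<open>W\<close>; the aim is x =
      z.\<close>
    define f where "f w = (if w \<in> vecs W then E x (S w) else 0)" for w
    have f: "f \<in> vecs (dual W)"
      unfolding f_def
    proof (rule W.restrict_in_dual)
      show "linear_functional_on (smul W) (vecs W) (\<lambda>w. E x (S w))"
        using V'.dual_add[OF E_mem[OF x(1)] S_mem S_mem] V'.dual_smul[OF E_mem[OF x(1)] S_mem]
        by (auto simp: linear_functional_on_def S_add S_smul V.smul_dual)
      show "norm (E x (S w)) \<le> 1 * nrm W w" if "w \<in> vecs W" for w
        using E_bound[OF x(1) S_mem[OF that]] nrm_S_le[OF that] x(2) M.nrm_nonneg[OF x(1)]
          mult_mono[OF x(2) nrm_S_le[OF that]] V.dual_nrm_nonneg[OF S_mem[OF that]] by simp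
    qed
    then obtain z where z: "z \<in> vecs M" "U z = f" using U_surj by blast
    define u where "u = x - z"
    have u: "u \<in> vecs M" unfolding u_def using x z by (intro M.diff_mem)
    \<comment> \<open>The vectors y + (x - \<sigma> n) tend to y + u pointwise on \<open>W\<close>,
      and a dual norm is lower semicontinuous for pointwise limits. Only a = 1 is used in
      \<open>approx\<close>.\<close>
    have 1: "nrm M (y + u) \<le> 1" if y: "y \<in> vecs V" "nrm M y \<le> 1" for y
    proof (rule field_le_epsilon)
      fix e :: real assume e: "e > 0"
      have yM: "y \<in> vecs M" using y V_subset by blast
      have "nrm (dual W) (U (y + u)) \<le> 1 + e"
      proof (rule W.dual_nrm_le)
        fix w assume w: "w \<in> vecs W"
        have "(\<lambda>n. S w (\<sigma> n)) \<longlonglongrightarrow> f w" using \<sigma>_lim[OF S_mem[OF w]] w by (simp add: f_def)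
        then have "(\<lambda>n. U (\<sigma> n) w) \<longlonglongrightarrow> f w" by (simp add: S_def \<sigma>)
        then have "(\<lambda>n. U y w + U x w - U (\<sigma> n) w) \<longlonglongrightarrow> U y w + U x w - f w"
          by (intro tendsto_intros)
        moreover have "U y w + U x w - U (\<sigma> n) w = U (y + smul M 1 (x - \<sigma> n)) w" for n
          using yM x \<sigma>M by (simp add: U_add U_diff M.diff_mem)
        moreover have "U y w + U x w - f w = U (y + u) w"
          using yM x u z by (simp add: U_add U_diff u_def M.diff_mem)
        ultimately have lim: "(\<lambda>n. norm (U (y + smul M 1 (x - \<sigma> n)) w)) \<longlonglongrightarrow> norm (U (y + u) w)"
          using tendsto_norm by simp
        show "norm (U (y + u) w) \<le> (1 + e) * nrm W w"
        proof (rule tendsto_upperbound[OF lim])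
          show "\<forall>\<^sub>F n in sequentially. norm (U (y + smul M 1 (x - \<sigma> n)) w) \<le> (1 + e) * nrm W w"
            using \<sigma>_nrm[OF y e]
          proof eventually_elim
            case (elim n)
            have "norm (U (y + smul M 1 (x - \<sigma> n)) w) \<le> nrm M (y + smul M 1 (x - \<sigma> n)) * nrm W w"
              using yM x \<sigma>M w by (intro U_bound M.add_mem M.smul_mem M.diff_mem)
            also have "\<dots> \<le> (1 + e) * nrm W w"
              using elim[rule_format, of 1] W.nrm_nonneg[OF w] by (intro mult_right_mono) simp_all
            finally show ?case .
          qed
        qed simp
      qed (use e in simp)
      then show "nrm M (y + u) \<le> 1 + e" using nrm_U[OF M.add_mem[OF yM u]] by simp
    qed
    \<comment> \<open>Now the limit is pointwise on \<open>dual V\<close>: \<open>u\<close> stays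
      fixed, while y in the ball of \<open>M\<close> is approximated from the ball of
      \<open>V\<close>.\<close>
    have 2: "nrm M (y + u) \<le> 1" if y: "y \<in> vecs M" "nrm M y \<le> 1" for y
    proof -
      obtain \<rho> where \<rho>: "\<And>n::nat. \<rho> n \<in> vecs V" "\<And>n. nrm M (\<rho> n) \<le> 1"
        and \<rho>_lim: "\<And>l. l \<in> vecs (dual V) \<Longrightarrow> (\<lambda>n. l (\<rho> n)) \<longlonglongrightarrow> E y l"
        using goldstine[OF y] by blast
      have "nrm (dual (dual V)) (E (y + u)) \<le> 1"
      proof (rule V'.dual_nrm_le)
        fix l assume l: "l \<in> vecs (dual V)"
        have eq: "l (\<rho> n) + E u l = E (\<rho> n + u) l" for n
          using \<rho> u l V_subset by (subst E_add) (auto simp: E_V)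
        have "(\<lambda>n. l (\<rho> n) + E u l) \<longlonglongrightarrow> E y l + E u l"
          by (intro tendsto_intros \<rho>_lim l)
        then have lim: "(\<lambda>n. norm (E (\<rho> n + u) l)) \<longlonglongrightarrow> norm (E (y + u) l)"
          unfolding eq using y u by (intro tendsto_norm) (simp add: E_add)
        have "norm (E (\<rho> n + u) l) \<le> 1 * nrm (dual V) l" for n
        proof -
          have "norm (E (\<rho> n + u) l) \<le> nrm M (\<rho> n + u) * nrm (dual V) l"
            using \<rho> u V_subset l by (intro E_bound M.add_mem) auto
          also have "\<dots> \<le> 1 * nrm (dual V) l"
            using 1[OF \<rho>] V.dual_nrm_nonneg[OF l] by (intro mult_right_mono)
          finally show ?thesis .
        qed
        then show "norm (E (y + u) l) \<le> 1 * nrm (dual V) l"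
          by (intro tendsto_upperbound[OF lim]) auto
      qed simp
      then show ?thesis using nrm_E[OF M.add_mem[OF y(1) u]] by simp
    qed
    \<comment> \<open>For y = u / ||u|| the bound just shown reads 1 + ||u|| \<le> 1.\<close>
    have "u = 0"
    proof (rule ccontr)
      assume "u \<noteq> 0"
      then have pos: "nrm M u > 0" using M.nrm_nonneg[OF u] M.nrm_eq_0[OF u] by simp
      define r where "r = inverse (nrm M u)"
      have r: "r > 0" "r * nrm M u = 1" using pos by (auto simp: r_def)
      have "nrm M (smul M (of_real r) u) = 1" using r u by (simp add: M.nrm_smul)
      then have "nrm M (smul M (of_real r) u + u) \<le> 1" using u by (intro 2) (auto intro: M.smul_mem)
      also have "smul M (of_real r) u + u = smul M (of_real (r + 1)) u"
        by (simp add: M.scale_left_distrib)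
      finally have "\<bar>r + 1\<bar> * nrm M u \<le> 1" using u by (simp only: M.nrm_smul norm_of_real)
      then show False using r pos by (simp add: distrib_right)
    qed
    then have "U x = f" using z by (simp add: u_def)
    then show ?thesis using w by (simp add: f_def)
  qed
  have key: "U x w = E x (S w)" if x: "x \<in> vecs M" and w: "w \<in> vecs W" for x w
  proof (cases "nrm M x \<le> 1")
    case False
    define r where "r = inverse (nrm M x)"
    have r: "r > 0" "r * nrm M x = 1" using False by (auto simp: r_def)
    have "nrm M (smul M (of_real r) x) \<le> 1" using r x by (simp add: M.nrm_smul)
    then have "U (smul M (of_real r) x) w = E (smul M (of_real r) x) (S w)"
      using x w by (intro key1 M.smul_mem)
    then show ?thesis using r x by (simp add: U_smul E_smul)
  qed (use key1 x w in blast)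

  have nrm_S: "nrm (dual V) (S w) = nrm W w" if w: "w \<in> vecs W" for w
  proof (rule antisym[OF nrm_S_le[OF w] W.nrm_le_dual[OF w]])
    fix f assume f: "f \<in> vecs (dual W)" "nrm (dual W) f \<le> 1"
    then obtain x where x: "x \<in> vecs M" "U x = f" using U_surj by blast
    have "norm (f w) \<le> nrm M x * nrm (dual V) (S w)"
      using E_bound[OF x(1) S_mem[OF w]] key[OF x(1) w] x by simp
    also have "\<dots> \<le> 1 * nrm (dual V) (S w)"
      using f nrm_U[OF x(1)] x V.dual_nrm_nonneg[OF S_mem[OF w]] by (intro mult_right_mono) auto
    finally show "norm (f w) \<le> nrm (dual V) (S w)" by simp
  qed
  have S_diff: "S v - S w = S (v - w)" if "v \<in> vecs W" "w \<in> vecs W" for v w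
    using S_add[of "v - w" w] that by (simp add: W.diff_mem)
  have inj_S: "inj_on S (vecs W)"
  proof (rule inj_onI)
    fix v w assume vw: "v \<in> vecs W" "w \<in> vecs W" "S v = S w"
    then have "S (v - w) = 0" using S_diff by (metis cancel_comm_monoid_add_class.diff_cancel)
    then have "nrm W (v - w) = 0" using nrm_S[of "v - w"] vw W.diff_mem V'.nrm_zero by simp
    then show "v = w" using W.nrm_eq_0[of "v - w"] vw W.diff_mem by simp
  qed
  have S_surj: "l \<in> S ` vecs W" if l: "l \<in> vecs (dual V)" for l
  proof (rule ccontr)
    assume nl: "l \<notin> S ` vecs W"
    \<comment> \<open>If the distance from l to the range were zero, preimages of approximants would
      form a Cauchy sequence because S is isometric, and their limit in \<open>W\<close> would be
      mapped to l.\<close>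
    have "\<exists>d>0. \<forall>z\<in>S ` vecs W. d \<le> nrm (dual V) (l - z)"
    proof (rule ccontr)
      assume "\<not> ?thesis"
      then have "\<exists>w\<in>vecs W. nrm (dual V) (l - S w) < d" if "d > 0" for d
        using that by (auto simp: not_le)
      then have "\<exists>w\<in>vecs W. nrm (dual V) (l - S w) < inverse (real (Suc n))" for n by simp
      then obtain \<sigma> where \<sigma>: "\<And>n. \<sigma> n \<in> vecs W"
        and \<sigma>l: "\<And>n. nrm (dual V) (l - S (\<sigma> n)) < inverse (real (Suc n))" by metis
      have lim0: "(\<lambda>n. nrm (dual V) (l - S (\<sigma> n))) \<longlonglongrightarrow> 0"
        by (rule tendsto_sandwich[OF _ _ tendsto_const LIMSEQ_inverse_real_of_nat])
          (use \<sigma>l V'.nrm_nonneg[OF V'.diff_mem[OF l S_mem[OF \<sigma>]]] in \<open>auto intro!: always_eventually less_imp_le\<close>)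
      have "\<exists>N. \<forall>m\<ge>N. \<forall>n\<ge>N. nrm W (\<sigma> m - \<sigma> n) < e" if e: "e > 0" for e
      proof -
        obtain N where N: "\<And>n. n \<ge> N \<Longrightarrow> nrm (dual V) (l - S (\<sigma> n)) < e / 2"
          using order_tendstoD(2)[OF lim0, of "e / 2"] e unfolding eventually_sequentially by auto
        have "nrm W (\<sigma> m - \<sigma> n) < e" if "m \<ge> N" "n \<ge> N" for m n
        proof -
          have "nrm W (\<sigma> m - \<sigma> n) = nrm (dual V) ((l - S (\<sigma> n)) - (l - S (\<sigma> m)))"
            using nrm_S[of "\<sigma> m - \<sigma> n"] \<sigma> S_diff by (simp add: W.diff_mem)
          also have "\<dots> \<le> nrm (dual V) (l - S (\<sigma> n)) + nrm (dual V) (l - S (\<sigma> m))"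
            by (intro V'.nrm_diff V'.diff_mem l S_mem \<sigma>)
          finally show ?thesis using N[OF that(1)] N[OF that(2)] by simp
        qed
        then show ?thesis by blast
      qed
      then obtain w where w: "w \<in> vecs W" "(\<lambda>n. nrm W (\<sigma> n - w)) \<longlonglongrightarrow> 0"
        using W \<sigma> unfolding banach_space_def by blast
      have "nrm (dual V) (l - S w) \<le> nrm (dual V) (l - S (\<sigma> n)) + nrm W (\<sigma> n - w)" for n
      proof -
        have "nrm (dual V) ((l - S (\<sigma> n)) + (S (\<sigma> n) - S w))
            \<le> nrm (dual V) (l - S (\<sigma> n)) + nrm (dual V) (S (\<sigma> n) - S w)"
          by (intro V'.nrm_add V'.diff_mem l S_mem \<sigma> w)
        also have "(l - S (\<sigma> n)) + (S (\<sigma> n) - S w) = l - S w" by simp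
        also have "S (\<sigma> n) - S w = S (\<sigma> n - w)" using S_diff \<sigma> w by blast
        also have "nrm (dual V) (S (\<sigma> n - w)) = nrm W (\<sigma> n - w)"
          using \<sigma> w by (intro nrm_S W.diff_mem)
        finally show ?thesis .
      qed
      moreover have "(\<lambda>n. nrm (dual V) (l - S (\<sigma> n)) + nrm W (\<sigma> n - w)) \<longlonglongrightarrow> 0 + 0"
        by (intro tendsto_add lim0 w)
      ultimately have "nrm (dual V) (l - S w) \<le> 0"
        using tendsto_lowerbound[of _ "0::real" sequentially "nrm (dual V) (l - S w)"] by simp
      then have "l - S w = 0"
        using V'.nrm_eq_0[of "l - S w"] V'.nrm_nonneg[of "l - S w"] V'.diff_mem l S_mem w by force
      then show False using nl w by auto
    qed
    then obtain d where d: "d > 0" "\<And>z. z \<in> S ` vecs W \<Longrightarrow> d \<le> nrm (dual V) (l - z)" by blast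
    have sub: "V'.subspace (S ` vecs W)"
    proof (rule V'.subspaceI)
      have "S 0 = 0" using S_diff[of 0 0] W.zero_mem by simp
      then show "0 \<in> S ` vecs W" using W.zero_mem by (metis imageI)
      show "x + y \<in> S ` vecs W" if "x \<in> S ` vecs W" "y \<in> S ` vecs W" for x y
        using that W.add_mem by (auto simp flip: S_add)
      show "smul (dual V) c x \<in> S ` vecs W" if "x \<in> S ` vecs W" for c x
        using that W.smul_mem by (auto simp: V.smul_dual simp flip: S_smul)
    qed
    have RV: "S ` vecs W \<subseteq> vecs (dual V)" using S_mem by blast
    obtain \<Phi> where \<Phi>: "\<Phi> \<in> vecs (dual (dual V))" "\<And>z. z \<in> S ` vecs W \<Longrightarrow> \<Phi> z = 0" "\<Phi> l \<noteq> 0"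
      using V'.separating_functional[OF sub RV l d] by blast
    obtain x where x: "x \<in> vecs M" "E x = \<Phi>" using E_surj \<Phi> by blast
    \<comment> \<open>E x vanishes on the range of S, so \<open>key\<close> makes U x vanish on all
      of \<open>W\<close>.\<close>
    have "U x = U 0"
    proof (rule W.dual_eqI)
      fix w assume w: "w \<in> vecs W"
      have "U 0 w = 0" using U_diff[of 0 0 w] M.zero_mem by simp
      then show "U x w = U 0 w" using key[OF x(1) w] x \<Phi> w by simp
    qed (use x U_mem M.zero_mem in auto)
    then have "x = 0" using U_inj x M.zero_mem by blast
    moreover have "E 0 = 0" using E_diff[of 0 0] M.zero_mem by simp
    ultimately show False using x \<Phi> by simp
  qed
  have "isometric_iso W (dual V) S"
    unfolding isometric_iso_def linear_map_def bij_betw_def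
    using S_mem S_surj inj_S nrm_S by (auto simp: S_add S_smul V.smul_dual)
  moreover have "T \<Phi> = adjoint_map W S \<Phi>" if \<Phi>: "\<Phi> \<in> vecs (dual (dual V))" for \<Phi>
  proof -
    obtain x where x: "x \<in> vecs M" "E x = \<Phi>" using E_surj \<Phi> by blast
    have "U x w = adjoint_map W S (E x) w" for w
      using key[OF x(1)] W.dual_off[OF U_mem[OF x(1)]] by (simp add: adjoint_map_def)
    then show ?thesis using x by (auto simp: U_def)
  qed
  ultimately show "\<exists>S. isometric_iso W (dual V) S \<and> (\<forall>f\<in>vecs (dual (dual V)). T f = adjoint_map W S f)"
    by blast
qed

text \<open>Functionals on \<open>V\<close> act on \<open>W\<close> through the bidual pairing E.
  Were this action the adjoint of some S from \<open>W\<close> to \<open>V\<close>, then E (g y1) =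
  E (S (g y1)) would put g y1, and with it a nonzero multiple of x0, into \<open>V\<close>. The
  delicate part is that a functional has the same norm on \<open>W\<close> as on
  \<open>V\<close>.\<close>

theorem not_strongly_unique_predual:
  assumes V_complete: "banach_space V" and neq: "vecs V \<noteq> vecs M"
  shows "\<not> strongly_unique_predual TYPE('v) V"
proof
  assume unique: "strongly_unique_predual TYPE('v) V"
  have VM: "y \<in> vecs M" if "y \<in> vecs V" for y using that V_subset by blast
  obtain x1 where x1: "x1 \<in> vecs M" "x1 \<notin> vecs V" using neq V_subset by blast
  have "x1 \<noteq> 0" using x1 V.zero_mem by auto
  then have pos: "nrm M x1 > 0" using M.nrm_nonneg[OF x1(1)] M.nrm_eq_0[OF x1(1)] by simp
  define x0 where "x0 = smul M (of_real (inverse (nrm M x1))) x1"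
  have x0: "x0 \<in> vecs M" "nrm M x0 = 1"
    using x1 pos by (auto simp: x0_def M.nrm_smul norm_inverse norm_divide intro: M.smul_mem)
  have x0V: "smul M c x0 \<notin> vecs V" if "c \<noteq> 0" for c
  proof
    assume "smul M c x0 \<in> vecs V"
    then have "smul V (of_real (nrm M x1) * inverse c) (smul M c x0) \<in> vecs V" by (rule V.smul_mem)
    moreover have "of_real (nrm M x1) * inverse c * (c * inverse (of_real (nrm M x1))) = (1::'k)"
      using that pos by (simp add: field_simps)
    ultimately show False using x1 by (simp add: smul_eq x0_def)
  qed
  obtain \<sigma> where \<sigma>: "\<And>n::nat. \<sigma> n \<in> vecs V"
    and \<sigma>_lim: "\<And>l. l \<in> vecs (dual V) \<Longrightarrow> (\<lambda>n. l (\<sigma> n)) \<longlonglongrightarrow> E x0 l"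
    and \<sigma>_nrm: "\<And>y e. y \<in> vecs V \<Longrightarrow> nrm M y \<le> 1 \<Longrightarrow> e > 0 \<Longrightarrow> \<forall>\<^sub>F n in sequentially.
           \<forall>a. norm a \<le> 1 \<longrightarrow> nrm M (y + smul M a (x0 - \<sigma> n)) \<le> 1 + e"
    using approx[OF x0(1) eq_refl[OF x0(2)]] by blast
  have \<sigma>M: "\<sigma> n \<in> vecs M" for n using \<sigma> V_subset by blast
  have E0: "E 0 = 0" using E_diff[of 0 0] M.zero_mem by simp
  \<comment> \<open>If \<open>V\<close> were zero, then \<sigma> and its limit E x0 would be zero,
    although x0 has norm one.\<close>
  obtain y1 where y1: "y1 \<in> vecs V" "y1 \<noteq> 0"
  proof (rule ccontr)
    assume "\<not> thesis"
    then have "\<sigma> n = 0" for n using \<sigma> that by blast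
    then have "E x0 l = 0" if "l \<in> vecs (dual V)" for l
      using \<sigma>_lim[OF that] V.dual_zero[OF that] by (simp add: LIMSEQ_const_iff)
    then have "E x0 = E 0"
      using V'.dual_eqI[OF E_mem[OF x0(1)] E_mem[OF M.zero_mem]] by (simp add: E0)
    then have "x0 = 0" using inj_E x0 M.zero_mem by (auto dest: inj_onD)
    then show False using x0 M.nrm_zero by simp
  qed
  obtain \<phi>1 where \<phi>1: "\<phi>1 \<in> vecs (dual V)" "nrm (dual V) \<phi>1 \<le> 1" "\<phi>1 y1 = of_real (nrm V y1)"
    using V.norming_functional[OF y1(1)] .
  \<comment> \<open>The factor 1/2 has two uses. It lets \<open>g\<close> differ from the identity
    by at most half the norm, so that \<open>g\<close> is bounded below. It also gives |\<phi> y|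
    \<le> 1/2 \<le> |1 + E x0 \<phi>| for y in the unit ball, which keeps the coefficient
    \<open>c0\<close> below in the unit disc.\<close>
  define \<phi> where "\<phi> = smul (dual V) (of_real (1/2)) \<phi>1"
  have \<phi>: "\<phi> \<in> vecs (dual V)" unfolding \<phi>_def using \<phi>1 by (intro V'.smul_mem)
  have nrm_\<phi>: "nrm (dual V) \<phi> \<le> 1/2"
    unfolding \<phi>_def V'.nrm_smul[OF \<phi>1(1)] norm_of_real using \<phi>1(2) by simp
  have \<phi>y1: "\<phi> y1 \<noteq> 0"
    using V.nrm_eq_0[OF y1(1)] y1 by (simp add: \<phi>_def V.smul_dual \<phi>1)
  have \<phi>_le: "norm (\<phi> y) \<le> nrm M y / 2" if "y \<in> vecs V" for y
  proof -
    have "norm (\<phi> y) \<le> nrm (dual V) \<phi> * nrm V y" by (rule V.dual_bound[OF \<phi> that])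
    also have "\<dots> \<le> (1/2) * nrm V y" by (rule mult_right_mono[OF nrm_\<phi> V.nrm_nonneg[OF that]])
    finally show ?thesis by (simp add: nrm_eq)
  qed
  have E\<phi>: "norm (E x0 \<phi>) \<le> 1/2" using E_bound[OF x0(1) \<phi>] x0(2) nrm_\<phi> by simp
  have E\<phi>_ne: "1 + E x0 \<phi> \<noteq> 0"
  proof
    assume "1 + E x0 \<phi> = 0"
    then have "E x0 \<phi> = - 1" by (simp add: add_eq_0_iff)
    then show False using E\<phi> by simp
  qed

  define g where "g y = y + smul M (\<phi> y) x0" for y
  have g_mem: "g y \<in> vecs M" if "y \<in> vecs V" for y
    unfolding g_def using that x0 V_subset by (intro M.add_mem M.smul_mem) auto
  have g_add: "g (x + y) = g x + g y" if "x \<in> vecs V" "y \<in> vecs V" for x y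
    using that by (simp add: g_def V.dual_add \<phi> M.scale_left_distrib)
  have g_smul: "g (smul M c x) = smul M c (g x)" if "x \<in> vecs V" for c x
    using V.dual_smul[OF \<phi> that, of c] by (simp add: g_def smul_eq M.scale_right_distrib)
  have g_diff: "g (x - y) = g x - g y" if "x \<in> vecs V" "y \<in> vecs V" for x y
    using g_add[of "x - y" y] that by (simp add: V.diff_mem)
  have nrm_smul_x0: "nrm M (smul M c x0) = norm c" for c
    using x0 by (simp add: M.nrm_smul)
  have g_ge: "nrm M y \<le> 2 * nrm M (g y)" if y: "y \<in> vecs V" for y
  proof -
    have "nrm M (g y - smul M (\<phi> y) x0) \<le> nrm M (g y) + nrm M (smul M (\<phi> y) x0)"
      using y x0 by (intro M.nrm_diff g_mem M.smul_mem)
    then have "nrm M y \<le> nrm M (g y) + norm (\<phi> y)" by (simp add: g_def nrm_smul_x0)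
    then show ?thesis using \<phi>_le[OF y] by simp
  qed
  have g_le: "nrm M (g y) \<le> 2 * nrm M y" if y: "y \<in> vecs V" for y
  proof -
    have "nrm M (g y) \<le> nrm M y + nrm M (smul M (\<phi> y) x0)"
      unfolding g_def using VM[OF y] x0 by (intro M.nrm_add M.smul_mem)
    then show ?thesis using \<phi>_le[OF y] M.nrm_nonneg[OF VM[OF y]] by (simp add: nrm_smul_x0)
  qed

  define W :: "('k, 'v) nspace" where "W = \<lparr>vecs = g ` vecs V, smul = smul M, nrm = nrm M\<rparr>"
  have W_sel: "vecs W = g ` vecs V" "smul W = smul M" "nrm W = nrm M" by (simp_all add: W_def)
  have WM: "w \<in> vecs M" if "w \<in> vecs W" for w using that g_mem by (auto simp: W_sel)
  have W_sub: "M.subspace (vecs W)"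
  proof (rule M.subspaceI)
    have "g 0 = 0" using g_diff[of 0 0] V.zero_mem by simp
    then show "0 \<in> vecs W" using V.zero_mem unfolding W_sel by (metis imageI)
    show "x + y \<in> vecs W" if "x \<in> vecs W" "y \<in> vecs W" for x y
      using that V.add_mem by (auto simp: W_sel simp flip: g_add)
    show "smul M c x \<in> vecs W" if "x \<in> vecs W" for c x
      using that V.smul_mem[unfolded smul_eq] by (auto simp: W_sel simp flip: g_smul)
  qed
  have "normed_space W"
    unfolding normed_space_def W_sel(2,3)
    using W_sub M.vector_space_axioms WM M.nrm_nonneg M.nrm_eq_0 M.nrm_add M.nrm_smul by blast
  then interpret W: normed W by unfold_locales
  have "banach_space W"
    unfolding banach_space_def
  proof (intro conjI allI impI)
    fix \<rho> :: "nat \<Rightarrow> 'v" assume *: "(\<forall>n. \<rho> n \<in> vecs W) \<and> (\<forall>e>0. \<exists>N. \<forall>m\<ge>N. \<forall>n\<ge>N. nrm W (\<rho> m - \<rho> n) < e)"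
    then have "\<forall>n. \<exists>y. y \<in> vecs V \<and> \<rho> n = g y" by (auto simp: W_sel)
    then obtain y where y: "\<And>n. y n \<in> vecs V" and \<rho>: "\<And>n. \<rho> n = g (y n)" by metis
    \<comment> \<open>By \<open>g_ge\<close>, differences in \<open>V\<close> are at most twice
      those of their images, so a Cauchy sequence in \<open>W\<close> comes from one in
      \<open>V\<close>.\<close>
    have "\<exists>N. \<forall>m\<ge>N. \<forall>n\<ge>N. nrm V (y m - y n) < e" if e: "e > 0" for e
    proof -
      obtain N where N: "\<And>m n. m \<ge> N \<Longrightarrow> n \<ge> N \<Longrightarrow> nrm W (\<rho> m - \<rho> n) < e / 2"
        using * e by (meson half_gt_zero)
      have "nrm V (y m - y n) < e" if "m \<ge> N" "n \<ge> N" for m n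
        using g_ge[OF V.diff_mem[OF y y], of m n] N[OF that]
        by (simp add: \<rho> g_diff y W_sel nrm_eq)
      then show ?thesis by blast
    qed
    then obtain z where z: "z \<in> vecs V" "(\<lambda>n. nrm V (y n - z)) \<longlonglongrightarrow> 0"
      using V_complete y unfolding banach_space_def by blast
    have "(\<lambda>n. nrm W (\<rho> n - g z)) \<longlonglongrightarrow> 0"
    proof (rule tendsto_sandwich[OF _ _ tendsto_const])
      show "(\<lambda>n. 2 * nrm V (y n - z)) \<longlonglongrightarrow> 0" using tendsto_mult_right_zero[OF z(2)] .
      show "\<forall>\<^sub>F n in sequentially. nrm W (\<rho> n - g z) \<le> 2 * nrm V (y n - z)"
        using g_le[OF V.diff_mem[OF y z(1)]]
        by (intro always_eventually) (simp add: \<rho> W_sel nrm_eq g_diff y z)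
      show "\<forall>\<^sub>F n in sequentially. 0 \<le> nrm W (\<rho> n - g z)"
        using y z by (intro always_eventually allI W.nrm_nonneg W.diff_mem) (auto simp: \<rho> W_sel)
    qed
    then show "\<exists>x\<in>vecs W. (\<lambda>n. nrm W (\<rho> n - x)) \<longlonglongrightarrow> 0" using z by (auto simp: W_sel)
  qed fact

  define T where "T l = (\<lambda>w. if w \<in> vecs W then E w l else 0)" for l
  have E_w_add: "E (v + w) l = E v l + E w l" if "v \<in> vecs M" "w \<in> vecs M" for v w l
    using that by (simp add: E_add)
  have T_le: "norm (E w l) \<le> nrm (dual V) l * nrm W w" if "w \<in> vecs W" "l \<in> vecs (dual V)" for w l
    using E_bound[OF WM] that by (simp add: W_sel(3) mult.commute)
  have T_mem: "T l \<in> vecs (dual W)" if l: "l \<in> vecs (dual V)" for l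
    unfolding T_def
  proof (rule W.restrict_in_dual[OF _ T_le])
    show "linear_functional_on (smul W) (vecs W) (\<lambda>w. E w l)"
      using WM by (auto simp: linear_functional_on_def E_w_add E_smul W_sel(2))
  qed (use l in auto)
  have T_add: "T (k + l) = T k + T l" if "k \<in> vecs (dual V)" "l \<in> vecs (dual V)" for k l
    using that WM by (auto simp: T_def fun_eq_iff V'.dual_add E_mem)
  have T_smul: "T (smul (dual V) c l) = smul (dual W) c (T l)" if "l \<in> vecs (dual V)" for c l
    using that WM by (auto simp: T_def fun_eq_iff V'.dual_smul E_mem W.smul_dual)
  have nrm_T: "nrm (dual W) (T l) = nrm (dual V) l" if l: "l \<in> vecs (dual V)" for l
  proof (rule antisym)
    show "nrm (dual W) (T l) \<le> nrm (dual V) l"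
      using l by (intro W.dual_nrm_le) (auto simp: T_def V.dual_nrm_nonneg T_le)
    define N where "N = nrm (dual W) (T l)"
    have N: "N \<ge> 0" unfolding N_def using T_mem[OF l] by (rule W.dual_nrm_nonneg)
    show "nrm (dual V) l \<le> nrm (dual W) (T l)"
    proof (rule V.dual_nrm_le_ball)
      fix y assume y: "y \<in> vecs V" "nrm V y \<le> 1"
      have yM: "y \<in> vecs M" "nrm M y \<le> 1" using y V_subset by (auto simp: nrm_eq)
      \<comment> \<open>The coefficient solves \<phi> (y - c \<sigma>_n) = c, which gives g (y - c
        \<sigma>_n) = y + c (x0 - \<sigma>_n). These elements of \<open>W\<close> converge to y
        against \<open>dual V\<close>, and \<open>approx\<close> controls their norms.\<close>
      define c where "c n = \<phi> y / (1 + \<phi> (\<sigma> n))" for n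
      define c0 where "c0 = \<phi> y / (1 + E x0 \<phi>)"
      have c_lim: "c \<longlonglongrightarrow> c0"
        unfolding c_def c0_def using E\<phi>_ne \<sigma>_lim[OF \<phi>] by (intro tendsto_intros)
      have c_le: "norm c0 \<le> 1"
      proof -
        have "1 - norm (E x0 \<phi>) \<le> norm (1 + E x0 \<phi>)"
          using norm_diff_ineq[of 1 "E x0 \<phi>"] by simp
        then have "norm (\<phi> y) \<le> norm (1 + E x0 \<phi>)"
          using E\<phi> \<phi>_le[OF y(1)] yM by simp
        then show ?thesis using E\<phi>_ne by (simp add: c0_def norm_divide)
      qed
      define w where "w n = g (y - smul M (c n) (\<sigma> n))" for n
      have pre: "y - smul M (c n) (\<sigma> n) \<in> vecs V" for n
        using V.diff_mem[OF y(1) V.smul_mem[OF \<sigma>]] by (simp add: smul_eq)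
      have wW: "w n \<in> vecs W" for n unfolding w_def W_sel using pre by blast
      have "\<forall>\<^sub>F n in sequentially. 1 + \<phi> (\<sigma> n) \<noteq> 0"
        using tendsto_add[OF tendsto_const \<sigma>_lim[OF \<phi>], of 1] E\<phi>_ne
        by (rule tendsto_imp_eventually_ne)
      then have w_eq: "\<forall>\<^sub>F n in sequentially. w n = y + smul M (c n) (x0 - \<sigma> n)"
      proof eventually_elim
        case (elim n)
        have "\<phi> (y - smul M (c n) (\<sigma> n)) = \<phi> y - c n * \<phi> (\<sigma> n)"
          using V.dual_diff[OF \<phi> y(1) V.smul_mem[OF \<sigma>]] V.dual_smul[OF \<phi> \<sigma>] by (simp add: smul_eq)
        also have "\<dots> = c n"
        proof -
          have "\<phi> y = c n * (1 + \<phi> (\<sigma> n))" using elim by (simp add: c_def)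
          then show ?thesis by (simp add: distrib_left)
        qed
        finally show ?case by (simp add: w_def g_def M.scale_right_diff_distrib)
      qed
      have "norm (l y) \<le> N * (1 + e)" if e: "e > 0" for e
      proof -
        have "(\<lambda>n. norm (l y + c n * (E x0 l - l (\<sigma> n)))) \<longlonglongrightarrow> norm (l y + c0 * (E x0 l - E x0 l))"
          by (intro tendsto_intros c_lim \<sigma>_lim l)
        then have lim1: "(\<lambda>n. norm (l y + c n * (E x0 l - l (\<sigma> n)))) \<longlonglongrightarrow> norm (l y)" by simp
        have "(\<lambda>n. N * ((1 + e) + norm (c n - c0) * (1 + e))) \<longlonglongrightarrow> N * ((1 + e) + norm (c0 - c0) * (1 + e))"
          by (intro tendsto_intros c_lim)
        then have lim2: "(\<lambda>n. N * ((1 + e) + norm (c n - c0) * (1 + e))) \<longlonglongrightarrow> N * (1 + e)" by simp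
        have n0: "nrm M 0 \<le> 1" by (simp add: M.nrm_zero)
        have "\<forall>\<^sub>F n in sequentially. norm (l y + c n * (E x0 l - l (\<sigma> n)))
            \<le> N * ((1 + e) + norm (c n - c0) * (1 + e))"
          using w_eq \<sigma>_nrm[OF y(1) yM(2) e] \<sigma>_nrm[OF V.zero_mem n0 e]
        proof eventually_elim
          case (elim n)
          have d: "x0 - \<sigma> n \<in> vecs M" using x0 \<sigma>M by (intro M.diff_mem)
          have d_le: "nrm M (x0 - \<sigma> n) \<le> 1 + e"
            using elim(3) by (metis M.nrm_zero M.scale_one add_0 norm_one order_refl zero_le_one)
          \<comment> \<open>\<open>approx\<close> covers coefficients in the unit disc, where
            \<open>c0\<close> lies but \<open>c n\<close> need not. The error c n - c0 is absorbed
            by the bound on x0 - \<sigma> n, which is \<open>approx\<close> with y = 0 and a =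
            1.\<close>
          have "w n = (y + smul M c0 (x0 - \<sigma> n)) + smul M (c n - c0) (x0 - \<sigma> n)"
            using elim(1) by (simp add: M.scale_left_diff_distrib)
          then have "nrm M (w n) \<le> nrm M (y + smul M c0 (x0 - \<sigma> n)) + nrm M (smul M (c n - c0) (x0 - \<sigma> n))"
            using yM d by (simp only:) (intro M.nrm_add M.add_mem M.smul_mem)
          also have "\<dots> \<le> (1 + e) + norm (c n - c0) * (1 + e)"
            using elim(2) c_le d d_le by (intro add_mono) (auto simp: M.nrm_smul intro: mult_left_mono)
          finally have nw: "nrm M (w n) \<le> (1 + e) + norm (c n - c0) * (1 + e)" .
          have "E (w n) l = E y l + c n * (E x0 l - E (\<sigma> n) l)"
            using elim(1) yM d x0 \<sigma>M by (simp add: E_w_add E_smul E_diff M.smul_mem)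
          then have "l y + c n * (E x0 l - l (\<sigma> n)) = T l (w n)"
            using wW by (simp add: T_def E_V y l \<sigma>)
          then have "norm (l y + c n * (E x0 l - l (\<sigma> n))) \<le> N * nrm M (w n)"
            using W.dual_bound[OF T_mem[OF l] wW] by (simp add: N_def W_sel)
          also have "\<dots> \<le> N * ((1 + e) + norm (c n - c0) * (1 + e))"
            using nw N by (rule mult_left_mono)
          finally show ?case .
        qed
        then show ?thesis by (rule tendsto_le[OF sequentially_bot lim2 lim1])
      qed
      note le = this
      have "(\<lambda>n. N * (1 + inverse (real (Suc n)))) \<longlonglongrightarrow> N * (1 + 0)"
        by (intro tendsto_intros LIMSEQ_inverse_real_of_nat)
      then show "norm (l y) \<le> nrm (dual W) (T l)"
        using le by (intro tendsto_lowerbound[of _ _ sequentially]) (auto simp: N_def)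
    qed
  qed
  have T_surj: "\<exists>l\<in>vecs (dual V). T l = G" if G: "G \<in> vecs (dual W)" for G
  proof -
    have gW: "g y \<in> vecs W" if "y \<in> vecs V" for y using that by (simp add: W_sel)
    define l1 where "l1 y = (if y \<in> vecs V then G (g y) else 0)" for y
    have l1: "l1 \<in> vecs (dual V)"
      unfolding l1_def
    proof (rule V.restrict_in_dual)
      show "linear_functional_on (smul V) (vecs V) (\<lambda>y. G (g y))"
        using W.dual_add[OF G gW gW] W.dual_smul[OF G gW]
        by (auto simp: linear_functional_on_def g_add g_smul smul_eq W_sel(2))
      show "norm (G (g y)) \<le> (nrm (dual W) G * 2) * nrm V y" if y: "y \<in> vecs V" for y
      proof -
        have "norm (G (g y)) \<le> nrm (dual W) G * nrm M (g y)"
          using W.dual_bound[OF G gW[OF y]] by (simp add: W_sel)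
        also have "\<dots> \<le> nrm (dual W) G * (2 * nrm M y)"
          using g_le[OF y] W.dual_nrm_nonneg[OF G] by (rule mult_left_mono)
        finally show ?thesis by (simp add: nrm_eq)
      qed
    qed
    \<comment> \<open>The pairing of l with g y is l y + \<phi> y * E x0 l. For l = l1 - b \<phi> it
      equals l1 y, the prescribed value G (g y), as soon as E x0 l = b. This is a linear equation
      for b, solvable because 1 + E x0 \<phi> is nonzero.\<close>
    define b where "b = E x0 l1 / (1 + E x0 \<phi>)"
    define l where "l = l1 - smul (dual V) b \<phi>"
    have b\<phi>: "smul (dual V) b \<phi> \<in> vecs (dual V)" using \<phi> by (rule V'.smul_mem)
    have l: "l \<in> vecs (dual V)" unfolding l_def using l1 b\<phi> by (rule V'.diff_mem)
    have "E x0 l = E x0 l1 - b * E x0 \<phi>"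
      unfolding l_def by (simp add: V'.dual_diff[OF E_mem[OF x0(1)] l1 b\<phi>] V'.dual_smul[OF E_mem[OF x0(1)] \<phi>])
    also have "\<dots> = b"
    proof -
      have "E x0 l1 = b * (1 + E x0 \<phi>)" using E\<phi>_ne by (simp add: b_def)
      then show ?thesis by (simp add: distrib_left)
    qed
    finally have E_l: "E x0 l = b" .
    have "T l = G"
    proof (rule W.dual_eqI[OF T_mem[OF l] G])
      fix w assume "w \<in> vecs W"
      then obtain y where y: "y \<in> vecs V" "w = g y" by (auto simp: W_sel)
      have "T l w = E (g y) l" using y gW by (simp add: T_def)
      also have "\<dots> = l y + \<phi> y * b"
        using y x0 VM l by (simp add: g_def E_w_add E_smul M.smul_mem E_V E_l)
      also have "\<dots> = G w" using y by (simp add: l_def l1_def V.smul_dual)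
      finally show "T l w = G w" .
    qed
    then show ?thesis using l by blast
  qed
  have T_diff: "T k - T l = T (k - l)" if "k \<in> vecs (dual V)" "l \<in> vecs (dual V)" for k l
    using T_add[of "k - l" l] that by (simp add: V'.diff_mem)
  have inj_T: "inj_on T (vecs (dual V))"
  proof (rule inj_onI)
    fix k l assume kl: "k \<in> vecs (dual V)" "l \<in> vecs (dual V)" "T k = T l"
    have "nrm (dual V) (k - l) = nrm (dual W) (T (k - l))" using kl by (simp add: nrm_T V'.diff_mem)
    also have "T (k - l) = 0" using T_diff[OF kl(1,2)] kl(3) by simp
    also have "nrm (dual W) 0 = 0" by (rule normed.nrm_zero) (unfold_locales, rule W.normed_space_dual)
    finally have "nrm (dual V) (k - l) = 0" .
    then have "k - l = 0" using V'.nrm_eq_0[OF V'.diff_mem[OF kl(1,2)]] by blast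
    then show "k = l" by simp
  qed
  have "T ` vecs (dual V) = vecs (dual W)" using T_mem T_surj by blast
  then have "isometric_iso (dual V) (dual W) T"
    unfolding isometric_iso_def linear_map_def bij_betw_def
    using inj_T T_add T_smul nrm_T by blast
  then obtain S where S: "isometric_iso W V S" "\<And>l. l \<in> vecs (dual V) \<Longrightarrow> T l = adjoint_map W S l"
    using unique \<open>banach_space W\<close> unfolding strongly_unique_predual_def by blast
  have w1: "g y1 \<in> vecs W" using y1 by (simp add: W_sel)
  then have Sw: "S (g y1) \<in> vecs V" using S(1) by (auto simp: isometric_iso_def linear_map_def)
  \<comment> \<open>On \<open>W\<close>, T l is both the pairing with l through E and l \<circ> S;
    letting l vary identifies g y1 with an element of \<open>V\<close>.\<close>
  have "E (g y1) = E (S (g y1))"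
  proof (rule V'.dual_eqI)
    fix l assume l: "l \<in> vecs (dual V)"
    have "E (g y1) l = T l (g y1)" using w1 by (simp add: T_def)
    also have "\<dots> = l (S (g y1))" using S(2)[OF l] w1 by (simp add: adjoint_map_def)
    finally show "E (g y1) l = E (S (g y1)) l" using Sw l by (simp add: E_V)
  qed (use y1 g_mem Sw VM E_mem in auto)
  then have "g y1 = S (g y1)" using inj_E g_mem[OF y1(1)] VM[OF Sw] by (auto dest: inj_onD)
  then have "g y1 - y1 \<in> vecs V" using V.diff_mem[OF Sw y1(1)] by simp
  then have "smul M (\<phi> y1) x0 \<in> vecs V" by (simp add: g_def)
  then show False using x0V \<phi>y1 by blast
qed

end

section \<open>The spaces \<open>M\<close> and \<open>M\<^sub>0\<close>\<close>

lemma normed_space_type_space: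
  assumes "normed_scaling s"
  shows "normed_space (type_space s)"
proof -
  interpret vector_space s using assms by (simp add: normed_scaling_def)
  show ?thesis
    using assms
    by (simp add: normed_space_def normed_scaling_def type_space_def vector_space_axioms norm_triangle_ineq)
qed

text \<open>The scalar class postulates no completeness; it is carried over from the real or complex
  numbers along the norm-preserving identification. It provides the limits that define elements of
  the bidual.\<close>

lemma scalar_Cauchy_convergent:
  fixes u :: "nat \<Rightarrow> 'k::real_or_complex"
  assumes u: "Cauchy u"
  shows "convergent u"
proof (cases rule: real_or_complex_scalars[where 'k = 'k])
  case real
  then have "\<forall>n. \<exists>a. u n = of_real a" by blast
  then obtain a where a: "\<And>n. u n = of_real (a n)" by metis
  have "norm (a m - a n) = norm (u m - u n)" for m n
    unfolding a of_real_diff[symmetric] norm_of_real by simp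
  then have "Cauchy a" using u by (simp add: Cauchy_iff)
  then obtain r where "a \<longlonglongrightarrow> r" using Cauchy_convergent convergent_def by blast
  then have "u \<longlonglongrightarrow> of_real r" unfolding a[abs_def] by (rule tendsto_of_real)
  then show ?thesis by (rule convergentI)
next
  case (complex \<phi>)
  define a where "a n = inv \<phi> (u n)" for n
  have a: "u n = \<phi> (a n)" for n using complex(4) by (simp add: a_def bij_def surj_f_inv_f)
  have \<phi>_diff: "\<phi> (z - w) = \<phi> z - \<phi> w" for z w using complex(1)[of "z - w" w] by simp
  have "norm (a m - a n) = norm (u m - u n)" for m n
    unfolding a \<phi>_diff[symmetric] complex(5) by simp
  then have "Cauchy a" using u by (simp add: Cauchy_iff)
  then obtain z where z: "a \<longlonglongrightarrow> z" using Cauchy_convergent convergent_def by blast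
  have "norm (a n - z) = norm (u n - \<phi> z)" for n
    unfolding a \<phi>_diff[symmetric] complex(5) by simp
  then have "u \<longlonglongrightarrow> \<phi> z" using z by (simp add: LIMSEQ_iff)
  then show ?thesis by (rule convergentI)
qed

text \<open>The counting step of the gliding hump arguments: each operator meets one exceptional
  index \<open>j\<close>, so the n ordinary terms cost n a and a single b is added.\<close>

lemma sum_le_all_but_one:
  fixes f :: "nat \<Rightarrow> real"
  assumes "\<And>i. i \<noteq> j \<Longrightarrow> f i \<le> a" and "\<And>i. f i \<le> b" and "0 \<le> a" "0 \<le> b"
  shows "(\<Sum>i<n. f i) \<le> real n * a + b"
proof -
  have "(\<Sum>i<n. f i) \<le> (\<Sum>i<n. a + (if i = j then b else 0))"
    using assms by (intro sum_mono) (simp add: add_increasing)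
  also have "\<dots> \<le> real n * a + b" using assms by (simp add: sum.distrib)
  finally show ?thesis .
qed

locale o_O_spaces =
  fixes sX :: "'k::real_or_complex \<Rightarrow> 'x::banach \<Rightarrow> 'x"
    and sY :: "'k \<Rightarrow> 'y::banach \<Rightarrow> 'y"
    and \<tau> :: "('x \<Rightarrow>\<^sub>L 'y) topology"
  assumes sX: "normed_scaling sX" and sY: "normed_scaling sY"
    and reflexive: "reflexive_space (type_space sX)"
    and linear: "\<And>L c x. L \<in> topspace \<tau> \<Longrightarrow> blinfun_apply L (sX c x) = sY c (blinfun_apply L x)"
    and continuous: "\<And>x. continuous_map \<tau> euclidean (\<lambda>L. blinfun_apply L x)"
    and M_banach: "banach_space (M_space sX (topspace \<tau>))"
    and M_embeds: "\<exists>C. \<forall>x\<in>vecs (M_space sX (topspace \<tau>)). norm x \<le> C * nrm (M_space sX (topspace \<tau>)) x"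
    and A: "assumption_A sX \<tau>"
begin

abbreviation "X \<equiv> type_space sX"
abbreviation "Y \<equiv> type_space sY"
abbreviation "M \<equiv> M_space sX (topspace \<tau>)"
abbreviation "M\<^sub>0 \<equiv> M0_space sX \<tau>"

sublocale X: normed X
  by unfold_locales (rule normed_space_type_space[OF sX])

sublocale Y: normed Y
  by unfold_locales (rule normed_space_type_space[OF sY])

sublocale M: normed M
  using M_banach by unfold_locales (simp add: banach_space_def)

section \<open>Elementary properties of \<open>M\<close> and \<open>M\<^sub>0\<close>\<close>

lemma space_simps [simp]: "vecs X = UNIV" "smul X = sX" "nrm X = norm" "vecs Y = UNIV" "smul Y = sY"
  "nrm Y = norm" "smul M = sX" "smul M\<^sub>0 = sX" "nrm M\<^sub>0 = nrm M"
  by (simp_all add: type_space_def M_space_def M0_space_def)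

lemma sX_of_real: "sX (of_real r) x = r *\<^sub>R x"
  using sX by (simp add: normed_scaling_def)

lemma norm_sX: "norm (sX c x) = norm c * norm x"
  and norm_sY: "norm (sY c y) = norm c * norm y"
  using sX sY by (simp_all add: normed_scaling_def)

lemma norm_le_nrm:
  assumes x: "x \<in> vecs M" and L: "L \<in> topspace \<tau>"
  shows "norm (blinfun_apply L x) \<le> nrm M x"
proof -
  have fin: "sup_norm (topspace \<tau>) x < \<infinity>" using x by (simp add: M_space_def)
  have "ennreal (norm (blinfun_apply L x)) \<le> sup_norm (topspace \<tau>) x"
    unfolding sup_norm_def using L by (rule SUP_upper)
  then have "enn2real (ennreal (norm (blinfun_apply L x))) \<le> enn2real (sup_norm (topspace \<tau>) x)"
    using fin by (intro enn2real_mono) auto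
  then show ?thesis by (simp add: M_space_def)
qed

lemma M_memI:
  assumes "0 \<le> C" "\<And>L. L \<in> topspace \<tau> \<Longrightarrow> norm (blinfun_apply L x) \<le> C"
  shows "x \<in> vecs M" "nrm M x \<le> C"
proof -
  have "sup_norm (topspace \<tau>) x \<le> ennreal C"
    unfolding sup_norm_def using assms by (intro SUP_least ennreal_leI)
  then show "x \<in> vecs M" "nrm M x \<le> C"
    using assms(1) by (auto simp: M_space_def intro: le_less_trans enn2real_leI)
qed

lemma mem_M0:
  "x \<in> vecs M\<^sub>0 \<longleftrightarrow> x \<in> vecs M \<and>
     (\<forall>e>0. \<exists>K. compactin \<tau> K \<and> (\<forall>L\<in>topspace \<tau> - K. norm (blinfun_apply L x) \<le> e))"
proof -
  have "limsup_at_infinity \<tau> x = 0 \<longleftrightarrow>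
     (\<forall>e>0. \<exists>K. compactin \<tau> K \<and> (\<forall>L\<in>topspace \<tau> - K. norm (blinfun_apply L x) \<le> e))" (is "?l \<longleftrightarrow> ?r")
  proof
    assume l: ?l
    show ?r
    proof (intro allI impI)
      fix e :: real assume "e > 0"
      then have "limsup_at_infinity \<tau> x < ennreal e" using l by simp
      then obtain K where K: "compactin \<tau> K" "sup_norm (topspace \<tau> - K) x < ennreal e"
        unfolding limsup_at_infinity_def INF_less_iff by blast
      have "norm (blinfun_apply L x) \<le> e" if L: "L \<in> topspace \<tau> - K" for L
      proof -
        have "ennreal (norm (blinfun_apply L x)) \<le> sup_norm (topspace \<tau> - K) x"
          unfolding sup_norm_def using L by (rule SUP_upper)
        also have "\<dots> \<le> ennreal e" using K by simp
        finally show ?thesis using \<open>e > 0\<close> by simp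
      qed
      then show "\<exists>K. compactin \<tau> K \<and> (\<forall>L\<in>topspace \<tau> - K. norm (blinfun_apply L x) \<le> e)"
        using K by blast
    qed
  next
    assume r: ?r
    have "limsup_at_infinity \<tau> x \<le> 0"
    proof (rule ennreal_le_epsilon)
      fix e :: real assume "e > 0"
      then obtain K where K: "compactin \<tau> K" "\<forall>L\<in>topspace \<tau> - K. norm (blinfun_apply L x) \<le> e"
        using r by blast
      have "limsup_at_infinity \<tau> x \<le> sup_norm (topspace \<tau> - K) x"
        unfolding limsup_at_infinity_def using K by (intro INF_lower) simp
      also have "\<dots> \<le> ennreal e"
        unfolding sup_norm_def using K by (intro SUP_least ennreal_leI) blast
      finally show "limsup_at_infinity \<tau> x \<le> 0 + ennreal e" by simp
    qed
    then show ?l by simp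
  qed
  then show ?thesis by (auto simp: M0_space_def)
qed

lemma M0_subset: "vecs M\<^sub>0 \<subseteq> vecs M"
  using mem_M0 by blast

lemma M0_small:
  assumes "x \<in> vecs M\<^sub>0" "0 < e"
  obtains K where "compactin \<tau> K" "\<And>L. L \<in> topspace \<tau> - K \<Longrightarrow> norm (blinfun_apply L x) \<le> e"
  using assms mem_M0 by blast

lemma subspace_M0: "M.subspace (vecs M\<^sub>0)"
proof (rule M.subspaceI)
  show "0 \<in> vecs M\<^sub>0" unfolding mem_M0 using M.zero_mem by (auto simp: blinfun.zero_right)
  show "x + y \<in> vecs M\<^sub>0" if xy: "x \<in> vecs M\<^sub>0" "y \<in> vecs M\<^sub>0" for x y
    unfolding mem_M0
  proof (intro conjI allI impI)
    show "x + y \<in> vecs M" using xy M0_subset by (intro M.add_mem) auto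
    fix e :: real assume "e > 0"
    then have e2: "e / 2 > 0" by simp
    obtain K where K: "compactin \<tau> K" "\<And>L. L \<in> topspace \<tau> - K \<Longrightarrow> norm (blinfun_apply L x) \<le> e / 2"
      using M0_small[OF xy(1) e2] by blast
    obtain K' where K': "compactin \<tau> K'" "\<And>L. L \<in> topspace \<tau> - K' \<Longrightarrow> norm (blinfun_apply L y) \<le> e / 2"
      using M0_small[OF xy(2) e2] by blast
    have "norm (blinfun_apply L (x + y)) \<le> e" if "L \<in> topspace \<tau> - (K \<union> K')" for L
      using K(2)[of L] K'(2)[of L] that norm_triangle_ineq[of "blinfun_apply L x" "blinfun_apply L y"]
      by (simp add: blinfun.add_right)
    moreover have "compactin \<tau> (K \<union> K')" using K K' by (intro compactin_Un)
    ultimately show "\<exists>K. compactin \<tau> K \<and> (\<forall>L\<in>topspace \<tau> - K. norm (blinfun_apply L (x + y)) \<le> e)"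
      by blast
  qed
  show "smul M c x \<in> vecs M\<^sub>0" if x: "x \<in> vecs M\<^sub>0" for c x
    unfolding mem_M0
  proof (intro conjI allI impI)
    show "smul M c x \<in> vecs M" using x M0_subset by (intro M.smul_mem) auto
    fix e :: real assume "e > 0"
    then have e2: "e / (norm c + 1) > 0" by (simp add: add_nonneg_pos)
    obtain K where K: "compactin \<tau> K"
      "\<And>L. L \<in> topspace \<tau> - K \<Longrightarrow> norm (blinfun_apply L x) \<le> e / (norm c + 1)"
      using M0_small[OF x e2] by blast
    have "norm (blinfun_apply L (smul M c x)) \<le> e" if L: "L \<in> topspace \<tau> - K" for L
    proof -
      have "norm (blinfun_apply L (smul M c x)) = norm c * norm (blinfun_apply L x)"
        using L by (simp add: linear norm_sY)
      also have "\<dots> \<le> (norm c + 1) * (e / (norm c + 1))"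
        using K(2)[OF L] by (intro mult_mono) auto
      also have "\<dots> = e" using norm_ge_zero[of c] by (simp add: add_nonneg_eq_0_iff)
      finally show ?thesis .
    qed
    then show "\<exists>K. compactin \<tau> K \<and> (\<forall>L\<in>topspace \<tau> - K. norm (blinfun_apply L (smul M c x)) \<le> e)"
      using K by blast
  qed
qed

lemma normed_space_M0: "normed_space M\<^sub>0"
  unfolding normed_space_def
  using M.vector_space_axioms subspace_M0 M0_subset M.nrm_nonneg M.nrm_eq_0 M.nrm_add M.nrm_smul
  by (auto simp: subset_iff)

sublocale V: normed M\<^sub>0
  by unfold_locales (rule normed_space_M0)

sublocale V': normed "dual M\<^sub>0"
  by unfold_locales (rule V.normed_space_dual)

sublocale V'': normed "dual (dual M\<^sub>0)"
  by unfold_locales (rule V'.normed_space_dual)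

text \<open>The norm of \<open>M\<close> is uniform over all operators, so a compact set that serves
  a close approximant from \<open>M\<^sub>0\<close> also serves the limit: \<open>M\<^sub>0\<close>
  is closed in \<open>M\<close>.\<close>

lemma banach_space_M0: "banach_space M\<^sub>0"
  unfolding banach_space_def
proof (intro conjI allI impI)
  fix \<sigma> :: "nat \<Rightarrow> 'x"
  assume \<sigma>: "(\<forall>n. \<sigma> n \<in> vecs M\<^sub>0) \<and> (\<forall>e>0. \<exists>N. \<forall>m\<ge>N. \<forall>n\<ge>N. nrm M\<^sub>0 (\<sigma> m - \<sigma> n) < e)"
  then have \<sigma>V: "\<sigma> n \<in> vecs M\<^sub>0" and \<sigma>M: "\<sigma> n \<in> vecs M" for n using M0_subset by auto
  obtain x where x: "x \<in> vecs M" and lim: "(\<lambda>n. nrm M (\<sigma> n - x)) \<longlonglongrightarrow> 0"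
    using M_banach \<sigma> \<sigma>M unfolding banach_space_def space_simps by blast
  have "x \<in> vecs M\<^sub>0"
    unfolding mem_M0
  proof (intro conjI x allI impI)
    fix e :: real assume e: "e > 0"
    then have "\<forall>\<^sub>F n in sequentially. nrm M (\<sigma> n - x) < e / 2" using lim by (intro order_tendstoD(2)) auto
    then obtain n where n: "nrm M (\<sigma> n - x) < e / 2" by (auto simp: eventually_sequentially)
    obtain K where K: "compactin \<tau> K" "\<And>L. L \<in> topspace \<tau> - K \<Longrightarrow> norm (blinfun_apply L (\<sigma> n)) \<le> e / 2"
      using M0_small[OF \<sigma>V, of "e / 2"] e by auto
    have "norm (blinfun_apply L x) \<le> e" if L: "L \<in> topspace \<tau> - K" for L
    proof -
      have "blinfun_apply L x = blinfun_apply L (\<sigma> n) - blinfun_apply L (\<sigma> n - x)"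
        by (simp add: blinfun.diff_right)
      then have "norm (blinfun_apply L x) \<le> norm (blinfun_apply L (\<sigma> n)) + norm (blinfun_apply L (\<sigma> n - x))"
        by (simp add: norm_triangle_ineq4)
      then show ?thesis using K(2)[OF L] n norm_le_nrm[OF M.diff_mem[OF \<sigma>M x], of L n] L by simp
    qed
    then show "\<exists>K. compactin \<tau> K \<and> (\<forall>L\<in>topspace \<tau> - K. norm (blinfun_apply L x) \<le> e)"
      using K by blast
  qed
  then show "\<exists>x\<in>vecs M\<^sub>0. (\<lambda>n. nrm M\<^sub>0 (\<sigma> n - x)) \<longlonglongrightarrow> 0" using lim by auto
qed (rule normed_space_M0)

section \<open>Compact sets of operators, gliding humps and functionals on
  \<open>M\<^sub>0\<close>\<close>

lemma compact_bound:
  assumes K: "compactin \<tau> K"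
  obtains C where "0 \<le> C" "\<And>L x. L \<in> K \<Longrightarrow> norm (blinfun_apply L x) \<le> C * norm x"
proof (rule uniform_boundedness[of K])
  fix x
  \<comment> \<open>Continuity in \<tau> concerns one vector at a time, so compactness yields
    pointwise bounds only; uniform boundedness turns them into a common bound. As a result, vectors
    small in X are uniformly small under all operators in \<open>K\<close>.\<close>
  have "compactin euclidean ((\<lambda>L. blinfun_apply L x) ` K)"
    using K continuous by (rule image_compactin)
  then have "bounded ((\<lambda>L. blinfun_apply L x) ` K)"
    by (simp add: compact_imp_bounded)
  then show "\<exists>C. \<forall>L\<in>K. norm (blinfun_apply L x) \<le> C"
    by (auto simp: bounded_iff)
qed (use that in blast)

text \<open>The gliding hump: each \<open>L\<close> has one index \<open>j\<close> such that \<open>L \<xi>\<^sub>i\<close> is small before \<open>j\<close> and \<open>L (\<xi>\<^sub>i - x)\<close> is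
  small after \<open>j\<close>.\<close>

lemma gliding_hump:
  assumes A0: "A \<subseteq> vecs M\<^sub>0" and near: "\<And>\<eta>. 0 < \<eta> \<Longrightarrow> \<exists>\<xi>\<in>A. norm (\<xi> - x) < \<eta>" and \<eta>: "0 < \<eta>"
  obtains \<xi> :: "nat \<Rightarrow> 'x" where "\<And>n. \<xi> n \<in> A" "\<And>n. norm (\<xi> n - x) < \<eta>"
    "\<And>L. L \<in> topspace \<tau> \<Longrightarrow>
       \<exists>j. \<forall>i. i \<noteq> j \<longrightarrow> norm (blinfun_apply L (\<xi> i)) \<le> \<eta> \<or> norm (blinfun_apply L (\<xi> i - x)) \<le> \<eta>"
proof -
  \<comment> \<open>A pair holds a vector and a compact set of operators outside which the vector is
    small. \<open>Q\<close> makes the compact sets increase and asks the next vector to be close to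
    x under all operators of the current set.\<close>
  define P where "P p \<longleftrightarrow> fst p \<in> A \<and> norm (fst p - x) < \<eta> \<and> compactin \<tau> (snd p) \<and>
    (\<forall>L\<in>topspace \<tau> - snd p. norm (blinfun_apply L (fst p)) \<le> \<eta>)" for p :: "'x \<times> ('x \<Rightarrow>\<^sub>L 'y) set"
  define Q where "Q p q \<longleftrightarrow> snd p \<subseteq> snd q \<and> (\<forall>L\<in>snd p. norm (blinfun_apply L (fst q - x)) \<le> \<eta>)"
    for p q :: "'x \<times> ('x \<Rightarrow>\<^sub>L 'y) set"
  have step: "\<exists>q. P q \<and> Q (y, K) q" if K: "compactin \<tau> K" for y K
  proof -
    obtain C where C: "0 \<le> C" "\<And>L x. L \<in> K \<Longrightarrow> norm (blinfun_apply L x) \<le> C * norm x"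
      using compact_bound[OF K] by blast
    have "min \<eta> (\<eta> / (C + 1)) > 0" using C(1) \<eta> by simp
    then obtain \<xi> where \<xi>: "\<xi> \<in> A" "norm (\<xi> - x) < min \<eta> (\<eta> / (C + 1))" using near by blast
    obtain K' where K': "compactin \<tau> K'" "\<And>L. L \<in> topspace \<tau> - K' \<Longrightarrow> norm (blinfun_apply L \<xi>) \<le> \<eta>"
      using M0_small[of \<xi> \<eta>] \<xi> A0 \<eta> by blast
    have "norm (blinfun_apply L (\<xi> - x)) \<le> \<eta>" if "L \<in> K" for L
    proof -
      have "norm (blinfun_apply L (\<xi> - x)) \<le> C * norm (\<xi> - x)" using C that by blast
      also have "\<dots> \<le> (C + 1) * (\<eta> / (C + 1))" using C \<xi> by (intro mult_mono) auto
      also have "\<dots> = \<eta>" using C by simp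
      finally show ?thesis .
    qed
    then have "P (\<xi>, K \<union> K')" "Q (y, K) (\<xi>, K \<union> K')"
      using \<xi> K K' by (auto simp: P_def Q_def compactin_Un)
    then show ?thesis by blast
  qed
  have "\<exists>p. P p" using step[OF compactin_empty] by blast
  moreover have "\<exists>q. P q \<and> Q p q" if "P p" for p
    using step[of "snd p" "fst p"] that by (simp add: P_def)
  ultimately obtain p where p: "\<And>n::nat. P (p n)" "\<And>n. Q (p n) (p (Suc n))"
    using dependent_nat_choice[of "\<lambda>_. P" "\<lambda>_. Q"] by blast
  have mono: "snd (p i) \<subseteq> snd (p j)" if "i \<le> j" for i j
    using p(2) by (intro lift_Suc_mono_le[of "\<lambda>i. snd (p i)", OF _ that]) (simp add: Q_def)
  show thesis
  proof (rule that[of "\<lambda>n. fst (p n)"])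
    show "fst (p n) \<in> A" "norm (fst (p n) - x) < \<eta>" for n using p(1) by (auto simp: P_def)
    fix L assume L: "L \<in> topspace \<tau>"
    show "\<exists>j. \<forall>i. i \<noteq> j \<longrightarrow> norm (blinfun_apply L (fst (p i))) \<le> \<eta> \<or> norm (blinfun_apply L (fst (p i) - x)) \<le> \<eta>"
    proof (cases "\<exists>n. L \<in> snd (p n)")
      case False
      then show ?thesis using p(1) L unfolding P_def by blast
    next
      case True
      \<comment> \<open>For i < j, L is outside the i-th compact set; for i > j, L belongs already
        to the set preceding the choice of the i-th vector.\<close>
      define j where "j = (LEAST n. L \<in> snd (p n))"
      have j: "L \<in> snd (p j)" unfolding j_def using True by (rule LeastI_ex)
      have "norm (blinfun_apply L (fst (p i))) \<le> \<eta> \<or> norm (blinfun_apply L (fst (p i) - x)) \<le> \<eta>" if ij: "i \<noteq> j" for i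
      proof (cases "i < j")
        case True
        then have "L \<notin> snd (p i)" unfolding j_def by (rule not_less_Least)
        then show ?thesis using p(1) L unfolding P_def by blast
      next
        case False
        then obtain m where m: "i = Suc m" "j \<le> m" using ij by (cases i) auto
        then have "L \<in> snd (p m)" using j mono by blast
        then show ?thesis using p(2)[of m] m unfolding Q_def by blast
      qed
      then show ?thesis by blast
    qed
  qed
qed

text \<open>If no C worked, there would be vectors of M-norm at most 1 in \<open>M\<^sub>0\<close>,
  arbitrarily small in X, at which l is real and at least e. The sum of n of them along a gliding
  hump with x = 0 has M-norm at most 2, while l is at least n e on it; this contradicts the
  boundedness of l.\<close>

lemma functional_bound:
  assumes l: "l \<in> vecs (dual M\<^sub>0)" and e: "0 < e"
  obtains C where "0 \<le> C" "\<And>y. y \<in> vecs M\<^sub>0 \<Longrightarrow> norm (l y) \<le> e * nrm M y + C * norm y"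
proof (rule ccontr)
  assume no: "\<not> thesis"
  note bound = that
  have ex: "\<exists>y\<in>vecs M\<^sub>0. norm (l y) > e * nrm M y + C * norm y" if C: "C \<ge> 0" for C
    using bound[OF C] no by (meson not_le)
  define N where "N = nrm (dual M\<^sub>0) l"
  have N: "N \<ge> 0" unfolding N_def using l by (rule V.dual_nrm_nonneg)
  have l_le: "norm (l y) \<le> N * nrm M y" if "y \<in> vecs M\<^sub>0" for y
    using V.dual_bound[OF l that] by (simp add: N_def)
  define A where "A = {y\<in>vecs M\<^sub>0. nrm M y \<le> 1 \<and> (\<exists>r\<ge>e. l y = of_real r)}"
  have "\<exists>\<xi>\<in>A. norm (\<xi> - 0) < \<eta>" if \<eta>: "\<eta> > 0" for \<eta>
  proof -
    \<comment> \<open>For C = (N + 1) / \<eta> the failure of the bound, together with |l y| \<le> N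
      ||y||_M, gives (N + 1) ||y|| < \<eta> N ||y||_M. Normalising y in \<open>M\<close> thus leaves
      it with X-norm below \<eta>.\<close>
    have "(N + 1) / \<eta> \<ge> 0" using N \<eta> by simp
    then obtain y where y: "y \<in> vecs M\<^sub>0" and big: "norm (l y) > e * nrm M y + (N + 1) / \<eta> * norm y"
      using ex by blast
    have yM: "y \<in> vecs M" using y M0_subset by blast
    have "y \<noteq> 0" using big V.dual_zero[OF l] by (auto simp: M.nrm_zero)
    then have pos: "nrm M y > 0" using M.nrm_nonneg[OF yM] M.nrm_eq_0[OF yM] by simp
    obtain c where c: "norm c = 1" "c * l y = of_real (norm (l y))" by (rule unit_rotation)
    \<comment> \<open>The rotation makes the value of l positive, so that the values cannot cancel
      in the sum.\<close>
    define a where "a = of_real (inverse (nrm M y)) * c"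
    have norm_a: "norm a = inverse (nrm M y)" using pos c by (simp add: a_def norm_mult norm_inverse norm_divide)
    have mem: "sX a y \<in> vecs M\<^sub>0" using V.smul_mem[OF y, of a] by simp
    have "nrm M (sX a y) = 1" using M.nrm_smul[OF yM, of a] norm_a pos by simp
    moreover have "l (sX a y) = of_real (norm (l y) / nrm M y)"
    proof -
      have "l (sX a y) = of_real (inverse (nrm M y)) * (c * l y)"
        using V.dual_smul[OF l y, of a] by (simp add: a_def mult.assoc)
      then show ?thesis unfolding c by (simp add: divide_inverse)
    qed
    moreover have "e \<le> norm (l y) / nrm M y"
    proof -
      have "0 \<le> (N + 1) / \<eta> * norm y" using N \<eta> by simp
      then have "e * nrm M y \<le> norm (l y)" using big by linarith
      then show ?thesis using pos by (simp add: field_simps)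
    qed
    ultimately have "sX a y \<in> A" using mem unfolding A_def by auto
    moreover have "norm (sX a y) < \<eta>"
    proof -
      have "(N + 1) / \<eta> * norm y < N * nrm M y"
        using big l_le[OF y] mult_pos_pos[OF e pos] by linarith
      then have "(N + 1) * norm y < N * nrm M y * \<eta>" using \<eta> by (simp add: field_simps)
      also have "\<dots> \<le> (N + 1) * (nrm M y * \<eta>)" using pos \<eta> by (simp add: algebra_simps)
      finally have "norm y < nrm M y * \<eta>" using N by (simp add: mult_less_cancel_left)
      then show ?thesis using pos by (simp add: norm_sX norm_a field_simps)
    qed
    ultimately show ?thesis by (intro bexI[of _ "sX a y"]) simp_all
  qed
  note near = this
  \<comment> \<open>Then n e exceeds 2 N, the largest modulus of l on vectors of M-norm 2. The hump
    tolerance 1 / n adds up to at most 1, and the exceptional term to at most 1 more.\<close>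
  obtain n :: nat where n: "2 * N / e < real n" using reals_Archimedean2 by blast
  have n0: "real n > 0" using n N e by (meson divide_nonneg_pos less_le_trans mult_nonneg_nonneg not_less zero_le_numeral)
  have A0: "A \<subseteq> vecs M\<^sub>0" unfolding A_def by blast
  obtain \<xi> :: "nat \<Rightarrow> 'x" where \<xi>A: "\<And>n. \<xi> n \<in> A"
    and \<xi>: "\<And>L. L \<in> topspace \<tau> \<Longrightarrow> \<exists>j. \<forall>i. i \<noteq> j \<longrightarrow> norm (blinfun_apply L (\<xi> i)) \<le> 1 / real n \<or>
         norm (blinfun_apply L (\<xi> i - 0)) \<le> 1 / real n"
    using gliding_hump[OF A0 near, of "1 / real n"] n0 by (metis zero_less_divide_1_iff)
  define z where "z = (\<Sum>i<n. \<xi> i)"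
  have z: "z \<in> vecs M\<^sub>0" unfolding z_def using \<xi>A A0 by (intro V.subspace_sum[OF V.subspace_vecs]) auto
  have "nrm M z \<le> 2"
  proof (rule M_memI(2))
    fix L assume L: "L \<in> topspace \<tau>"
    obtain j where j: "\<And>i. i \<noteq> j \<Longrightarrow> norm (blinfun_apply L (\<xi> i)) \<le> 1 / real n" using \<xi>[OF L] by auto
    have le1: "norm (blinfun_apply L (\<xi> i)) \<le> 1" for i
      using norm_le_nrm[OF _ L, of "\<xi> i"] \<xi>A[of i] M0_subset unfolding A_def by force
    have "norm (blinfun_apply L z) \<le> (\<Sum>i<n. norm (blinfun_apply L (\<xi> i)))"
      unfolding z_def blinfun.sum_right by (rule norm_sum)
    also have "\<dots> \<le> real n * (1 / real n) + 1" using j le1 by (intro sum_le_all_but_one) auto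
    finally show "norm (blinfun_apply L z) \<le> 2" using n0 by simp
  qed simp
  have "\<forall>i. \<exists>r. r \<ge> e \<and> l (\<xi> i) = of_real r" using \<xi>A unfolding A_def by blast
  then obtain r where r: "\<And>i. r i \<ge> e" "\<And>i. l (\<xi> i) = of_real (r i)" by metis
  have "l (\<Sum>i<m. \<xi> i) = of_real (\<Sum>i<m. r i)" for m
  proof (induction m)
    case (Suc m)
    have "(\<Sum>i<m. \<xi> i) \<in> vecs M\<^sub>0" using \<xi>A A0 by (intro V.subspace_sum[OF V.subspace_vecs]) auto
    then show ?case using Suc \<xi>A A0 r by (auto simp: V.dual_add[OF l] subset_iff)
  qed (simp add: V.dual_zero[OF l])
  then have "norm (l z) = \<bar>\<Sum>i<n. r i\<bar>" unfolding z_def by (simp only: norm_of_real)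
  moreover have "real n * e \<le> (\<Sum>i<n. r i)" using sum_mono[of "{..<n}" "\<lambda>_. e" r] r by simp
  moreover have "norm (l z) \<le> N * 2"
    using l_le[OF z] mult_left_mono[OF \<open>nrm M z \<le> 2\<close> N] by linarith
  moreover have "2 * N < real n * e" using n e by (simp add: field_simps)
  ultimately show False by linarith
qed

text \<open>This is the density of X* in M_0*. The sandwich theorem splits l along the two seminorms
  of \<open>functional_bound\<close>, into a part of norm at most e and the restriction of a
  functional bounded on all of X.\<close>

lemma functional_approx:
  assumes l: "l \<in> vecs (dual M\<^sub>0)" and e: "0 < e"
  obtains g where "g \<in> vecs (dual X)" "\<And>y. y \<in> vecs M\<^sub>0 \<Longrightarrow> norm (l y - g y) \<le> e * nrm M y"
proof -
  obtain C where C: "0 \<le> C" "\<And>y. y \<in> vecs M\<^sub>0 \<Longrightarrow> norm (l y) \<le> e * nrm M y + C * norm y"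
    using functional_bound[OF l e] by blast
  have p1: "seminorm_on sX (vecs M\<^sub>0) (\<lambda>y. e * nrm M y)"
    unfolding seminorm_on_def
  proof (intro conjI ballI allI)
    show "e * nrm M (x + y) \<le> e * nrm M x + e * nrm M y" if "x \<in> vecs M\<^sub>0" "y \<in> vecs M\<^sub>0" for x y
      using mult_left_mono[OF V.nrm_add[OF that], of e] e by (simp add: distrib_left)
    show "e * nrm M (sX c x) = norm c * (e * nrm M x)" if "x \<in> vecs M\<^sub>0" for c x
      using V.nrm_smul[OF that, of c] by simp
  qed
  have p2: "seminorm_on sX UNIV (\<lambda>y. C * norm y)"
    unfolding seminorm_on_def
  proof (intro conjI ballI allI)
    show "C * norm (x + y) \<le> C * norm x + C * norm y" for x y :: 'x
      using mult_left_mono[OF norm_triangle_ineq C(1)] by (simp add: distrib_left)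
  qed (simp add: norm_sX)
  have lin: "linear_functional_on sX (vecs M\<^sub>0) l" using l by (simp add: V.mem_dual)
  obtain g where g: "linear_functional_on sX UNIV g"
    "\<And>y. y \<in> vecs M\<^sub>0 \<Longrightarrow> norm (l y - g y) \<le> e * nrm M y" "\<And>y. norm (g y) \<le> C * norm y"
    using hahn_banach_sandwich[OF _ _ _ _ p1 p2 lin C(2)] X.vector_space_axioms X.subspace_UNIV V.subspace_vecs
    by auto
  have "g \<in> vecs (dual X)" using g by (intro X.dual_memI[of _ C]) auto
  then show thesis using g that by blast
qed

section \<open>Restriction of functionals and the bidual of \<open>M\<^sub>0\<close>\<close>

abbreviation "J \<equiv> adjoint_map M\<^sub>0 (\<lambda>x. x)"

lemma J_apply: "y \<in> vecs M\<^sub>0 \<Longrightarrow> J g y = g y"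
  by (simp add: adjoint_map_def)

lemma J_bounded:
  obtains C where "0 \<le> C" "\<And>g. g \<in> vecs (dual X) \<Longrightarrow> J g \<in> vecs (dual M\<^sub>0)"
    "\<And>g. g \<in> vecs (dual X) \<Longrightarrow> nrm (dual M\<^sub>0) (J g) \<le> nrm (dual X) g * C"
proof -
  obtain C0 where C0: "\<And>x. x \<in> vecs M \<Longrightarrow> norm x \<le> C0 * nrm M x" using M_embeds by blast
  define C where "C = \<bar>C0\<bar>"
  have C: "norm x \<le> C * nrm M x" if "x \<in> vecs M\<^sub>0" for x
    using C0[of x] that M0_subset V.nrm_nonneg[OF that] mult_right_mono[of C0 C "nrm M x"]
    by (force simp: C_def)
  have le: "norm (g x) \<le> (nrm (dual X) g * C) * nrm M\<^sub>0 x" if "g \<in> vecs (dual X)" "x \<in> vecs M\<^sub>0" for g x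
  proof -
    have "norm (g x) \<le> nrm (dual X) g * norm x" using X.dual_bound[of g x] that by simp
    also have "\<dots> \<le> nrm (dual X) g * (C * nrm M x)"
      using that by (intro mult_left_mono C X.dual_nrm_nonneg)
    finally show ?thesis by (simp add: mult.assoc)
  qed
  show thesis
  proof (rule that[of C])
    show "J g \<in> vecs (dual M\<^sub>0)" if g: "g \<in> vecs (dual X)" for g
      unfolding adjoint_map_def
    proof (rule V.restrict_in_dual[OF _ le[OF g]])
      show "linear_functional_on (smul M\<^sub>0) (vecs M\<^sub>0) g"
        using g by (simp add: X.mem_dual linear_functional_on_def)
    qed
    show "nrm (dual M\<^sub>0) (J g) \<le> nrm (dual X) g * C" if g: "g \<in> vecs (dual X)" for g
      using le[OF g] X.dual_nrm_nonneg[OF g]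
      by (intro V.dual_nrm_le) (auto simp: J_apply C_def)
  qed (simp add: C_def)
qed

lemma J_mem: "g \<in> vecs (dual X) \<Longrightarrow> J g \<in> vecs (dual M\<^sub>0)"
  using J_bounded by metis

lemma nrm_diff_J_le:
  assumes "l \<in> vecs (dual M\<^sub>0)" "0 \<le> e" "\<And>y. y \<in> vecs M\<^sub>0 \<Longrightarrow> norm (l y - g y) \<le> e * nrm M y"
  shows "nrm (dual M\<^sub>0) (l - J g) \<le> e"
  using assms by (intro V.dual_nrm_le) (auto simp: J_apply)

lemma X_eqI:
  assumes "\<And>g. g \<in> vecs (dual X) \<Longrightarrow> g x = g y"
  shows "x = y"
proof -
  have "nrm X (x - y) \<le> 0"
    using assms by (intro X.nrm_le_dual) (auto simp: X.dual_diff)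
  then show ?thesis by simp
qed

text \<open>Elements of the bidual are continuous, and the functionals \<open>J g\<close> are dense
  in \<open>dual M\<^sub>0\<close> by \<open>functional_approx\<close>. This is the source of the
  injectivity of the canonical map.\<close>

lemma bidual_eqI:
  assumes \<Phi>: "\<Phi> \<in> vecs (dual (dual M\<^sub>0))" and \<Psi>: "\<Psi> \<in> vecs (dual (dual M\<^sub>0))"
    and eq: "\<And>g. g \<in> vecs (dual X) \<Longrightarrow> \<Phi> (J g) = \<Psi> (J g)"
  shows "\<Phi> = \<Psi>"
proof (rule V'.dual_eqI[OF \<Phi> \<Psi>])
  fix l assume l: "l \<in> vecs (dual M\<^sub>0)"
  define \<Theta> where "\<Theta> = \<Phi> - \<Psi>"
  have \<Theta>: "\<Theta> \<in> vecs (dual (dual M\<^sub>0))" unfolding \<Theta>_def using \<Phi> \<Psi> by (rule V''.diff_mem)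
  have "norm (\<Theta> l) \<le> 0 + e" if e: "e > 0" for e
  proof -
    define N where "N = nrm (dual (dual M\<^sub>0)) \<Theta>"
    have N: "N \<ge> 0" unfolding N_def using \<Theta> by (rule V'.dual_nrm_nonneg)
    have e': "e / (N + 1) > 0" using e N by simp
    obtain g where g: "g \<in> vecs (dual X)" "\<And>y. y \<in> vecs M\<^sub>0 \<Longrightarrow> norm (l y - g y) \<le> e / (N + 1) * nrm M y"
      using functional_approx[OF l e'] by blast
    have "nrm (dual M\<^sub>0) (l - J g) \<le> e / (N + 1)"
      by (rule nrm_diff_J_le[OF l less_imp_le[OF e'] g(2)])
    have "\<Theta> (l - J g) = \<Theta> l - \<Theta> (J g)" by (rule V'.dual_diff[OF \<Theta> l J_mem[OF g(1)]])
    then have "norm (\<Theta> l) = norm (\<Theta> (l - J g))" using eq[OF g(1)] by (simp add: \<Theta>_def)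
    also have "\<dots> \<le> N * nrm (dual M\<^sub>0) (l - J g)"
      unfolding N_def by (rule V'.dual_bound[OF \<Theta> V'.diff_mem[OF l J_mem[OF g(1)]]])
    also have "\<dots> \<le> N * (e / (N + 1))" using \<open>nrm _ (l - J g) \<le> _\<close> N by (rule mult_left_mono)
    also have "\<dots> \<le> e" using N e by (simp add: field_simps)
    finally show ?thesis by simp
  qed
  then have "norm (\<Theta> l) \<le> 0" by (rule field_le_epsilon)
  then show "\<Phi> l = \<Psi> l" by (simp add: \<Theta>_def)
qed

text \<open>For a sequence bounded in \<open>M\<close>, convergence against the dense set of
  functionals \<open>J g\<close> extends to all of \<open>dual M\<^sub>0\<close>.\<close>

lemma bidual_limit:
  assumes \<Phi>: "\<Phi> \<in> vecs (dual (dual M\<^sub>0))" and \<Phi>x: "\<And>g. g \<in> vecs (dual X) \<Longrightarrow> \<Phi> (J g) = g x"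
    and \<sigma>: "\<And>n. \<sigma> n \<in> vecs M\<^sub>0" "\<And>n. nrm M (\<sigma> n) \<le> B"
    and weak: "\<And>g. g \<in> vecs (dual X) \<Longrightarrow> (\<lambda>n::nat. g (\<sigma> n)) \<longlonglongrightarrow> g x"
    and l: "l \<in> vecs (dual M\<^sub>0)"
  shows "(\<lambda>n. l (\<sigma> n)) \<longlonglongrightarrow> \<Phi> l"
proof (rule LIMSEQ_I)
  fix e :: real assume e: "e > 0"
  define N where "N = nrm (dual (dual M\<^sub>0)) \<Phi> + \<bar>B\<bar>"
  have nn: "nrm (dual (dual M\<^sub>0)) \<Phi> \<ge> 0" using \<Phi> by (rule V'.dual_nrm_nonneg)
  then have N: "N \<ge> 0" by (simp add: N_def)
  \<comment> \<open>Replacing l by g costs ||\<Phi>|| d in the limit and |B| d along the sequence,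
    together at most e / 2; the summand 1 guards against N = 0.\<close>
  define d where "d = e / (2 * (N + 1))"
  have d: "d > 0" using e N by (simp add: d_def)
  obtain g where g: "g \<in> vecs (dual X)" and lg: "\<And>y. y \<in> vecs M\<^sub>0 \<Longrightarrow> norm (l y - g y) \<le> d * nrm M y"
    using functional_approx[OF l d] by blast
  have "norm (\<Phi> l - g x) \<le> nrm (dual (dual M\<^sub>0)) \<Phi> * d"
  proof -
    have "norm (\<Phi> (l - J g)) \<le> nrm (dual (dual M\<^sub>0)) \<Phi> * nrm (dual M\<^sub>0) (l - J g)"
      by (rule V'.dual_bound[OF \<Phi> V'.diff_mem[OF l J_mem[OF g]]])
    also have "\<dots> \<le> nrm (dual (dual M\<^sub>0)) \<Phi> * d"
      using nn nrm_diff_J_le[OF l less_imp_le[OF d] lg] by (intro mult_left_mono)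
    finally show ?thesis using V'.dual_diff[OF \<Phi> l J_mem[OF g]] \<Phi>x[OF g] by simp
  qed
  moreover have "norm (l (\<sigma> n) - g (\<sigma> n)) \<le> \<bar>B\<bar> * d" for n
  proof -
    have "norm (l (\<sigma> n) - g (\<sigma> n)) \<le> d * nrm M (\<sigma> n)" using lg \<sigma> by blast
    also have "\<dots> \<le> d * \<bar>B\<bar>" using d \<sigma>(2)[of n] by (intro mult_left_mono) auto
    finally show ?thesis by (simp add: mult.commute)
  qed
  moreover have "N * d \<le> e / 2"
    using N e by (simp add: d_def field_simps)
  moreover obtain n0 where "\<And>n. n \<ge> n0 \<Longrightarrow> norm (g (\<sigma> n) - g x) < e / 2"
    using LIMSEQ_D[OF weak[OF g], of "e / 2"] e by auto
  moreover have "norm (l (\<sigma> n) - \<Phi> l) \<le> norm (l (\<sigma> n) - g (\<sigma> n)) + norm (g (\<sigma> n) - g x) + norm (\<Phi> l - g x)" for n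
  proof -
    have "l (\<sigma> n) - \<Phi> l = (l (\<sigma> n) - g (\<sigma> n)) + (g (\<sigma> n) - g x) - (\<Phi> l - g x)" by simp
    then show ?thesis
      using norm_triangle_ineq4[of "(l (\<sigma> n) - g (\<sigma> n)) + (g (\<sigma> n) - g x)" "\<Phi> l - g x"]
        norm_triangle_ineq[of "l (\<sigma> n) - g (\<sigma> n)" "g (\<sigma> n) - g x"] by simp
  qed
  moreover have "nrm (dual (dual M\<^sub>0)) \<Phi> * d + \<bar>B\<bar> * d = N * d" by (simp add: N_def distrib_right)
  ultimately have "norm (l (\<sigma> n) - \<Phi> l) < e" if "n \<ge> n0" for n
    using that by (smt (verit) field_sum_of_halves)
  then show "\<exists>n0. \<forall>n\<ge>n0. norm (l (\<sigma> n) - \<Phi> l) < e" by blast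
qed

lemma weak_approximation:
  assumes "x \<in> vecs M"
  obtains \<sigma> :: "nat \<Rightarrow> 'x" where "\<And>n. \<sigma> n \<in> vecs M\<^sub>0" "\<And>n. nrm M (\<sigma> n) \<le> nrm M x"
    "\<And>g. g \<in> vecs (dual X) \<Longrightarrow> (\<lambda>n. g (\<sigma> n)) \<longlonglongrightarrow> g x"
  using A assms unfolding assumption_A_def by blast

text \<open>The sequence of Assumption (A) is bounded in \<open>M\<close> and converges against X*;
  approximating l by functionals from X* makes l (\<sigma> n) Cauchy. The limit functional yields
  surjectivity of the canonical map, and the norm bound in (A) prevents the norm from
  growing.\<close>

lemma bidual_of_M:
  assumes x: "x \<in> vecs M"
  obtains \<Phi> where "\<Phi> \<in> vecs (dual (dual M\<^sub>0))" "\<And>g. g \<in> vecs (dual X) \<Longrightarrow> \<Phi> (J g) = g x"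
    "nrm (dual (dual M\<^sub>0)) \<Phi> \<le> nrm M x"
proof -
  obtain \<sigma> :: "nat \<Rightarrow> 'x" where \<sigma>: "\<And>n. \<sigma> n \<in> vecs M\<^sub>0" "\<And>n. nrm M (\<sigma> n) \<le> nrm M x"
    and weak: "\<And>g. g \<in> vecs (dual X) \<Longrightarrow> (\<lambda>n. g (\<sigma> n)) \<longlonglongrightarrow> g x"
    using weak_approximation[OF x] by blast
  have conv: "convergent (\<lambda>n. l (\<sigma> n))" if l: "l \<in> vecs (dual M\<^sub>0)" for l
  proof (rule scalar_Cauchy_convergent, rule CauchyI)
    fix e :: real assume e: "e > 0"
    have B: "nrm M x \<ge> 0" using x by (rule M.nrm_nonneg)
    define d where "d = e / (4 * (nrm M x + 1))"
    have d: "d > 0" "d * nrm M x \<le> e / 4" using e B by (auto simp: d_def field_simps)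
    obtain g where g: "g \<in> vecs (dual X)" and lg: "\<And>y. y \<in> vecs M\<^sub>0 \<Longrightarrow> norm (l y - g y) \<le> d * nrm M y"
      using functional_approx[OF l d(1)] by blast
    have lg': "norm (l (\<sigma> n) - g (\<sigma> n)) \<le> e / 4" for n
    proof -
      have "d * nrm M (\<sigma> n) \<le> d * nrm M x" using \<sigma>(2) d(1) by (intro mult_left_mono) auto
      then show ?thesis using lg[OF \<sigma>(1), of n] d(2) by linarith
    qed
    have "Cauchy (\<lambda>n. g (\<sigma> n))" using weak[OF g] by (intro convergent_Cauchy convergentI)
    then obtain N where N: "\<And>m n. m \<ge> N \<Longrightarrow> n \<ge> N \<Longrightarrow> norm (g (\<sigma> m) - g (\<sigma> n)) < e / 2"
      using CauchyD[of "\<lambda>n. g (\<sigma> n)" "e / 2"] e by auto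
    have "norm (l (\<sigma> m) - l (\<sigma> n)) < e" if "m \<ge> N" "n \<ge> N" for m n
    proof -
      have "l (\<sigma> m) - l (\<sigma> n) = ((l (\<sigma> m) - g (\<sigma> m)) + (g (\<sigma> m) - g (\<sigma> n))) - (l (\<sigma> n) - g (\<sigma> n))"
        by simp
      then show ?thesis
        using norm_triangle_ineq4[of "(l (\<sigma> m) - g (\<sigma> m)) + (g (\<sigma> m) - g (\<sigma> n))" "l (\<sigma> n) - g (\<sigma> n)"]
          norm_triangle_ineq[of "l (\<sigma> m) - g (\<sigma> m)" "g (\<sigma> m) - g (\<sigma> n)"] lg'[of m] lg'[of n] N[OF that]
        by simp
    qed
    then show "\<exists>N. \<forall>m\<ge>N. \<forall>n\<ge>N. norm (l (\<sigma> m) - l (\<sigma> n)) < e" by blast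
  qed
  define \<Phi> where "\<Phi> l = (if l \<in> vecs (dual M\<^sub>0) then lim (\<lambda>n. l (\<sigma> n)) else 0)" for l
  have lim: "(\<lambda>n. l (\<sigma> n)) \<longlonglongrightarrow> \<Phi> l" if "l \<in> vecs (dual M\<^sub>0)" for l
    using conv[OF that] that by (simp add: \<Phi>_def convergent_LIMSEQ_iff)
  have le: "norm (\<Phi> l) \<le> nrm M x * nrm (dual M\<^sub>0) l" if l: "l \<in> vecs (dual M\<^sub>0)" for l
  proof (rule tendsto_upperbound[OF tendsto_norm[OF lim[OF l]]])
    have "norm (l (\<sigma> n)) \<le> nrm M x * nrm (dual M\<^sub>0) l" for n
    proof -
      have "norm (l (\<sigma> n)) \<le> nrm (dual M\<^sub>0) l * nrm M (\<sigma> n)" using V.dual_bound[OF l \<sigma>(1)] by simp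
      also have "\<dots> \<le> nrm (dual M\<^sub>0) l * nrm M x" using \<sigma>(2) V.dual_nrm_nonneg[OF l] by (rule mult_left_mono)
      finally show ?thesis by (simp add: mult.commute)
    qed
    then show "\<forall>\<^sub>F n in sequentially. norm (l (\<sigma> n)) \<le> nrm M x * nrm (dual M\<^sub>0) l" by simp
  qed simp
  show thesis
  proof (rule that[of \<Phi>])
    show "\<Phi> \<in> vecs (dual (dual M\<^sub>0))"
    proof (rule V'.dual_memI[OF _ le])
      show "linear_functional_on (smul (dual M\<^sub>0)) (vecs (dual M\<^sub>0)) \<Phi>"
        unfolding linear_functional_on_def
      proof (intro conjI ballI allI)
        fix k l assume kl: "k \<in> vecs (dual M\<^sub>0)" "l \<in> vecs (dual M\<^sub>0)"
        have "(\<lambda>n. (k + l) (\<sigma> n)) \<longlonglongrightarrow> \<Phi> k + \<Phi> l" using kl by (simp add: tendsto_add lim)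
        then show "\<Phi> (k + l) = \<Phi> k + \<Phi> l" using lim[OF V'.add_mem[OF kl]] LIMSEQ_unique by blast
      next
        fix c l assume l: "l \<in> vecs (dual M\<^sub>0)"
        have "(\<lambda>n. smul (dual M\<^sub>0) c l (\<sigma> n)) \<longlonglongrightarrow> c * \<Phi> l"
          using l by (simp add: V.smul_dual tendsto_mult_left lim)
        then show "\<Phi> (smul (dual M\<^sub>0) c l) = c * \<Phi> l" using lim[OF V'.smul_mem[OF l]] LIMSEQ_unique by blast
      qed
    qed (simp_all add: \<Phi>_def)
    show "\<Phi> (J g) = g x" if g: "g \<in> vecs (dual X)" for g
      using lim[OF J_mem[OF g]] weak[OF g] LIMSEQ_unique by (simp add: J_apply \<sigma>) blast
    show "nrm (dual (dual M\<^sub>0)) \<Phi> \<le> nrm M x"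
      using le x by (intro V'.dual_nrm_le) (auto simp: M.nrm_nonneg)
  qed
qed

section \<open>The canonical identification of the bidual with \<open>M\<close>\<close>

abbreviation "I \<equiv> canonical_I sX \<tau>"

text \<open>\<open>canonical_I\<close> picks a preimage under the embedding of X into its bidual,
  which is meaningful only on the range of that embedding; reflexivity puts \<Phi> \<circ> J
  there.\<close>

lemma I_char:
  assumes \<Phi>: "\<Phi> \<in> vecs (dual (dual M\<^sub>0))" and g: "g \<in> vecs (dual X)"
  shows "g (I \<Phi>) = \<Phi> (J g)"
proof -
  interpret X': normed "dual X" by unfold_locales (rule X.normed_space_dual)
  define F where "F = adjoint_map (dual X) J \<Phi>"
  obtain C where C: "\<And>g. g \<in> vecs (dual X) \<Longrightarrow> nrm (dual M\<^sub>0) (J g) \<le> nrm (dual X) g * C"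
    using J_bounded by metis
  have J_add: "J (f + g) = J f + J g" and J_smul: "J (smul (dual X) c f) = smul (dual M\<^sub>0) c (J f)" for f g c
    by (auto simp: adjoint_map_def fun_eq_iff X.smul_dual V.smul_dual)
  have F: "F = (\<lambda>g. if g \<in> vecs (dual X) then \<Phi> (J g) else 0)"
    unfolding F_def by (rule adjoint_map_def)
  have "F \<in> vecs (dual (dual X))"
    unfolding F
  proof (rule X'.restrict_in_dual)
    show "linear_functional_on (smul (dual X)) (vecs (dual X)) (\<lambda>g. \<Phi> (J g))"
      by (simp add: linear_functional_on_def J_add J_smul V'.dual_add[OF \<Phi>] V'.dual_smul[OF \<Phi>] J_mem)
    show "norm (\<Phi> (J g)) \<le> (nrm (dual (dual M\<^sub>0)) \<Phi> * C) * nrm (dual X) g" if g: "g \<in> vecs (dual X)" for g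
    proof -
      have "norm (\<Phi> (J g)) \<le> nrm (dual (dual M\<^sub>0)) \<Phi> * nrm (dual M\<^sub>0) (J g)"
        by (rule V'.dual_bound[OF \<Phi> J_mem[OF g]])
      also have "\<dots> \<le> nrm (dual (dual M\<^sub>0)) \<Phi> * (nrm (dual X) g * C)"
        using C[OF g] V'.dual_nrm_nonneg[OF \<Phi>] by (rule mult_left_mono)
      finally show ?thesis by (simp add: mult_ac)
    qed
  qed
  then have "F \<in> bidual_embed X ` UNIV" using reflexive by (simp add: reflexive_space_def)
  then have "bidual_embed X (I \<Phi>) = F"
    unfolding canonical_I_def Let_def F_def[symmetric] by (rule f_inv_into_f)
  then have "bidual_embed X (I \<Phi>) g = F g" by simp
  then show ?thesis using g by (simp add: bidual_embed_def F)
qed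

text \<open>For h in the unit ball of Y* and L in the family, h \<circ> L restricted to
  \<open>M\<^sub>0\<close> has norm at most one by the definition of the M-norm. Hence h (L (I
  \<Phi>)) = \<Phi> (J (h \<circ> L)) is at most ||\<Phi>|| in modulus, uniformly in h and
  L.\<close>

lemma I_in_M:
  assumes \<Phi>: "\<Phi> \<in> vecs (dual (dual M\<^sub>0))"
  shows "I \<Phi> \<in> vecs M" "nrm M (I \<Phi>) \<le> nrm (dual (dual M\<^sub>0)) \<Phi>"
proof -
  have le: "norm (blinfun_apply L (I \<Phi>)) \<le> nrm (dual (dual M\<^sub>0)) \<Phi>" if L: "L \<in> topspace \<tau>" for L
  proof -
    have "nrm Y (blinfun_apply L (I \<Phi>)) \<le> nrm (dual (dual M\<^sub>0)) \<Phi>"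
    proof (rule Y.nrm_le_dual)
      fix h assume h: "h \<in> vecs (dual Y)" "nrm (dual Y) h \<le> 1"
      have h_le: "norm (h y) \<le> norm y" for y
      proof -
        have "norm (h y) \<le> nrm (dual Y) h * norm y" using Y.dual_bound[OF h(1), of y] by simp
        also have "\<dots> \<le> 1 * norm y" using h(2) by (intro mult_right_mono) auto
        finally show ?thesis by simp
      qed
      define g where "g x = h (blinfun_apply L x)" for x
      have g: "g \<in> vecs (dual X)"
      proof (rule X.dual_memI)
        show "linear_functional_on (smul X) (vecs X) g"
          using Y.dual_add[OF h(1)] Y.dual_smul[OF h(1)] L
          by (simp add: linear_functional_on_def g_def blinfun.add_right linear)
        show "norm (g x) \<le> norm L * nrm X x" for x
          using order_trans[OF h_le norm_blinfun] by (simp add: g_def)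
      qed simp
      have "nrm (dual M\<^sub>0) (J g) \<le> 1"
      proof (rule V.dual_nrm_le)
        fix y assume y: "y \<in> vecs M\<^sub>0"
        then have "norm (g y) \<le> nrm M y"
          unfolding g_def using order_trans[OF h_le norm_le_nrm[OF _ L]] M0_subset by blast
        then show "norm (J g y) \<le> 1 * nrm M\<^sub>0 y" using y by (simp add: J_apply)
      qed simp
      have "norm (h (blinfun_apply L (I \<Phi>))) = norm (\<Phi> (J g))" using I_char[OF \<Phi> g] by (simp add: g_def)
      also have "\<dots> \<le> nrm (dual (dual M\<^sub>0)) \<Phi>"
        by (rule V'.dual_bound_unit[OF \<Phi> J_mem[OF g]]) fact
      finally show "norm (h (blinfun_apply L (I \<Phi>))) \<le> nrm (dual (dual M\<^sub>0)) \<Phi>" .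
    qed simp
    then show ?thesis by simp
  qed
  show "I \<Phi> \<in> vecs M" "nrm M (I \<Phi>) \<le> nrm (dual (dual M\<^sub>0)) \<Phi>"
    using M_memI[OF V'.dual_nrm_nonneg[OF \<Phi>] le] by auto
qed

text \<open>The norm equality joins two one-sided bounds: \<open>I_in_M\<close> shows that the map
  does not increase norms, and \<open>bidual_of_M\<close> supplies a preimage of no larger norm,
  which by injectivity is the given element.\<close>

lemma isometric_iso_I: "isometric_iso (dual (dual M\<^sub>0)) M I"
proof -
  let ?B = "vecs (dual (dual M\<^sub>0))"
  have add: "I (\<Phi> + \<Psi>) = I \<Phi> + I \<Psi>" if "\<Phi> \<in> ?B" "\<Psi> \<in> ?B" for \<Phi> \<Psi>
    using that by (intro X_eqI) (simp add: I_char V''.add_mem X.dual_add)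
  have smul: "I (smul (dual (dual M\<^sub>0)) c \<Phi>) = smul M c (I \<Phi>)" if "\<Phi> \<in> ?B" for c \<Phi>
  proof (rule X_eqI)
    fix g assume g: "g \<in> vecs (dual X)"
    have "g (I (smul (dual (dual M\<^sub>0)) c \<Phi>)) = c * g (I \<Phi>)"
      using I_char[OF V''.smul_mem[OF that] g] I_char[OF that g] by (simp add: V'.smul_dual)
    then show "g (I (smul (dual (dual M\<^sub>0)) c \<Phi>)) = g (smul M c (I \<Phi>))"
      using X.dual_smul[OF g, of "I \<Phi>" c] by simp
  qed
  have inj: "\<Phi> = \<Psi>" if "\<Phi> \<in> ?B" "\<Psi> \<in> ?B" "I \<Phi> = I \<Psi>" for \<Phi> \<Psi>
    using that I_char by (intro bidual_eqI) metis+
  have ex: "\<exists>\<Phi>\<in>?B. I \<Phi> = x \<and> nrm (dual (dual M\<^sub>0)) \<Phi> \<le> nrm M x" if x: "x \<in> vecs M" for x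
  proof -
    obtain \<Phi> where \<Phi>: "\<Phi> \<in> ?B" "\<And>g. g \<in> vecs (dual X) \<Longrightarrow> \<Phi> (J g) = g x"
      "nrm (dual (dual M\<^sub>0)) \<Phi> \<le> nrm M x"
      using bidual_of_M[OF x] by blast
    have "I \<Phi> = x" using \<Phi> by (intro X_eqI) (simp add: I_char)
    then show ?thesis using \<Phi> by blast
  qed
  have nrm: "nrm M (I \<Phi>) = nrm (dual (dual M\<^sub>0)) \<Phi>" if \<Phi>: "\<Phi> \<in> ?B" for \<Phi>
  proof (rule antisym[OF I_in_M(2)[OF \<Phi>]])
    obtain \<Psi> where "\<Psi> \<in> ?B" "I \<Psi> = I \<Phi>" "nrm (dual (dual M\<^sub>0)) \<Psi> \<le> nrm M (I \<Phi>)"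
      using ex[OF I_in_M(1)[OF \<Phi>]] by blast
    then show "nrm (dual (dual M\<^sub>0)) \<Phi> \<le> nrm M (I \<Phi>)" using inj \<Phi> by metis
  qed
  have "I ` ?B = vecs M" using ex I_in_M by blast
  moreover have "inj_on I ?B" using inj by (rule inj_onI)
  ultimately show ?thesis
    using add smul nrm unfolding isometric_iso_def linear_map_def bij_betw_def by blast
qed

section \<open>Approximation by elements of \<open>M\<^sub>0\<close> in the norm of X\<close>

text \<open>A Mazur-type passage from weak to norm approximation. If it failed, Hahn-Banach would
  give g in X* with |g| \<le> ||.||_M on \<open>M\<^sub>0\<close> and g x real and at least 2,
  whereas the sequence of (A) forces |g x| \<le> 1. Allowing norm 2 instead of 1 creates the
  gap.\<close>

lemma norm_approximation:
  assumes x: "x \<in> vecs M" "nrm M x \<le> 1" and \<eta>: "0 < \<eta>"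
  obtains z where "z \<in> vecs M\<^sub>0" "nrm M z \<le> 2" "norm (z - x) < \<eta>"
proof (rule ccontr)
  assume no: "\<not> thesis"
  note witness = that
  \<comment> \<open>The weight 2 / \<eta> makes every z at distance at least \<eta> from x pay 2 in
    the second term; a z of M-norm above 2 pays it in the first.\<close>
  have \<kappa>: "2 \<le> nrm M z + 2 / \<eta> * norm (x - z)" if z: "z \<in> vecs M\<^sub>0" for z
  proof (cases "nrm M z \<le> 2")
    case True
    then have "\<not> norm (z - x) < \<eta>" using witness[OF z] no by blast
    then have "2 \<le> 2 / \<eta> * norm (x - z)" using \<eta> by (simp add: norm_minus_commute field_simps)
    then show ?thesis using V.nrm_nonneg[OF z] by simp
  next
    case False
    then show ?thesis using \<eta> by (simp add: add_increasing2)
  qed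
  have p1: "seminorm_on sX (vecs M\<^sub>0) (nrm M)" using V.seminorm_nrm by simp
  have p2: "seminorm_on sX UNIV (\<lambda>y. 2 / \<eta> * norm y)"
    unfolding seminorm_on_def
  proof (intro conjI ballI allI)
    show "2 / \<eta> * norm (x + y) \<le> 2 / \<eta> * norm x + 2 / \<eta> * norm y" for x y :: 'x
      using mult_left_mono[OF norm_triangle_ineq, of "2 / \<eta>" x y] \<eta> by (simp add: distrib_left)
  qed (simp add: norm_sX)
  have subs: "module.subspace sX UNIV" "module.subspace sX (vecs M\<^sub>0)"
    using X.subspace_UNIV V.subspace_vecs by simp_all
  have vs: "vector_space sX" using X.vector_space_axioms by simp
  obtain g r where g: "linear_functional_on sX UNIV g" "g x = of_real r" "2 \<le> r"
    and g1: "\<And>y. y \<in> vecs M\<^sub>0 \<Longrightarrow> norm (g y) \<le> nrm M y" and g2: "\<And>y. norm (g y) \<le> 2 / \<eta> * norm y"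
    using hahn_banach_inf_convolution[OF vs subs subset_UNIV p1 p2 UNIV_I \<kappa>] by (metis UNIV_I)
  have "g \<in> vecs (dual X)" using g g2 by (intro X.dual_memI[of _ "2 / \<eta>"]) auto
  moreover obtain \<sigma> :: "nat \<Rightarrow> 'x" where \<sigma>: "\<And>n. \<sigma> n \<in> vecs M\<^sub>0" "\<And>n. nrm M (\<sigma> n) \<le> nrm M x"
    and weak: "\<And>g. g \<in> vecs (dual X) \<Longrightarrow> (\<lambda>n. g (\<sigma> n)) \<longlonglongrightarrow> g x"
    using weak_approximation[OF x(1)] by blast
  ultimately have lim: "(\<lambda>n. norm (g (\<sigma> n))) \<longlonglongrightarrow> norm (g x)" by (intro tendsto_norm)
  have "norm (g (\<sigma> n)) \<le> 1" for n using g1[OF \<sigma>(1), of n] \<sigma>(2)[of n] x(2) by linarith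
  then have "norm (g x) \<le> 1" by (intro tendsto_upperbound[OF lim]) auto
  then show False using g by simp
qed

text \<open>Averaging a gliding sequence of approximants leaves \<open>\<parallel>L (x - \<xi>\<^sub>i)\<parallel>\<close> larger than about \<open>1\<close> for a single
  \<open>i\<close> only, whose contribution is diluted in the mean.\<close>

lemma average_approximation:
  assumes x: "x \<in> vecs M" "nrm M x \<le> 1" and \<delta>: "0 < \<delta>"
  obtains z where "z \<in> vecs M\<^sub>0" "norm (x - z) \<le> \<delta>" "nrm M (x - z) \<le> 1 + \<delta>"
proof -
  define A where "A = {z\<in>vecs M\<^sub>0. nrm M z \<le> 2}"
  have A0: "A \<subseteq> vecs M\<^sub>0" by (auto simp: A_def)
  have near: "\<exists>\<xi>\<in>A. norm (\<xi> - x) < \<eta>" if "\<eta> > 0" for \<eta>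
    using norm_approximation[OF x that] unfolding A_def by blast
  \<comment> \<open>One half of \<delta> pays for the hump tolerance, the other for the exceptional
    index.\<close>
  define \<eta> where "\<eta> = \<delta> / 2"
  have \<eta>: "\<eta> > 0" using \<delta> by (simp add: \<eta>_def)
  obtain \<xi> :: "nat \<Rightarrow> 'x" where \<xi>A: "\<And>n. \<xi> n \<in> A" and \<xi>x: "\<And>n. norm (\<xi> n - x) < \<eta>"
    and \<xi>: "\<And>L. L \<in> topspace \<tau> \<Longrightarrow>
       \<exists>j. \<forall>i. i \<noteq> j \<longrightarrow> norm (blinfun_apply L (\<xi> i)) \<le> \<eta> \<or> norm (blinfun_apply L (\<xi> i - x)) \<le> \<eta>"
    using gliding_hump[OF A0 near \<eta>] by blast
  \<comment> \<open>The exceptional term is at most 3 = 1 + 2, from ||L x|| \<le> 1 and ||L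
    \<xi>_i|| \<le> 2; the mean over n terms reduces it to at most \<eta>.\<close>
  obtain n :: nat where n: "3 / \<eta> < real n" using reals_Archimedean2 by blast
  have "0 < 3 / \<eta>" using \<eta> by simp
  then have n0: "real n > 0" using n by linarith
  have n3: "3 / real n \<le> \<eta>" using n n0 \<eta> by (simp add: field_simps)
  define z where "z = (1 / real n) *\<^sub>R (\<Sum>i<n. \<xi> i)"
  have z: "z \<in> vecs M\<^sub>0"
  proof -
    have "(\<Sum>i<n. \<xi> i) \<in> vecs M\<^sub>0" using \<xi>A A0 by (intro V.subspace_sum[OF V.subspace_vecs]) auto
    from V.smul_mem[OF this, of "of_real (1 / real n)"] show ?thesis unfolding z_def space_simps sX_of_real .
  qed
  have diff: "x - z = (1 / real n) *\<^sub>R (\<Sum>i<n. x - \<xi> i)"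
    using n0 by (simp add: z_def sum_subtractf scaleR_right_diff_distrib sum_constant_scaleR)
  have "norm (x - z) \<le> \<delta>"
  proof -
    have "norm (\<Sum>i<n. x - \<xi> i) \<le> (\<Sum>i<n. norm (x - \<xi> i))" by (rule norm_sum)
    also have "\<dots> \<le> (\<Sum>i<n. \<eta>)" using \<xi>x by (intro sum_mono) (simp add: norm_minus_commute less_imp_le)
    finally have "norm (x - z) \<le> \<eta>" using n0 by (simp add: diff field_simps)
    then show ?thesis using \<delta> by (simp add: \<eta>_def)
  qed
  moreover have "nrm M (x - z) \<le> 1 + \<delta>"
  proof (rule M_memI(2))
    fix L assume L: "L \<in> topspace \<tau>"
    obtain j where j: "\<And>i. i \<noteq> j \<Longrightarrow> norm (blinfun_apply L (\<xi> i)) \<le> \<eta> \<or> norm (blinfun_apply L (\<xi> i - x)) \<le> \<eta>"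
      using \<xi>[OF L] by blast
    have Lx: "norm (blinfun_apply L x) \<le> 1" using norm_le_nrm[OF x(1) L] x(2) by simp
    have split: "norm (blinfun_apply L (x - \<xi> i)) \<le> norm (blinfun_apply L x) + norm (blinfun_apply L (\<xi> i))" for i
      by (simp add: blinfun.diff_right norm_triangle_ineq4)
    have flip: "norm (blinfun_apply L (\<xi> i - x)) = norm (blinfun_apply L (x - \<xi> i))" for i
      by (simp add: blinfun.diff_right norm_minus_commute)
    have "norm (blinfun_apply L (x - \<xi> i)) \<le> 1 + \<eta>" if "i \<noteq> j" for i
      using j[OF that] split[of i] Lx \<eta> unfolding flip by linarith
    moreover have "norm (blinfun_apply L (x - \<xi> i)) \<le> 3" for i
    proof -
      have "norm (blinfun_apply L (\<xi> i)) \<le> 2"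
        using norm_le_nrm[OF _ L, of "\<xi> i"] \<xi>A[of i] M0_subset unfolding A_def by force
      then show ?thesis using split[of i] Lx by linarith
    qed
    ultimately have "(\<Sum>i<n. norm (blinfun_apply L (x - \<xi> i))) \<le> real n * (1 + \<eta>) + 3"
      using \<eta> by (intro sum_le_all_but_one) auto
    then have "norm (\<Sum>i<n. blinfun_apply L (x - \<xi> i)) \<le> real n * (1 + \<eta>) + 3"
      by (rule order_trans[OF norm_sum])
    moreover have "norm (blinfun_apply L (x - z)) = (1 / real n) * norm (\<Sum>i<n. blinfun_apply L (x - \<xi> i))"
      by (simp add: diff blinfun.scaleR_right blinfun.sum_right)
    ultimately have "norm (blinfun_apply L (x - z)) \<le> (1 / real n) * (real n * (1 + \<eta>) + 3)"
      using n0 by (simp only:) (intro mult_left_mono, simp_all)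
    also have "\<dots> = 1 + \<eta> + 3 / real n" using n0 by (simp add: field_simps)
    also have "\<dots> \<le> 1 + \<delta>" using n3 by (simp add: \<eta>_def)
    finally show "norm (blinfun_apply L (x - z)) \<le> 1 + \<delta>" .
  qed (use \<delta> in simp)
  ultimately show thesis using z that by blast
qed

section \<open>\<open>M\<^sub>0\<close> as an M-ideal in \<open>M\<close>\<close>

abbreviation "E \<equiv> inv_into (vecs (dual (dual M\<^sub>0))) I"

lemma isometric_iso_E: "isometric_iso M (dual (dual M\<^sub>0)) E"
  by (rule isometric_iso_inverse[OF V'.normed_space_dual isometric_iso_I])

lemma E_mem: "x \<in> vecs M \<Longrightarrow> E x \<in> vecs (dual (dual M\<^sub>0))"
  using isometric_iso_E by (auto simp: isometric_iso_def linear_map_def)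

lemma E_J:
  assumes x: "x \<in> vecs M" and g: "g \<in> vecs (dual X)"
  shows "E x (J g) = g x"
proof -
  have "bij_betw I (vecs (dual (dual M\<^sub>0))) (vecs M)"
    using isometric_iso_I unfolding isometric_iso_def by (elim conjE)
  then have "I (E x) = x" using x by (rule bij_betw_inv_into_right)
  then show ?thesis using I_char[OF E_mem[OF x] g] by simp
qed

lemma E_limit:
  assumes x: "x \<in> vecs M" and \<sigma>: "\<And>n. \<sigma> n \<in> vecs M\<^sub>0" "\<And>n. nrm M (\<sigma> n) \<le> B"
    and weak: "\<And>g. g \<in> vecs (dual X) \<Longrightarrow> (\<lambda>n::nat. g (\<sigma> n)) \<longlonglongrightarrow> g x"
    and l: "l \<in> vecs (dual M\<^sub>0)"
  shows "(\<lambda>n. l (\<sigma> n)) \<longlonglongrightarrow> E x l"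
  by (rule bidual_limit[OF E_mem[OF x] E_J[OF x] \<sigma> weak l])

text \<open>The hypothesis \<open>goldstine\<close> comes from Assumption (A). For
  \<open>approx\<close>, operators are split by a compact \<open>K\<close> outside which
  \<open>L y\<close> is small: on \<open>K\<close> the image of x - \<sigma> n is small because x -
  \<sigma> n is small in X, and off \<open>K\<close> it has norm at most about 1. So y and x -
  \<sigma> n are never both large under the same L.\<close>

lemma m_embedded_M0: "m_embedded M\<^sub>0 M E"
proof
  show "vecs M\<^sub>0 \<subseteq> vecs M" by (rule M0_subset)
  show "isometric_iso M (dual (dual M\<^sub>0)) E" by (rule isometric_iso_E)
  show "E y l = l y" if y: "y \<in> vecs M\<^sub>0" and l: "l \<in> vecs (dual M\<^sub>0)" for y l
  proof -
    \<comment> \<open>The constant sequence y approximates y, and limits are unique.\<close>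
    have "(\<lambda>n::nat. l y) \<longlonglongrightarrow> E y l"
      using y M0_subset l by (intro E_limit[of y "\<lambda>_. y" "nrm M y"]) auto
    then show ?thesis by (simp add: LIMSEQ_const_iff)
  qed
next
  fix x assume x: "x \<in> vecs M" "nrm M x \<le> 1"
  obtain \<sigma> :: "nat \<Rightarrow> 'x" where \<sigma>: "\<And>n. \<sigma> n \<in> vecs M\<^sub>0" "\<And>n. nrm M (\<sigma> n) \<le> nrm M x"
    and weak: "\<And>g. g \<in> vecs (dual X) \<Longrightarrow> (\<lambda>n. g (\<sigma> n)) \<longlonglongrightarrow> g x"
    using weak_approximation[OF x(1)] by blast
  have "(\<lambda>n. l (\<sigma> n)) \<longlonglongrightarrow> E x l" if "l \<in> vecs (dual M\<^sub>0)" for l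
    by (rule E_limit[OF x(1) \<sigma> weak that])
  moreover have "nrm M (\<sigma> n) \<le> 1" for n using \<sigma>(2)[of n] x(2) by simp
  ultimately show "\<exists>\<sigma>. (\<forall>n. \<sigma> n \<in> vecs M\<^sub>0 \<and> nrm M (\<sigma> n) \<le> 1) \<and>
      (\<forall>l\<in>vecs (dual M\<^sub>0). (\<lambda>n::nat. l (\<sigma> n)) \<longlonglongrightarrow> E x l)"
    using \<sigma>(1) by blast
next
  fix x assume x: "x \<in> vecs M" "nrm M x \<le> 1"
  have "\<exists>z. z \<in> vecs M\<^sub>0 \<and> norm (x - z) \<le> inverse (real (Suc n)) \<and> nrm M (x - z) \<le> 1 + inverse (real (Suc n))" for n
    using average_approximation[OF x, of "inverse (real (Suc n))"] by auto
  then obtain \<sigma> where \<sigma>: "\<And>n. \<sigma> n \<in> vecs M\<^sub>0"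
    and \<sigma>x: "\<And>n. norm (x - \<sigma> n) \<le> inverse (real (Suc n))"
    and \<sigma>M: "\<And>n. nrm M (x - \<sigma> n) \<le> 1 + inverse (real (Suc n))" by metis
  have \<sigma>_mem: "\<sigma> n \<in> vecs M" for n using \<sigma> M0_subset by blast
  have d_mem: "x - \<sigma> n \<in> vecs M" for n using x(1) \<sigma>_mem by (rule M.diff_mem)
  have \<sigma>x0: "(\<lambda>n. norm (x - \<sigma> n)) \<longlonglongrightarrow> 0"
    using \<sigma>x by (intro tendsto_sandwich[OF _ _ tendsto_const LIMSEQ_inverse_real_of_nat]) auto
  \<comment> \<open>A bound in \<open>M\<close> is what upgrades convergence against X* to
    convergence against \<open>dual M\<^sub>0\<close>; the constant is 1 + (1 + 1).\<close>
  have \<sigma>3: "nrm M (\<sigma> n) \<le> 3" for n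
  proof -
    have "nrm M (x - (x - \<sigma> n)) \<le> nrm M x + nrm M (x - \<sigma> n)" by (rule M.nrm_diff[OF x(1) d_mem])
    moreover have "inverse (real (Suc n)) \<le> 1" by (simp add: inverse_le_1_iff)
    ultimately show ?thesis using \<sigma>M[of n] x(2) by simp
  qed
  have weak: "(\<lambda>n. g (\<sigma> n)) \<longlonglongrightarrow> g x" if g: "g \<in> vecs (dual X)" for g
  proof (rule LIM_zero_cancel, rule tendsto_norm_zero_cancel)
    show "(\<lambda>n. norm (g (\<sigma> n) - g x)) \<longlonglongrightarrow> 0"
    proof (rule tendsto_sandwich[OF _ _ tendsto_const tendsto_mult_right_zero[OF \<sigma>x0]])
      show "\<forall>\<^sub>F n in sequentially. norm (g (\<sigma> n) - g x) \<le> nrm (dual X) g * norm (x - \<sigma> n)"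
        using X.dual_bound[OF g, of "x - \<sigma> _"] X.dual_diff[OF g]
        by (intro always_eventually) (simp add: norm_minus_commute)
    qed simp
  qed
  have lim: "(\<lambda>n. l (\<sigma> n)) \<longlonglongrightarrow> E x l" if "l \<in> vecs (dual M\<^sub>0)" for l
    by (rule E_limit[OF x(1) \<sigma> \<sigma>3 weak that])
  have ev: "\<forall>\<^sub>F n in sequentially. \<forall>a. norm a \<le> 1 \<longrightarrow> nrm M (y + smul M a (x - \<sigma> n)) \<le> 1 + e"
    if y: "y \<in> vecs M\<^sub>0" "nrm M y \<le> 1" and e: "e > 0" for y and e :: real
  proof -
    have yM: "y \<in> vecs M" using y M0_subset by blast
    obtain K where K: "compactin \<tau> K" "\<And>L. L \<in> topspace \<tau> - K \<Longrightarrow> norm (blinfun_apply L y) \<le> e / 2"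
      using M0_small[OF y(1), of "e / 2"] e by auto
    obtain C where C: "0 \<le> C" "\<And>L x. L \<in> K \<Longrightarrow> norm (blinfun_apply L x) \<le> C * norm x"
      using compact_bound[OF K(1)] by blast
    \<comment> \<open>On \<open>K\<close> the budget 1 + e is spent as 1 on y and e on the
      difference; off \<open>K\<close> it is e / 2 on y and 1 + e / 2 on the difference.\<close>
    have "\<forall>\<^sub>F n in sequentially. C * norm (x - \<sigma> n) < e"
      using order_tendstoD(2)[OF tendsto_mult_right_zero[OF \<sigma>x0, of C] e] .
    moreover have "\<forall>\<^sub>F n in sequentially. inverse (real (Suc n)) < e / 2"
      using order_tendstoD(2)[OF LIMSEQ_inverse_real_of_nat, of "e / 2"] e by simp
    ultimately show ?thesis
    proof eventually_elim
      case (elim n)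
      show ?case
      proof (intro allI impI)
        fix a :: 'k assume a: "norm a \<le> 1"
        show "nrm M (y + smul M a (x - \<sigma> n)) \<le> 1 + e"
        proof (rule M_memI(2))
          fix L assume L: "L \<in> topspace \<tau>"
          define d where "d = norm (blinfun_apply L (x - \<sigma> n))"
          have "norm (blinfun_apply L (y + smul M a (x - \<sigma> n))) \<le> norm (blinfun_apply L y) + norm a * d"
            using norm_triangle_ineq[of "blinfun_apply L y" "sY a (blinfun_apply L (x - \<sigma> n))"] L
            by (simp add: blinfun.add_right linear norm_sY d_def)
          moreover have "norm a * d \<le> d" using mult_right_mono[OF a, of d] by (simp add: d_def)
          moreover have "norm (blinfun_apply L y) + d \<le> 1 + e"
          proof (cases "L \<in> K")
            case True
            have "d \<le> C * norm (x - \<sigma> n)" using C(2)[OF True] by (simp add: d_def)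
            then show ?thesis using elim(1) norm_le_nrm[OF yM L] y(2) by linarith
          next
            case False
            have "d \<le> 1 + inverse (real (Suc n))"
              unfolding d_def using norm_le_nrm[OF d_mem L] \<sigma>M by (rule order_trans)
            then show ?thesis using elim(2) K(2)[of L] L False by simp
          qed
          ultimately show "norm (blinfun_apply L (y + smul M a (x - \<sigma> n))) \<le> 1 + e" by linarith
        qed (use e in simp)
      qed
    qed
  qed
  show "\<exists>\<sigma>. (\<forall>n. \<sigma> n \<in> vecs M\<^sub>0) \<and> (\<forall>l\<in>vecs (dual M\<^sub>0). (\<lambda>n::nat. l (\<sigma> n)) \<longlonglongrightarrow> E x l) \<and>
      (\<forall>y\<in>vecs M\<^sub>0. nrm M y \<le> 1 \<longrightarrow> (\<forall>e>0. \<forall>\<^sub>F n in sequentially.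
         \<forall>a. norm a \<le> 1 \<longrightarrow> nrm M (y + smul M a (x - \<sigma> n)) \<le> 1 + e))"
    by (intro exI[of _ \<sigma>] conjI ballI allI impI \<sigma> lim ev)
qed simp_all

end

theorem corollary1p3:
  fixes sX :: "'k::real_or_complex \<Rightarrow> 'x::banach \<Rightarrow> 'x"
    and sY :: "'k \<Rightarrow> 'y::banach \<Rightarrow> 'y"
    and \<L> :: "('x \<Rightarrow>\<^sub>L 'y) set"
    and \<tau> :: "('x \<Rightarrow>\<^sub>L 'y) topology"
  assumes "normed_scaling sX" and "normed_scaling sY"
    and separable: "\<exists>D::'x set. countable D \<and> closure D = UNIV"
    and reflexive: "reflexive_space (type_space sX)"
    and linear: "\<And>L c x. L \<in> \<L> \<Longrightarrow> blinfun_apply L (sX c x) = sY c (blinfun_apply L x)"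
    and "topspace \<tau> = \<L>"
    and "Hausdorff_space \<tau>" and "sigma_compact_space \<tau>" and "locally_compact_space \<tau>"
    and continuous: "\<And>x. continuous_map \<tau> euclidean (\<lambda>L. blinfun_apply L x)"
    and dense: "closure (vecs (M_space sX \<L>)) = UNIV"
    and M_banach: "banach_space (M_space sX \<L>)"
    and M_embeds: "\<exists>C. \<forall>x\<in>vecs (M_space sX \<L>). norm x \<le> C * nrm (M_space sX \<L>) x"
    and A: "assumption_A sX \<tau>"
    and neq: "vecs (M0_space sX \<tau>) \<noteq> vecs (M_space sX \<L>)"
  shows "(isometric_iso (dual (dual (M0_space sX \<tau>))) (M_space sX \<L>) (canonical_I sX \<tau>) \<and>
          strongly_unique_predual TYPE('w::ab_group_add) (dual (M0_space sX \<tau>))) \<and>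
         \<not> strongly_unique_predual TYPE('x) (M0_space sX \<tau>)"
proof -
  have \<L>: "\<L> = topspace \<tau>" using assms(6) by simp
  interpret o_O_spaces sX sY \<tau>
    using assms(1,2) reflexive linear continuous M_banach M_embeds A unfolding \<L> by unfold_locales
  interpret embedded: m_embedded M\<^sub>0 M E
    by (rule m_embedded_M0)
  show ?thesis
    unfolding \<L>
    using isometric_iso_I embedded.dual_strongly_unique_predual
      embedded.not_strongly_unique_predual[OF banach_space_M0] neq \<L> by blast
qed

end
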